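(* Let $z,z'$ be admissible parameters with $|z+z'|<1$, let $n\ge1$, and let $\mathfrak{p}=(p_1^+,\dots,p_n^+;p_1^-,\dots,p_n^-)\in\mathbb{R}_+^n\times\mathbb{R}_-^n$ be a $2n$-tuple of distinct points. For $\delta>0$ and $X\in\mathrm{Conf}(\mathbb{R}^* )$ put $$D_\delta(X)=\sum_{i=1}^n\Big(\sum_{x\in X\cap(\delta,\infty)}\log\Big|\frac{x/p_i^+-1}{x/p_i^--1}\Big|^2+\sum_{x\in X\cap(-\infty,-\delta)}\log\Big|\frac{x/p_i^--1}{x/p_i^+-1}\Big|^2\Big).$$ Then the limit $$\overline{S}_{\mathfrak{p}}(X):=\lim_{\delta\to0^+}\big\{D_\delta(X)-\mathbb{E}_{\mathscr{P}_{z,z'}}D_\delta\big\}$$ exists for $\mathscr{P}_{z,z'}$-almost every $X\in\mathrm{Conf}(\mathbb{R}^* )$. Moreover, $\exp(\overline{S}_{\mathfrak{p}})\in L^1(\mathrm{Conf}(\mathbb{R}^* ),\mathscr{P}_{z,z'})$.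
   Context: $\mathbb{R}^*=\mathbb{R}\setminus\{0\}=\mathbb{R}_+\sqcup\mathbb{R}_-$ (open positive and negative semi-axes). $\mathrm{Conf}(\mathbb{R}^* )$ is the set of subsets $X\subset\mathbb{R}^*$ with $\#(X\cap B)<\infty$ for every compact $B\subset\mathbb{R}^*$, with the Borel structure generated by the maps $X\mapsto\#(X\cap B)$, $B$ relatively compact Borel. A point process is a Borel probability measure on $\mathrm{Conf}(\mathbb{R}^* )$. It is determinantal with correlation kernel $K$ if for all $k\ge1$ and disjoint relatively compact Borel $D_1,\dots,D_k$, $\mathbb{E}\prod_{i=1}^k\#(X\cap D_i)=\int_{D_1\times\cdots\times D_k}\det(K(x_i,x_j))_{1\le i,j\le k}\,dx_1\cdots dx_k$. Admissible parameters and Whittaker kernels. $z,z'\in\mathbb{C}$ are admissible if either $z'=\bar z$, $z\in\mathbb{C}\setminus\mathbb{Z}$; or $z,z'\in\mathbb{R}$ and $m<z,z'<m+1$ for some $m\in\mathbb{Z}$. For $x>0$ set $$\mathcal{P}_\pm(x)=\frac{(zz')^{1/4}}{(\Gamma(1\pm z)\Gamma(1\pm z')x)^{1/2}}W_{\frac{\pm(z+z')+1}{2},\frac{z-z'}{2}}(x),\quad \mathcal{Q}_\pm(x)=\frac{(zz')^{3/4}}{(\Gamma(1\pm z)\Gamma(1\pm z')x)^{1/2}}W_{\frac{\pm(z+z')-1}{2},\frac{z-z'}{2}}(x),$$ where $\Gamma$ is the Euler Gamma function and $W_{a,b}$ the Whittaker function. The Whittaker kernel $\mathcal{K}_{z,z'}(x,y)$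 is $\frac{\mathcal{P}_+(x)\mathcal{Q}_+(y)-\mathcal{Q}_+(x)\mathcal{P}_+(y)}{x-y}$ for $x,y>0$; $\frac{\mathcal{P}_+(x)\mathcal{P}_-(-y)+\mathcal{Q}_+(x)\mathcal{Q}_-(-y)}{x-y}$ for $x>0,y<0$; $\frac{\mathcal{P}_-(-x)\mathcal{P}_+(y)+\mathcal{Q}_-(-x)\mathcal{Q}_+(y)}{x-y}$ for $x<0,y>0$; $\frac{\mathcal{P}_-(-x)\mathcal{Q}_-(-y)-\mathcal{Q}_-(-x)\mathcal{P}_-(-y)}{y-x}$ for $x,y<0$ (extended by continuity to the diagonal). By Borodin and Olshanski, it is the correlation kernel of a determinantal point process on $\mathbb{R}^*$, denoted $\mathscr{P}_{z,z'}$. *)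

theory Defs
  imports "HOL-Probability.Probability" "Jordan_Normal_Form.Determinant"
begin

definition rel_compact_borel :: "real set \<Rightarrow> bool" where
  "rel_compact_borel B \<longleftrightarrow> B \<in> sets borel \<and> (\<exists>C. compact C \<and> C \<subseteq> - {0} \<and> B \<subseteq> C)"

definition Conf :: "real set set" where
  "Conf = {X. X \<subseteq> - {0} \<and> (\<forall>B. compact B \<and> B \<subseteq> - {0} \<longrightarrow> finite (X \<inter> B))}"

definition conf_space :: "real set measure" where
  "conf_space = sigma Conf
     {(\<lambda>X. card (X \<inter> B)) -` {m} \<inter> Conf | B m. rel_compact_borel B}"

definition point_process :: "real set measure \<Rightarrow> bool" where
  "point_process M \<longleftrightarrow> prob_space M \<and> sets M = sets conf_space"

text \<open>Both integrals are required to converge, since the Bochner integral of a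
  non-integrable function is \<open>0\<close> by convention.\<close>

definition determinantal :: "real set measure \<Rightarrow> (real \<Rightarrow> real \<Rightarrow> complex) \<Rightarrow> bool" where
  "determinantal M K \<longleftrightarrow> point_process M \<and>
     (\<forall>k\<ge>1. \<forall>D :: nat \<Rightarrow> real set.
        (\<forall>i<k. rel_compact_borel (D i)) \<and> disjoint_family_on D {..<k} \<longrightarrow>
        integrable M (\<lambda>X. \<Prod>i<k. real (card (X \<inter> D i))) \<and>
        set_integrable (Pi\<^sub>M {..<k} (\<lambda>_. lborel)) (Pi\<^sub>E {..<k} D)
          (\<lambda>x. Determinant.det (Matrix.mat k k (\<lambda>(i, j). K (x i) (x j)))) \<and>
        complex_of_real (\<integral>X. (\<Prod>i<k. real (card (X \<inter> D i))) \<partial>M) =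
          set_lebesgue_integral (Pi\<^sub>M {..<k} (\<lambda>_. lborel)) (Pi\<^sub>E {..<k} D)
            (\<lambda>x. Determinant.det (Matrix.mat k k (\<lambda>(i, j). K (x i) (x j)))))"

definition admissible :: "complex \<Rightarrow> complex \<Rightarrow> bool" where
  "admissible z z' \<longleftrightarrow>
     (z' = cnj z \<and> z \<notin> \<int>) \<or>
     (z \<in> \<real> \<and> z' \<in> \<real> \<and>
       (\<exists>m :: int. of_int m < Re z \<and> Re z < of_int m + 1 \<and>
                   of_int m < Re z' \<and> Re z' < of_int m + 1))"

text \<open>The Whittaker function \<open>W\<^bsub>a,b\<^esub>\<close> on the positive half-line is the solution of
  Whittaker's equation \<open>w'' + (-1/4 + a/x + (1/4 - b\<^sup>2)/x\<^sup>2) w = 0\<close> that is recessive at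
  infinity, normalised by \<open>w(x) \<sim> exp(-x/2) x\<^sup>a\<close>.  These conditions determine
  \<open>w\<close> on \<open>x > 0\<close>, and only there.\<close>

definition is_whittaker_W :: "complex \<Rightarrow> complex \<Rightarrow> (real \<Rightarrow> complex) \<Rightarrow> bool" where
  "is_whittaker_W a b w \<longleftrightarrow>
     (\<exists>w'. \<forall>x>0. (w has_vector_derivative w' x) (at x) \<and>
        (w' has_vector_derivative
           - ((- 1/4 + a / of_real x + (1/4 - b\<^sup>2) / (of_real x)\<^sup>2) * w x)) (at x)) \<and>
     ((\<lambda>x. w x / (exp (- of_real x / 2) * of_real x powr a)) \<longlongrightarrow> 1) at_top"

definition whittaker_W :: "complex \<Rightarrow> complex \<Rightarrow> real \<Rightarrow> complex" where
  "whittaker_W a b x = (THE v. \<exists>w. is_whittaker_W a b w \<and> v = w x)"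

text \<open>In the next two definitions the sign \<open>\<plusminus>\<close> is the argument \<open>s \<in> {1, -1}\<close>.  For
  admissible parameters \<open>z z'\<close> and \<open>\<Gamma>(1 \<plusminus> z) \<Gamma>(1 \<plusminus> z')\<close> are positive reals, so
  that the principal branches taken by \<^const>\<open>powr\<close> are the positive roots.\<close>

definition whittaker_P :: "complex \<Rightarrow> complex \<Rightarrow> complex \<Rightarrow> real \<Rightarrow> complex" where
  "whittaker_P s z z' x =
     (z * z') powr (1/4) / (Gamma (1 + s * z) * Gamma (1 + s * z') * of_real x) powr (1/2)
     * whittaker_W ((s * (z + z') + 1) / 2) ((z - z') / 2) x"

definition whittaker_Q :: "complex \<Rightarrow> complex \<Rightarrow> complex \<Rightarrow> real \<Rightarrow> complex" where
  "whittaker_Q s z z' x =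
     (z * z') powr (3/4) / (Gamma (1 + s * z) * Gamma (1 + s * z') * of_real x) powr (1/2)
     * whittaker_W ((s * (z + z') - 1) / 2) ((z - z') / 2) x"

definition whittaker_kernel_offdiag ::
    "complex \<Rightarrow> complex \<Rightarrow> real \<Rightarrow> real \<Rightarrow> complex" where
  "whittaker_kernel_offdiag z z' x y =
    (let Pp = whittaker_P 1 z z'; Qp = whittaker_Q 1 z z';
         Pm = whittaker_P (- 1) z z'; Qm = whittaker_Q (- 1) z z'
     in if x > 0 \<and> y > 0 then (Pp x * Qp y - Qp x * Pp y) / of_real (x - y)
        else if x > 0 \<and> y < 0 then (Pp x * Pm (- y) + Qp x * Qm (- y)) / of_real (x - y)
        else if x < 0 \<and> y > 0 then (Pm (- x) * Pp y + Qm (- x) * Qp y) / of_real (x - y)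
        else if x < 0 \<and> y < 0 then (Pm (- x) * Qm (- y) - Qm (- x) * Pm (- y)) / of_real (y - x)
        else 0)"

definition whittaker_kernel :: "complex \<Rightarrow> complex \<Rightarrow> real \<Rightarrow> real \<Rightarrow> complex" where
  "whittaker_kernel z z' x y =
    (if x = y then Lim (at x) (whittaker_kernel_offdiag z z' x)
     else whittaker_kernel_offdiag z z' x y)"

text \<open>For an arbitrary configuration the inner sums may have infinitely many terms
  (accumulating at infinity), hence \<^const>\<open>infsum\<close>.  The convention \<open>ln 0 = 0\<close> only matters for
  configurations containing one of the points \<open>p\<^sub>i\<close>.\<close>

definition D_trunc ::
    "nat \<Rightarrow> (nat \<Rightarrow> real) \<Rightarrow> (nat \<Rightarrow> real) \<Rightarrow> real \<Rightarrow> real set \<Rightarrow> real" where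
  "D_trunc n pp pm \<delta> X =
    (\<Sum>i=1..n. (\<Sum>\<^sub>\<infinity>x\<in>X \<inter> {\<delta><..}. ln (\<bar>(x / pp i - 1) / (x / pm i - 1)\<bar>\<^sup>2))
             + (\<Sum>\<^sub>\<infinity>x\<in>X \<inter> {..<- \<delta>}. ln (\<bar>(x / pm i - 1) / (x / pp i - 1)\<bar>\<^sup>2)))"

definition D_centred ::
    "real set measure \<Rightarrow> nat \<Rightarrow> (nat \<Rightarrow> real) \<Rightarrow> (nat \<Rightarrow> real) \<Rightarrow> real set \<Rightarrow> real \<Rightarrow> real" where
  "D_centred M n pp pm X \<delta> = D_trunc n pp pm \<delta> X - (\<integral>Y. D_trunc n pp pm \<delta> Y \<partial>M)"

definition S_bar ::
    "real set measure \<Rightarrow> nat \<Rightarrow> (nat \<Rightarrow> real) \<Rightarrow> (nat \<Rightarrow> real) \<Rightarrow> real set \<Rightarrow> real" where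
  "S_bar M n pp pm X = Lim (at_right 0) (D_centred M n pp pm X)"

end

theory Submission
  imports Defs "HOL-Real_Asymp.Real_Asymp" "Jordan_Normal_Form.Schur_Decomposition"
    "Jordan_Normal_Form.Char_Poly"
begin

text \<open>
  All the sums in the statement converge absolutely, so that the limit of the centred sums is the
  sum over the whole configuration minus its expectation.  Everything follows from one estimate,
  \<open>whittaker_kernel_bound\<close>: if \<open>x\<close> and \<open>y\<close> have the same sign, then \<open>|K(x, y)| \<le> \<phi>(x) \<phi>(y)\<close>
  with \<open>\<phi>(x)\<^sup>2\<close> a multiple of $|x|^{-3/2} e^{-|x|/2}$.  In particular \<open>\<phi>\<^sup>2\<close> dominates the
  intensity and \<open>min |x| 1\<close> is integrable against it.

  To prove the estimate, a half-line kernel is written in terms of $u = W_{c+1,b}$ and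
  $v = W_{c,b}$.  These solve a first-order system, from which
  \<open>u(x) v(y) - v(x) u(y)\<close> is seen to be \<open>(x - y) / 2\<close> times the integral of
  \<open>(u(t x) v(t y) + v(t x) u(t y)) / t\<close> over \<open>t > 1\<close>.  So the denominator \<open>x - y\<close> of the kernel
  cancels, and it remains to see that \<open>u\<close> and \<open>v\<close> are bounded near 0 and decay exponentially
  (\<open>whittaker_wronskian_bound\<close>, \<open>whittaker_pair_decay\<close>).  The Whittaker functions are
  characterised by their equation and their normalisation at infinity; existence comes from
  Laplace's integral (\<open>whittaker_pair_exists\<close>) and uniqueness from a Wronskian argument
  (\<open>whittaker_solution_unique\<close>).

  For the first two claims, the summand is \<open>O(|x|)\<close> at 0, bounded at infinity and has
  logarithmic singularities at the given points.  It is integrable against \<open>\<phi>\<^sup>2\<close>, and by Campbell's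
  formula (\<open>expectation_count_le\<close>) the sum of its absolute values over the configuration has
  finite expectation.  Dominated convergence then gives the limits.

  For the third claim, the summand is bounded above by a multiple of \<open>min |x| 1\<close>
  (\<open>side_log_ratio_le\<close>), and it is enough that the sum of \<open>min |x| 1\<close> over the points of one
  half-line has exponential moments of all orders (\<open>exponential_moment\<close>).  Expanding into
  factorial moments and bounding the determinants by Hadamard's inequality leads to the
  series with terms $k^{k/2} T^k / k!$, which converges for every \<open>T\<close>.  The two half-lines
  are combined by the Cauchy-Schwarz inequality, so only pairs of points of the same sign are
  ever compared.
\<close>

section \<open>Whittaker's equation\<close>

lemma has_real_derivative_norm_power2:
  fixes f :: "real \<Rightarrow> 'a::real_inner"
  assumes "(f has_vector_derivative f') (at x)"
  shows "((\<lambda>x. (norm (f x))\<^sup>2) has_real_derivative 2 * (f x \<bullet> f')) (at x)"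
proof -
  have "(f has_derivative (\<lambda>h. h *\<^sub>R f')) (at x)"
    using assms by (simp add: has_vector_derivative_def)
  from has_derivative_inner[OF this this] show ?thesis
    unfolding has_field_derivative_def power2_norm_eq_inner
    by (rule has_derivative_eq_rhs) (auto simp: fun_eq_iff inner_commute)
qed

lemma has_vector_derivative_quotient:
  fixes f g :: "real \<Rightarrow> 'a::real_normed_field"
  assumes "(f has_vector_derivative f') (at x within S)" "(g has_vector_derivative g') (at x within S)" "g x \<noteq> 0"
  shows "((\<lambda>x. f x / g x) has_vector_derivative (f' * g x - f x * g') / (g x * g x)) (at x within S)"
  unfolding has_vector_derivative_def
  by (rule has_derivative_eq_rhs, rule has_derivative_divide'[OF assms[unfolded has_vector_derivative_def]])
    (simp add: fun_eq_iff scaleR_conv_of_real right_diff_distrib)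

definition whittaker_coeff :: "real \<Rightarrow> real \<Rightarrow> real \<Rightarrow> real" where
  "whittaker_coeff a \<beta> x = - 1/4 + a / x + (1/4 - \<beta>) / x\<^sup>2"

text \<open>In the statement both \<open>a\<close> and \<open>b\<^sup>2\<close> turn out to be real for admissible parameters, also
  when \<open>b\<close> is imaginary; only \<open>\<beta> = b\<^sup>2\<close> enters the equation.\<close>

definition whittaker_ode :: "real \<Rightarrow> real \<Rightarrow> (real \<Rightarrow> complex) \<Rightarrow> (real \<Rightarrow> complex) \<Rightarrow> bool" where
  "whittaker_ode a \<beta> w w' \<longleftrightarrow> (\<forall>x>0. (w has_vector_derivative w' x) (at x) \<and>
     (w' has_vector_derivative - (of_real (whittaker_coeff a \<beta> x) * w x)) (at x))"

lemma is_whittaker_W_real_iff: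
  assumes "b\<^sup>2 = of_real \<beta>"
  shows "is_whittaker_W (of_real a) b w \<longleftrightarrow>
    (\<exists>w'. whittaker_ode a \<beta> w w') \<and>
    ((\<lambda>x. w x / of_real (exp (- x / 2) * x powr a)) \<longlongrightarrow> 1) at_top"
proof -
  have 1: "- 1/4 + of_real a / of_real x + (1/4 - b\<^sup>2) / (of_real x)\<^sup>2 =
      complex_of_real (whittaker_coeff a \<beta> x)" for x
    by (simp add: whittaker_coeff_def assms)
  have 2: "((\<lambda>x. w x / (exp (- of_real x / 2) * of_real x powr of_real a)) \<longlongrightarrow> 1) at_top \<longleftrightarrow>
      ((\<lambda>x. w x / of_real (exp (- x / 2) * x powr a)) \<longlongrightarrow> 1) at_top"
    by (intro filterlim_cong refl eventually_mono[OF eventually_gt_at_top[of 0]])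
      (auto simp: powr_of_real exp_of_real[symmetric])
  show ?thesis
    unfolding is_whittaker_W_def whittaker_ode_def 1 2 by blast
qed

text \<open>Uniqueness for the initial value problem at \<open>R\<close>, on the left of \<open>R\<close>.  The quantity
  \<open>E = |d|\<^sup>2 + |d'|\<^sup>2\<close> satisfies \<open>E' \<ge> - k E\<close> on \<open>[x, R]\<close>, so that \<open>E(t) exp (k t)\<close>
  increases up to its final value 0.\<close>

lemma whittaker_ode_zero_backwards:
  assumes ode: "whittaker_ode a \<beta> d d'" and zero: "d R = 0" "d' R = 0" and x: "0 < x" "x \<le> R"
  shows "d x = 0"
proof -
  have "continuous_on {x..R} (whittaker_coeff a \<beta>)"
    unfolding whittaker_coeff_def using x by (intro continuous_intros) auto
  then have "bounded (whittaker_coeff a \<beta> ` {x..R})"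
    by (intro compact_imp_bounded compact_continuous_image) auto
  then obtain Q where Q: "\<And>t. t \<in> {x..R} \<Longrightarrow> \<bar>whittaker_coeff a \<beta> t\<bar> \<le> Q"
    unfolding bounded_iff real_norm_def by (metis imageI)
  define k where "k = 1 + Q"
  define E where "E t = (norm (d t))\<^sup>2 + (norm (d' t))\<^sup>2" for t
  define E' where "E' t = 2 * (d t \<bullet> d' t) + 2 * (d' t \<bullet> (- (of_real (whittaker_coeff a \<beta> t) * d t)))" for t
  have E': "(E has_real_derivative E' t) (at t)" if "t > 0" for t
    unfolding E_def E'_def using ode that unfolding whittaker_ode_def
    by (intro DERIV_add has_real_derivative_norm_power2) auto
  have bound: "- k * E t \<le> E' t" if t: "t \<in> {x..R}" for t
  proof -
    have "of_real (whittaker_coeff a \<beta> t) * d t = whittaker_coeff a \<beta> t *\<^sub>R d t"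
      by (simp add: scaleR_conv_of_real)
    then have "E' t = 2 * (1 - whittaker_coeff a \<beta> t) * (d t \<bullet> d' t)"
      unfolding E'_def inner_minus_right by (simp add: inner_commute algebra_simps)
    then have "\<bar>E' t\<bar> = \<bar>1 - whittaker_coeff a \<beta> t\<bar> * (2 * \<bar>d t \<bullet> d' t\<bar>)"
      by (simp only: abs_mult)
    also have "\<dots> \<le> k * E t"
    proof (rule mult_mono)
      show "\<bar>1 - whittaker_coeff a \<beta> t\<bar> \<le> k" using Q[OF t] by (auto simp: k_def)
      have "\<bar>d t \<bullet> d' t\<bar> \<le> norm (d t) * norm (d' t)" by (rule Cauchy_Schwarz_ineq2)
      moreover have "2 * (norm (d t) * norm (d' t)) \<le> E t"
        unfolding E_def using sum_squares_bound[of "norm (d t)" "norm (d' t)"] by simp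
      ultimately show "2 * \<bar>d t \<bullet> d' t\<bar> \<le> E t" by simp
      show "0 \<le> k" using Q[OF t] by (simp add: k_def)
    qed auto
    finally show ?thesis by simp
  qed
  define \<Phi> where "\<Phi> t = E t * exp (k * t)" for t
  have "\<Phi> x \<le> \<Phi> R"
  proof (rule DERIV_nonneg_imp_nondecreasing[OF x(2)])
    fix t assume t: "x \<le> t" "t \<le> R"
    have "(\<Phi> has_real_derivative (E' t + k * E t) * exp (k * t)) (at t)"
      unfolding \<Phi>_def using t x
      by (auto intro!: derivative_eq_intros E' simp: algebra_simps)
    moreover have "0 \<le> (E' t + k * E t) * exp (k * t)" using bound[of t] t by simp
    ultimately show "\<exists>y. (\<Phi> has_real_derivative y) (at t) \<and> 0 \<le> y" by blast
  qed
  also have "\<Phi> R = 0" by (simp add: \<Phi>_def E_def zero)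
  finally have "E x \<le> 0" by (simp add: \<Phi>_def mult_le_0_iff)
  then show ?thesis by (simp add: E_def sum_power2_le_zero_iff)
qed

text \<open>Let \<open>d\<close> be the difference of the two solutions, so that \<open>r = d / w1\<close> tends to 0.  The
  Wronskian \<open>C\<close> of \<open>d\<close> and \<open>w1\<close> is constant and \<open>r' = C / w1\<^sup>2\<close>.  Since \<open>w1\<^sup>2\<close> behaves
  like $e^{-x} x^{2a}$ with real \<open>a\<close>, the real part of \<open>1 / w1\<^sup>2\<close> is eventually at least 1.  If
  \<open>C\<close> were nonzero, the real part of \<open>r / C\<close> would thus grow at least linearly.  Hence \<open>C = 0\<close>,
  \<open>r\<close> is eventually constant, that constant is 0, and the zero spreads to all positive \<open>x\<close>.\<close>

lemma whittaker_solution_unique: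
  assumes ode1: "whittaker_ode a \<beta> w1 w1'" and ode2: "whittaker_ode a \<beta> w2 w2'"
    and lim1: "((\<lambda>x. w1 x / of_real (exp (- x / 2) * x powr a)) \<longlongrightarrow> 1) at_top"
    and lim2: "((\<lambda>x. w2 x / of_real (exp (- x / 2) * x powr a)) \<longlongrightarrow> 1) at_top"
    and x: "x > 0"
  shows "w1 x = w2 x"
proof -
  define g where "g x = exp (- x / 2) * x powr a" for x :: real
  have g_pos: "g x > 0" if "x > 0" for x using that by (simp add: g_def)
  define d where "d x = w1 x - w2 x" for x
  define d' where "d' x = w1' x - w2' x" for x
  have ode_d: "whittaker_ode a \<beta> d d'"
    using ode1 ode2 unfolding whittaker_ode_def d_def d'_def
    by (auto intro!: derivative_eq_intros simp: algebra_simps)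
  define Wr where "Wr x = d' x * w1 x - d x * w1' x" for x
  have "\<exists>C. \<forall>x\<in>{0<..}. Wr x = C"
  proof (rule has_vector_derivative_zero_constant)
    show "convex {0::real<..}" by simp
    fix x :: real assume "x \<in> {0<..}"
    then have "(Wr has_vector_derivative 0) (at x)"
      using ode_d ode1 unfolding whittaker_ode_def Wr_def
      by (auto intro!: derivative_eq_intros simp: algebra_simps)
    then show "(Wr has_vector_derivative 0) (at x within {0<..})"
      by (rule has_vector_derivative_at_within)
  qed auto
  then obtain C where C: "\<And>x. x > 0 \<Longrightarrow> Wr x = C" by auto
  define r where "r x = d x / w1 x" for x
  have lim_r: "(r \<longlongrightarrow> 0) at_top"
  proof -
    have "((\<lambda>x. (w1 x / of_real (g x) - w2 x / of_real (g x)) / (w1 x / of_real (g x))) \<longlongrightarrow> (1 - 1) / 1) at_top"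
      by (intro tendsto_intros lim1[folded g_def] lim2[folded g_def]) auto
    moreover have "\<forall>\<^sub>F x in at_top. (w1 x / of_real (g x) - w2 x / of_real (g x)) / (w1 x / of_real (g x)) = r x"
      using eventually_gt_at_top[of 0]
      by eventually_elim (use g_pos in \<open>force simp: r_def d_def field_simps\<close>)
    ultimately show ?thesis by (simp cong: filterlim_cong add: filterlim_cong)
  qed
  have lim_sq: "((\<lambda>x. Re (1 / (w1 x / of_real (g x))\<^sup>2)) \<longlongrightarrow> Re (1 / 1\<^sup>2)) at_top"
    by (intro tendsto_intros lim1[folded g_def]) auto
  have lim_g: "((\<lambda>x. (g x)\<^sup>2) \<longlongrightarrow> 0) at_top"
  proof -
    have "((\<lambda>x::real. (exp (- x / 2) * x powr a)\<^sup>2) \<longlongrightarrow> 0) at_top" by real_asymp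
    then show ?thesis by (simp add: g_def)
  qed
  have "\<forall>\<^sub>F x in at_top. x > 0 \<and> Re (1 / (w1 x / of_real (g x))\<^sup>2) > 1/2 \<and> (g x)\<^sup>2 < 1/2"
    using eventually_gt_at_top[of 0] order_tendstoD(1)[OF lim_sq, of "1/2"] order_tendstoD(2)[OF lim_g, of "1/2"]
    by (auto intro: eventually_conj)
  then obtain X where X: "\<And>x. x \<ge> X \<Longrightarrow> x > 0 \<and> Re (1 / (w1 x / of_real (g x))\<^sup>2) > 1/2 \<and> (g x)\<^sup>2 < 1/2"
    unfolding eventually_at_top_linorder by blast
  have X0: "X > 0" using X[of X] by simp
  have w1_nz: "w1 x \<noteq> 0" if "x \<ge> X" for x using X[OF that] by auto
  have w1_big: "Re (1 / (w1 x)\<^sup>2) \<ge> 1" if "x \<ge> X" for x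
  proof -
    have gx: "g x > 0" using X[OF that] g_pos by auto
    have "1 / (w1 x / of_real (g x))\<^sup>2 = of_real ((g x)\<^sup>2) * (1 / (w1 x)\<^sup>2)"
      using w1_nz[OF that] gx by (simp add: field_simps)
    then have "Re (1 / (w1 x / of_real (g x))\<^sup>2) = (g x)\<^sup>2 * Re (1 / (w1 x)\<^sup>2)"
      by (simp only: Re_complex_of_real times_complex.sel) simp
    then have *: "1/2 < (g x)\<^sup>2 * Re (1 / (w1 x)\<^sup>2)" using X[OF that] by simp
    show ?thesis
    proof (rule ccontr)
      assume "\<not> 1 \<le> Re (1 / (w1 x)\<^sup>2)"
      then have "(g x)\<^sup>2 * Re (1 / (w1 x)\<^sup>2) \<le> (g x)\<^sup>2 * 1" by (intro mult_left_mono) auto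
      then show False using * X[OF that] by simp
    qed
  qed
  have r': "(r has_vector_derivative C / (w1 x)\<^sup>2) (at x)" if "x \<ge> X" for x
  proof -
    have x0: "x > 0" using X[OF that] by simp
    have "(r has_vector_derivative (d' x * w1 x - d x * w1' x) / (w1 x * w1 x)) (at x)"
      unfolding r_def
      using ode_d ode1 x0 w1_nz[OF that] unfolding whittaker_ode_def
      by (intro has_vector_derivative_quotient) auto
    then show ?thesis using C[OF x0] by (simp add: Wr_def power2_eq_square)
  qed
  have "C = 0"
  proof (rule ccontr)
    assume C0: "C \<noteq> 0"
    define \<rho> where "\<rho> x = Re (r x / C)" for x
    have "(\<rho> \<longlongrightarrow> Re (0 / C)) at_top"
      unfolding \<rho>_def by (intro tendsto_intros lim_r C0)
    then have lim\<rho>: "(\<rho> \<longlongrightarrow> 0) at_top" by simp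
    have "\<rho> x \<ge> \<rho> X + (x - X)" if "x \<ge> X" for x
    proof -
      have "\<rho> X - X \<le> \<rho> x - x"
      proof (rule DERIV_nonneg_imp_nondecreasing[OF that])
        fix t assume t: "X \<le> t" "t \<le> x"
        have "((\<lambda>x. r x / C) has_vector_derivative (C / (w1 t)\<^sup>2) / C) (at t)"
          using r'[OF t(1)] by (auto intro!: derivative_eq_intros simp: C0)
        then have "(\<rho> has_vector_derivative Re (1 / (w1 t)\<^sup>2)) (at t)"
          unfolding \<rho>_def using C0
          by (intro bounded_linear.has_vector_derivative[OF bounded_linear_Re]) auto
        then have "((\<lambda>x. \<rho> x - x) has_real_derivative Re (1 / (w1 t)\<^sup>2) - 1) (at t)"
          unfolding has_real_derivative_iff_has_vector_derivative
          by (auto intro!: derivative_eq_intros)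
        moreover have "0 \<le> Re (1 / (w1 t)\<^sup>2) - 1" using w1_big[OF t(1)] by simp
        ultimately show "\<exists>y. ((\<lambda>x. \<rho> x - x) has_real_derivative y) (at t) \<and> 0 \<le> y" by blast
      qed
      then show ?thesis by simp
    qed
    moreover have "\<forall>\<^sub>F x in at_top. \<rho> x < 1 \<and> x \<ge> X \<and> x \<ge> X + 1 - \<rho> X"
      by (intro eventually_conj order_tendstoD(2)[OF lim\<rho>] eventually_ge_at_top) simp
    then obtain x where "\<rho> x < 1" "x \<ge> X" "x \<ge> X + 1 - \<rho> X"
      by (auto simp: eventually_at_top_linorder)
    ultimately show False by force
  qed
  have "\<exists>c. \<forall>x\<in>{X..}. r x = c"
  proof (rule has_vector_derivative_zero_constant)
    fix x assume "x \<in> {X..}"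
    then show "(r has_vector_derivative 0) (at x within {X..})"
      using r'[of x] \<open>C = 0\<close> by (auto intro: has_vector_derivative_at_within)
  qed auto
  then obtain c where c: "\<And>x. x \<ge> X \<Longrightarrow> r x = c" by auto
  have "(r \<longlongrightarrow> c) at_top"
    by (rule tendsto_eventually, rule eventually_mono[OF eventually_ge_at_top[of X]]) (rule c)
  then have "c = 0" using lim_r tendsto_unique trivial_limit_at_top_linorder by blast
  then have d0: "d x = 0" if "x \<ge> X" for x using c[OF that] w1_nz[OF that] by (simp add: r_def)
  have d'0: "d' x = 0" if "x \<ge> X" for x
    using C[of x] X[OF that] \<open>C = 0\<close> d0[OF that] w1_nz[OF that] by (simp add: Wr_def)
  have "d x = 0"
    using whittaker_ode_zero_backwards[OF ode_d, of "max x X" x] d0[of "max x X"] d'0[of "max x X"] x by auto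
  then show ?thesis by (simp add: d_def)
qed

lemma whittaker_W_eqI:
  assumes "b\<^sup>2 = of_real \<beta>" "is_whittaker_W (of_real a) b w" "x > 0"
  shows "whittaker_W (of_real a) b x = w x"
  unfolding whittaker_W_def
proof (rule the_equality)
  fix v assume "\<exists>w. is_whittaker_W (of_real a) b w \<and> v = w x"
  then obtain w2 where "is_whittaker_W (of_real a) b w2" "v = w2 x" by blast
  then show "v = w x"
    using assms(2,3) unfolding is_whittaker_W_real_iff[OF assms(1)]
    by (auto intro: whittaker_solution_unique)
qed (use assms in blast)

text \<open>Write the equation as \<open>w'' = - q w\<close>.  As \<open>\<beta> < 1/4\<close>, the leading term of \<open>q\<close> at 0 is
  \<open>\<kappa> / x\<^sup>2\<close> with \<open>\<kappa> > 0\<close>, so that near 0 the function \<open>q\<close> is positive and decreasing.  There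
  the energy \<open>|w|\<^sup>2 + |w'|\<^sup>2 / q\<close> has derivative \<open>- q' |w'|\<^sup>2 / q\<^sup>2 \<ge> 0\<close>; it therefore stays
  bounded as \<open>x\<close> decreases to 0.  This replaces the exact behaviour at 0, where the case
  \<open>b = 0\<close> would have to be treated separately.\<close>

lemma whittaker_ode_bounded_near_zero:
  assumes ode: "whittaker_ode a \<beta> w w'" and \<beta>: "\<beta> < 1/4"
  obtains x0 B where "x0 > 0" "\<And>x. 0 < x \<Longrightarrow> x \<le> x0 \<Longrightarrow> norm (w x) \<le> B \<and> norm (of_real x * w' x) \<le> B"
proof -
  define \<kappa> where "\<kappa> = 1/4 - \<beta>"
  have \<kappa>: "\<kappa> > 0" using \<beta> by (simp add: \<kappa>_def)
  define q where "q x = - 1/4 + a / x + \<kappa> / x\<^sup>2" for x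
  have qc: "whittaker_coeff a \<beta> x = q x" for x by (simp add: q_def \<kappa>_def whittaker_coeff_def)
  \<comment> \<open>On \<open>(0, x0]\<close> the term \<open>\<kappa> / x\<^sup>2\<close> dominates \<open>|a| / x + 1\<close>, hence also \<open>|a| / x + 1/4\<close>.\<close>
  define x0 where "x0 = min 1 (\<kappa> / (\<bar>a\<bar> + 1))"
  have x0: "x0 > 0" using \<kappa> by (simp add: x0_def)
  have small: "\<bar>a\<bar> + 1 \<le> \<kappa> / x" if "0 < x" "x \<le> x0" for x
    using that by (simp add: x0_def field_simps)
  have q_pos: "q x > 0" if x: "0 < x" "x \<le> x0" for x
  proof -
    have "1 \<le> 1 / x" using x by (simp add: x0_def)
    have "(\<bar>a\<bar> + 1) / x \<le> (\<kappa> / x) / x" using small[OF x] x by (intro divide_right_mono) auto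
    then have "\<bar>a\<bar> / x + 1 / x \<le> \<kappa> / x\<^sup>2" by (simp add: add_divide_distrib power2_eq_square)
    moreover have "- \<bar>a\<bar> / x \<le> a / x" using x by (intro divide_right_mono) auto
    ultimately show ?thesis using \<open>1 \<le> 1 / x\<close> by (simp add: q_def)
  qed
  define q' where "q' x = - (a + 2 * (\<kappa> / x)) / x\<^sup>2" for x
  have q'_neg: "q' x \<le> 0" if x: "0 < x" "x \<le> x0" for x
    using small[OF x] x by (simp add: q'_def divide_le_0_iff)
  have q': "(q has_real_derivative q' x) (at x)" if "x > 0" for x
    unfolding q_def q'_def using that
    by (auto intro!: derivative_eq_intros simp: field_simps power2_eq_square)
  define E where "E x = (norm (w x))\<^sup>2 + (norm (w' x))\<^sup>2 / q x" for x
  have E_mono: "E x \<le> E x0" if x: "0 < x" "x \<le> x0" for x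
  proof (rule DERIV_nonneg_imp_nondecreasing[OF x(2)])
    fix t assume "x \<le> t" "t \<le> x0"
    then have t: "0 < t" "t \<le> x0" using x by auto
    have qt: "q t \<noteq> 0" using q_pos[OF t] by simp
    have "(E has_real_derivative
       2 * (w t \<bullet> w' t) + (2 * (w' t \<bullet> (- (of_real (q t) * w t))) * q t - (norm (w' t))\<^sup>2 * q' t) / (q t * q t)) (at t)"
      unfolding E_def using ode t(1) qt unfolding whittaker_ode_def qc
      by (intro DERIV_add DERIV_divide has_real_derivative_norm_power2 q') auto
    also have "2 * (w t \<bullet> w' t) + (2 * (w' t \<bullet> (- (of_real (q t) * w t))) * q t - (norm (w' t))\<^sup>2 * q' t) / (q t * q t)
       = - q' t * (norm (w' t) / q t)\<^sup>2"
      unfolding inner_minus_right scaleR_conv_of_real[symmetric] inner_scaleR_right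
      using qt by (simp add: inner_commute field_simps power2_eq_square)
    finally show "\<exists>y. (E has_real_derivative y) (at t) \<and> 0 \<le> y"
      using q'_neg[OF t] by (metis mult_nonneg_nonneg neg_0_le_iff_le zero_le_power2)
  qed
  define M where "M = E x0 * (1 + \<bar>a\<bar> + \<kappa>)"
  have E0: "E x0 \<ge> 0" using q_pos[of x0] x0 by (simp add: E_def)
  have "norm (w x) \<le> sqrt M \<and> norm (of_real x * w' x) \<le> sqrt M" if x: "0 < x" "x \<le> x0" for x
  proof
    have "(norm (w x))\<^sup>2 \<le> E x" using q_pos[OF x] by (simp add: E_def)
    also have "\<dots> \<le> E x0 * 1" using E_mono[OF x] by simp
    also have "\<dots> \<le> M" unfolding M_def using E0 \<kappa> by (intro mult_left_mono) auto
    finally show "norm (w x) \<le> sqrt M" by (rule real_le_rsqrt)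
    have "(norm (w' x))\<^sup>2 / q x \<le> E x" by (simp add: E_def)
    also have "\<dots> \<le> E x0" by (rule E_mono[OF x])
    finally have "(norm (w' x))\<^sup>2 \<le> E x0 * q x" using q_pos[OF x] by (simp add: field_simps)
    then have "x\<^sup>2 * (norm (w' x))\<^sup>2 \<le> x\<^sup>2 * (E x0 * q x)" by (intro mult_left_mono) auto
    also have "\<dots> = E x0 * (x\<^sup>2 * q x)" by simp
    also have "x\<^sup>2 * q x = - x\<^sup>2 / 4 + a * x + \<kappa>"
      using x by (simp add: q_def field_simps power2_eq_square)
    also have "E x0 * (- x\<^sup>2 / 4 + a * x + \<kappa>) \<le> M"
      unfolding M_def
    proof (intro mult_left_mono E0)
      have "x \<le> 1" using x by (simp add: x0_def)
      then have "a * x \<le> \<bar>a\<bar> * 1" using x by (intro mult_mono) auto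
      moreover have "- x\<^sup>2 / 4 \<le> 0" by simp
      ultimately show "- x\<^sup>2 / 4 + a * x + \<kappa> \<le> 1 + \<bar>a\<bar> + \<kappa>" by linarith
    qed
    finally have "(norm (of_real x * w' x))\<^sup>2 \<le> M" by (simp add: norm_mult power_mult_distrib)
    then show "norm (of_real x * w' x) \<le> sqrt M" by (rule real_le_rsqrt)
  qed
  then show thesis using that x0 by blast
qed

section \<open>Laplace integrals for confluent hypergeometric functions\<close>

lemma has_vector_derivative_iff_quotient_tendsto:
  fixes f :: "real \<Rightarrow> 'a::real_normed_field"
  shows "(f has_vector_derivative D) (at x) \<longleftrightarrow> ((\<lambda>y. (f y - f x) / of_real (y - x)) \<longlongrightarrow> D) (at x)"
proof -
  have eq: "norm (f y - f x - (y - x) *\<^sub>R D) / norm (y - x) = norm ((f y - f x) / of_real (y - x) - D)"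
    if "y \<noteq> x" for y
  proof -
    have "norm ((f y - f x) / of_real (y - x) - D) = norm ((f y - f x - (y - x) *\<^sub>R D) / of_real (y - x))"
      using that by (simp add: diff_divide_distrib scaleR_conv_of_real)
    then show ?thesis by (simp add: norm_divide del: of_real_diff)
  qed
  have "(f has_vector_derivative D) (at x) \<longleftrightarrow>
      ((\<lambda>y. norm (f y - f x - (y - x) *\<^sub>R D) / norm (y - x)) \<longlongrightarrow> 0) (at x)"
    unfolding has_vector_derivative_def has_derivative_iff_norm
    by (simp add: bounded_linear_scaleR_left)
  also have "\<dots> \<longleftrightarrow> ((\<lambda>y. norm ((f y - f x) / of_real (y - x) - D)) \<longlongrightarrow> 0) (at x)"
  proof (rule tendsto_cong)
    have "\<forall>\<^sub>F y in at x. y \<noteq> x" by (rule eventually_neq_at_within)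
    then show "\<forall>\<^sub>F y in at x. norm (f y - f x - (y - x) *\<^sub>R D) / norm (y - x) = norm ((f y - f x) / of_real (y - x) - D)"
      by eventually_elim (rule eq)
  qed
  also have "\<dots> \<longleftrightarrow> ((\<lambda>y. (f y - f x) / of_real (y - x) - D) \<longlongrightarrow> 0) (at x)"
    by (rule tendsto_norm_zero_iff)
  also have "\<dots> \<longleftrightarrow> ((\<lambda>y. (f y - f x) / of_real (y - x)) \<longlongrightarrow> D) (at x)"
    by (rule LIM_zero_iff)
  finally show ?thesis .
qed

lemma mult_exp_minus_le:
  assumes "x > 0" "s \<ge> (0::real)" 
  shows "s * exp (- (x * s)) \<le> 2 / x * exp (- (x / 2 * s))"
proof -
  have "x / 2 * s \<le> exp (x / 2 * s)" using exp_ge_add_one_self[of "x / 2 * s"] by linarith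
  then have "s \<le> 2 / x * exp (x / 2 * s)" using assms by (simp add: field_simps)
  then have "s * exp (- (x * s)) \<le> 2 / x * exp (x / 2 * s) * exp (- (x * s))" by (intro mult_right_mono) auto
  also have "\<dots> = 2 / x * exp (- (x / 2 * s))"
    by (simp add: exp_add[symmetric] mult.assoc)
  finally show ?thesis .
qed

text \<open>Differentiation under a Laplace integral.  For \<open>y > x/2\<close> the difference quotients of
  \<open>exp (- y s)\<close> in \<open>y\<close> are at most \<open>s exp (- s x / 2)\<close>, and the factor \<open>s\<close> is absorbed by
  giving away half of the exponential.\<close>

lemma
  fixes m :: "real \<Rightarrow> complex"
  assumes meas[measurable]: "m \<in> borel_measurable borel" and supp: "\<And>s. s \<le> 0 \<Longrightarrow> m s = 0"
    and int: "\<And>x. x > 0 \<Longrightarrow> integrable lborel (\<lambda>s. of_real (exp (- (x * s))) * m s)" and x: "x > 0"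
  shows integrable_laplace_times_id:
      "integrable lborel (\<lambda>s. of_real (exp (- (x * s))) * (of_real s * m s))" (is ?thesis1)
    and has_vector_derivative_laplace:
      "((\<lambda>x. \<integral>s. of_real (exp (- (x * s))) * m s \<partial>lborel) has_vector_derivative
        - (\<integral>s. of_real (exp (- (x * s))) * (of_real s * m s) \<partial>lborel)) (at x)" (is ?thesis2)
proof -
  have aux: "norm (of_real (exp (- (y * s))) * (of_real s * m s)) \<le>
      norm (of_real (2 / y) * (of_real (exp (- (y / 2 * s))) * m s))" if "y > 0" for y s
  proof (cases "s > 0")
    case True
    then show ?thesis
      using mult_right_mono[OF mult_exp_minus_le[OF that, of s], of "norm (m s)"] that
      by (simp add: norm_mult norm_divide mult_ac)
  qed (simp add: supp)
  have int1: "integrable lborel (\<lambda>s. of_real (exp (- (y * s))) * (of_real s * m s))" if "y > 0" for y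
  proof (rule Bochner_Integration.integrable_bound)
    show "integrable lborel (\<lambda>s. complex_of_real (2 / y) * (of_real (exp (- (y / 2 * s))) * m s))"
      using int[of "y / 2"] that by (intro integrable_mult_right) auto
  qed (use aux[OF that] in auto)
  show ?thesis1 by (rule int1[OF x])
  have half: "at x = at x within {x/2<..}" using x by (simp add: at_within_open[symmetric])
  show ?thesis2
    unfolding has_vector_derivative_iff_quotient_tendsto
    unfolding half tendsto_at_iff_sequentially comp_def
  proof (intro allI impI)
    fix X assume X: "\<forall>i. X i \<in> {x/2<..} - {x}" "X \<longlonglongrightarrow> x"
    define q where "q i s = of_real ((exp (- (X i * s)) - exp (- (x * s))) / (X i - x)) * m s" for i s
    have Xpos: "X i > 0" for i using X(1) x by (metis DiffE greaterThan_iff half_gt_zero order.strict_trans)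
    have "((\<integral>s. of_real (exp (- (X i * s))) * m s \<partial>lborel) - (\<integral>s. of_real (exp (- (x * s))) * m s \<partial>lborel)) / of_real (X i - x)
      = (\<integral>s. q i s \<partial>lborel)" for i
    proof -
      have "(\<integral>s. q i s \<partial>lborel) = (\<integral>s. (of_real (exp (- (X i * s))) * m s - of_real (exp (- (x * s))) * m s) / of_real (X i - x) \<partial>lborel)"
        by (simp add: q_def algebra_simps diff_divide_distrib)
      also have "\<dots> = (\<integral>s. (of_real (exp (- (X i * s))) * m s - of_real (exp (- (x * s))) * m s) \<partial>lborel) / of_real (X i - x)"
        by (simp only: integral_divide_zero)
      finally show ?thesis using int[OF Xpos] int[OF x] by simp
    qed
    moreover have "(\<lambda>i. \<integral>s. q i s \<partial>lborel) \<longlonglongrightarrow> (\<integral>s. - (of_real (exp (- (x * s))) * (of_real s * m s)) \<partial>lborel)"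
    proof (rule integral_dominated_convergence)
      show "integrable lborel (\<lambda>s. norm (of_real (exp (- (x/2 * s))) * (of_real s * m s)))"
        using int1[of "x/2"] x by (intro integrable_norm) auto
      show "AE s in lborel. (\<lambda>i. q i s) \<longlonglongrightarrow> - (of_real (exp (- (x * s))) * (of_real s * m s))"
      proof (rule AE_I2)
        fix s
        have "((\<lambda>y. exp (- (y * s))) has_real_derivative - (s * exp (- (x * s)))) (at x)"
          by (auto intro!: derivative_eq_intros)
        then have "((\<lambda>y. (exp (- (y * s)) - exp (- (x * s))) / (y - x)) \<longlongrightarrow> - (s * exp (- (x * s)))) (at x)"
          by (simp add: has_field_derivative_iff)
        then have "(\<lambda>i. (exp (- (X i * s)) - exp (- (x * s))) / (X i - x)) \<longlonglongrightarrow> - (s * exp (- (x * s)))"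
          unfolding tendsto_at_iff_sequentially comp_def using X by auto
        then have "(\<lambda>i. q i s) \<longlonglongrightarrow> of_real (- (s * exp (- (x * s)))) * m s"
          unfolding q_def by (intro tendsto_intros)
        then show "(\<lambda>i. q i s) \<longlonglongrightarrow> - (of_real (exp (- (x * s))) * (of_real s * m s))"
          by (simp add: mult_ac)
      qed
      show "AE s in lborel. norm (q i s) \<le> norm (of_real (exp (- (x/2 * s))) * (of_real s * m s))" for i
      proof (rule AE_I2)
        fix s
        show "norm (q i s) \<le> norm (of_real (exp (- (x/2 * s))) * (of_real s * m s))"
        proof (cases "s > 0")
          case True
          have "norm (exp (- (X i * s)) - exp (- (x * s))) \<le> (exp (- (x/2 * s)) * s) * norm (X i - x)"
          proof (rule field_differentiable_bound[of "{x/2<..}"])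
            show "norm (- (s * exp (- (y * s)))) \<le> exp (- (x/2 * s)) * s" if "y \<in> {x/2<..}" for y
              using that True by (simp add: abs_mult)
            show "((\<lambda>y. exp (- (y * s))) has_field_derivative - (s * exp (- (y * s)))) (at y within {x/2<..})" for y
              by (auto intro!: derivative_eq_intros)
          qed (use X x in auto)
          then have "norm ((exp (- (X i * s)) - exp (- (x * s))) / (X i - x)) \<le> exp (- (x/2 * s)) * s"
            using X(1) by (simp add: norm_divide divide_le_eq)
          from mult_right_mono[OF this, of "norm (m s)"] show ?thesis
            using True by (simp add: q_def norm_mult norm_divide mult_ac del: of_real_diff of_real_divide)
        qed (simp add: q_def supp)
      qed
    qed (auto simp: q_def)
    ultimately show "(\<lambda>i. ((\<integral>s. of_real (exp (- (X i * s))) * m s \<partial>lborel) - (\<integral>s. of_real (exp (- (x * s))) * m s \<partial>lborel)) / of_real (X i - x))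
      \<longlonglongrightarrow> - (\<integral>s. of_real (exp (- (x * s))) * (of_real s * m s) \<partial>lborel)"
      by simp
  qed
qed

text \<open>The tangent to the logarithm at \<open>1/\<delta>\<close> with a sufficiently small slope \<open>\<delta>\<close>.\<close>

lemma one_plus_powr_le_exp:
  fixes g e :: real
  assumes "e > 0"
  obtains C where "\<And>s. s \<ge> 0 \<Longrightarrow> (1 + s) powr g \<le> C * exp (e * s)" "C > 0"
proof -
  define \<delta> where "\<delta> = e / (\<bar>g\<bar> + 1)"
  have \<delta>: "\<delta> > 0" "\<bar>g\<bar> * \<delta> \<le> e" using assms by (simp_all add: \<delta>_def field_simps)
  define C where "C = exp (\<bar>g\<bar> * (\<delta> - 1 - ln \<delta>))"
  have "(1 + s) powr g \<le> C * exp (e * s)" if s: "s \<ge> 0" for s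
  proof -
    have "ln (\<delta> * (1 + s)) \<le> \<delta> * (1 + s) - 1" using \<delta> s by (intro ln_le_minus_one) auto
    then have "ln (1 + s) \<le> \<delta> * (1 + s) - 1 - ln \<delta>" using \<delta> s by (simp add: ln_mult)
    then have "\<bar>g\<bar> * ln (1 + s) \<le> \<bar>g\<bar> * (\<delta> * (1 + s) - 1 - ln \<delta>)" by (intro mult_left_mono) auto
    also have "\<dots> = \<bar>g\<bar> * (\<delta> - 1 - ln \<delta>) + (\<bar>g\<bar> * \<delta>) * s" by (simp add: algebra_simps)
    also have "\<dots> \<le> \<bar>g\<bar> * (\<delta> - 1 - ln \<delta>) + e * s" using \<delta> s by (intro add_left_mono mult_right_mono) auto
    finally have *: "\<bar>g\<bar> * ln (1 + s) \<le> \<bar>g\<bar> * (\<delta> - 1 - ln \<delta>) + e * s" .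
    have "g * ln (1 + s) \<le> \<bar>g\<bar> * ln (1 + s)" using s by (intro mult_right_mono) auto
    with * show ?thesis using s by (simp add: powr_def C_def exp_add[symmetric])
  qed
  then show thesis using that[of C] by (simp add: C_def)
qed

text \<open>Up to the factor \<open>\<Gamma>(\<alpha>)\<close>, \<open>tricomi_integral \<alpha> \<gamma>\<close> is Laplace's integral for Tricomi's
  confluent hypergeometric function \<open>U(\<alpha>, \<alpha> + \<gamma> + 1, x)\<close>.\<close>

definition tricomi_weight :: "complex \<Rightarrow> complex \<Rightarrow> real \<Rightarrow> complex" where
  "tricomi_weight \<alpha> \<gamma> s = indicator {0<..} s *\<^sub>R (of_real s powr (\<alpha> - 1) * of_real (1 + s) powr \<gamma>)"

definition tricomi_integral :: "complex \<Rightarrow> complex \<Rightarrow> real \<Rightarrow> complex" where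
  "tricomi_integral \<alpha> \<gamma> x = (\<integral>s. of_real (exp (- (x * s))) * tricomi_weight \<alpha> \<gamma> s \<partial>lborel)"

lemma tricomi_weight_measurable [measurable]: "tricomi_weight \<alpha> \<gamma> \<in> borel_measurable borel"
  unfolding tricomi_weight_def
  by (rule borel_measurable_continuous_on_indicator)
    (auto intro!: continuous_intros simp: nonpos_Reals_def complex_eq_iff)

text \<open>Raising \<open>\<alpha>\<close> by one is the same as differentiating the Laplace integral, up to sign.\<close>

lemma tricomi_weight_Suc: "of_real s * tricomi_weight \<alpha> \<gamma> s = tricomi_weight (\<alpha> + 1) \<gamma> s"
proof (cases "s > 0")
  case True
  have "of_real s powr (\<alpha> - 1 + 1) = of_real s powr (\<alpha> - 1) * of_real s powr (1::complex)" by (rule powr_add)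
  then show ?thesis using True by (simp add: tricomi_weight_def mult_ac)
qed (simp add: tricomi_weight_def)

lemma norm_tricomi_weight:
  "norm (tricomi_weight \<alpha> \<gamma> s) = indicator {0<..} s * (s powr (Re \<alpha> - 1) * (1 + s) powr Re \<gamma>)"
proof (cases "s > 0")
  case True
  have "cmod (of_real (1 + s) powr \<gamma>) = (1 + s) powr Re \<gamma>"
    using True by (subst norm_powr_real_powr) (auto simp del: of_real_add)
  moreover have "cmod (of_real s powr (\<alpha> - 1)) = s powr (Re \<alpha> - 1)"
    using True by (subst norm_powr_real_powr) auto
  ultimately show ?thesis using True by (simp add: tricomi_weight_def norm_mult del: of_real_add)
qed (simp add: tricomi_weight_def)

lemma integrable_Gamma_weight:
  assumes "A > 0" "a > 0"
  shows "integrable lborel (\<lambda>t::real. indicator {0<..} t * (t powr (A - 1) * exp (- (a * t))))"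
proof -
  have "(\<lambda>t. norm (complex_of_real t powr (of_real A - 1) / of_real (exp (a * t)))) absolutely_integrable_on {0<..}"
    using absolutely_integrable_Gamma_integral[of "of_real A" a] assms by (intro set_integrable_norm) auto
  then have "integrable (completion lborel) (\<lambda>t. indicator {0<..} t *\<^sub>R norm (complex_of_real t powr (of_real A - 1) / of_real (exp (a * t))))"
    unfolding set_integrable_def .
  moreover have eq: "indicator {0<..} t *\<^sub>R norm (complex_of_real t powr (of_real A - 1) / of_real (exp (a * t))) =
     indicator {0<..} t * (t powr (A - 1) * exp (- (a * t)))" for t :: real
    by (auto simp: indicator_def norm_divide norm_powr_real_powr exp_minus field_simps)
  ultimately have int: "integrable (completion lborel) (\<lambda>t. indicator {0<..} t * (t powr (A - 1) * exp (- (a * t))))"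
    by (simp only: eq)
  have "(\<lambda>t. indicator {0<..} t * (t powr (A - 1) * exp (- (a * t)))) \<in> borel_measurable lborel"
    by measurable
  from integrable_completion[OF this] int show ?thesis by simp
qed

lemma integrable_tricomi:
  assumes "Re \<alpha> > 0" "x > 0"
  shows "integrable lborel (\<lambda>s. of_real (exp (- (x * s))) * tricomi_weight \<alpha> \<gamma> s)"
proof -
  obtain C where C: "\<And>s. s \<ge> 0 \<Longrightarrow> (1 + s) powr Re \<gamma> \<le> C * exp (x / 2 * s)" "C > 0"
    using one_plus_powr_le_exp[of "x / 2"] assms(2) by (metis half_gt_zero)
  show ?thesis
  proof (rule Bochner_Integration.integrable_bound)
    show "integrable lborel (\<lambda>s. C * (indicator {0<..} s * (s powr (Re \<alpha> - 1) * exp (- (x / 2 * s)))))"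
      using assms by (intro integrable_mult_right integrable_Gamma_weight) auto
    show "AE s in lborel. norm (of_real (exp (- (x * s))) * tricomi_weight \<alpha> \<gamma> s) \<le>
      norm (C * (indicator {0<..} s * (s powr (Re \<alpha> - 1) * exp (- (x / 2 * s)))))"
    proof (rule AE_I2)
      fix s
      show "norm (of_real (exp (- (x * s))) * tricomi_weight \<alpha> \<gamma> s) \<le>
        norm (C * (indicator {0<..} s * (s powr (Re \<alpha> - 1) * exp (- (x / 2 * s)))))"
      proof (cases "s > 0")
        case True
        have "exp (- (x * s)) * (s powr (Re \<alpha> - 1) * (1 + s) powr Re \<gamma>) \<le>
           exp (- (x * s)) * (s powr (Re \<alpha> - 1) * (C * exp (x / 2 * s)))"
          using C(1)[of s] True by (intro mult_left_mono) auto
        also have "\<dots> = C * (s powr (Re \<alpha> - 1) * (exp (- (x * s)) * exp (x / 2 * s)))" by (simp add: mult_ac)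
        also have "exp (- (x * s)) * exp (x / 2 * s) = exp (- (x / 2 * s))"
          by (simp add: exp_add[symmetric])
        finally show ?thesis using True C(2) by (simp add: norm_mult norm_tricomi_weight abs_mult)
      qed (simp add: tricomi_weight_def)
    qed
  qed simp
qed

lemma has_vector_derivative_tricomi:
  assumes "Re \<alpha> > 0" "x > 0"
  shows "(tricomi_integral \<alpha> \<gamma> has_vector_derivative - tricomi_integral (\<alpha> + 1) \<gamma> x) (at x)"
  using has_vector_derivative_laplace[of "tricomi_weight \<alpha> \<gamma>" x] integrable_tricomi[OF assms(1)] assms(2)
  unfolding tricomi_integral_def[abs_def] tricomi_weight_Suc by (simp add: tricomi_weight_def)

text \<open>After the substitution \<open>s = t / x\<close> the integrand is \<open>exp (- t)\<close> times
  $t^{\alpha-1} (1 + t/x)^\gamma$, which converges to the integrand of the Gamma function.\<close>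

lemma tricomi_integral_asymptotics:
  assumes \<alpha>: "Re \<alpha> > 0"
  shows "((\<lambda>x. of_real x powr \<alpha> * tricomi_integral \<alpha> \<gamma> x) \<longlongrightarrow> Gamma \<alpha>) at_top"
proof -
  \<comment> \<open>Replacing \<open>x\<close> by \<open>max 1 x\<close> keeps \<open>f x\<close> measurable for every real \<open>x\<close>.\<close>
  define f where "f x t = of_real (exp (- t)) * (indicator {0<..} t *\<^sub>R (complex_of_real t powr (\<alpha> - 1) * of_real (1 + t / max 1 x) powr \<gamma>))" for x t :: real
  define h where "h t = of_real (exp (- t)) * (indicator {0<..} t *\<^sub>R (complex_of_real t powr (\<alpha> - 1)))" for t :: real
  have eq: "of_real x powr \<alpha> * tricomi_integral \<alpha> \<gamma> x = (\<integral>t. f x t \<partial>lborel)" if x: "x \<ge> 1" for x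
  proof -
    have "tricomi_integral \<alpha> \<gamma> x = (1 / x) *\<^sub>R (\<integral>t. of_real (exp (- (x * (0 + 1 / x * t)))) * tricomi_weight \<alpha> \<gamma> (0 + 1 / x * t) \<partial>lborel)"
      unfolding tricomi_integral_def using x by (subst lborel_integral_real_affine[of "1 / x" _ 0]) auto
    then have "of_real x powr \<alpha> * tricomi_integral \<alpha> \<gamma> x =
       (\<integral>t. (of_real x powr \<alpha> / of_real x) * (of_real (exp (- (x * (0 + 1 / x * t)))) * tricomi_weight \<alpha> \<gamma> (0 + 1 / x * t)) \<partial>lborel)"
      by (simp add: scaleR_conv_of_real)
    also have "\<dots> = (\<integral>t. f x t \<partial>lborel)"
    proof (rule Bochner_Integration.integral_cong[OF refl])
      fix t
      have x1: "max 1 x = x" using x by simp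
      show "(of_real x powr \<alpha> / of_real x) * (of_real (exp (- (x * (0 + 1 / x * t)))) * tricomi_weight \<alpha> \<gamma> (0 + 1 / x * t)) = f x t"
      proof (cases "t > 0")
        case True
        have "complex_of_real (t / x) powr (\<alpha> - 1) = of_real t powr (\<alpha> - 1) / of_real x powr (\<alpha> - 1)"
          using x True powr_times_real[of "complex_of_real (t / x)" "of_real x" "\<alpha> - 1"] by simp
        moreover have "complex_of_real x powr (\<alpha> - 1) = of_real x powr \<alpha> / of_real x"
          using x by (simp add: powr_diff)
        moreover have "complex_of_real x powr \<alpha> \<noteq> 0" using x by simp
        ultimately show ?thesis using x True by (simp add: f_def x1 tricomi_weight_def del: of_real_divide of_real_add)
      next
        case False
        then have "\<not> 0 < t / x" using x by (simp add: zero_less_divide_iff)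
        with False show ?thesis by (simp add: f_def tricomi_weight_def)
      qed
    qed
    finally show ?thesis .
  qed
  obtain C where C: "\<And>s. s \<ge> 0 \<Longrightarrow> (1 + s) powr \<bar>Re \<gamma>\<bar> \<le> C * exp (1 / 2 * s)" "C > 0"
    by (rule one_plus_powr_le_exp[of "1 / 2" "\<bar>Re \<gamma>\<bar>"]) auto
  have "((\<lambda>x. \<integral>t. f x t \<partial>lborel) \<longlongrightarrow> (\<integral>t. h t \<partial>lborel)) at_top"
  proof (rule integral_dominated_convergence_at_top)
    show "integrable lborel (\<lambda>s. C * (indicator {0<..} s * (s powr (Re \<alpha> - 1) * exp (- (1 / 2 * s)))))"
      using \<alpha> by (intro integrable_mult_right integrable_Gamma_weight) auto
    have "(\<lambda>t. indicator {0<..} t *\<^sub>R (complex_of_real t powr (\<alpha> - 1))) \<in> borel_measurable borel"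
      by (rule borel_measurable_continuous_on_indicator)
        (auto intro!: continuous_intros simp: complex_nonpos_Reals_iff)
    then show "h \<in> borel_measurable lborel"
      unfolding h_def by measurable
    show "f x \<in> borel_measurable lborel" for x
    proof -
      have "(\<lambda>t. indicator {0<..} t *\<^sub>R (complex_of_real t powr (\<alpha> - 1) * of_real (1 + t / max 1 x) powr \<gamma>)) \<in> borel_measurable borel"
      proof (rule borel_measurable_continuous_on_indicator)
        have pos: "1 + t / max 1 x > 0" if "t > 0" for t using that by (intro add_pos_nonneg divide_nonneg_pos) auto
        have "complex_of_real (1 + t / max 1 x) \<notin> \<real>\<^sub>\<le>\<^sub>0" "complex_of_real t \<notin> \<real>\<^sub>\<le>\<^sub>0" if "t \<in> {0<..}" for t
          using pos[of t] that unfolding complex_nonpos_Reals_iff Re_complex_of_real by auto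
        then show "continuous_on {0<..} (\<lambda>t. complex_of_real t powr (\<alpha> - 1) * of_real (1 + t / max 1 x) powr \<gamma>)"
          unfolding continuous_on_def
          by (intro ballI tendsto_mult tendsto_powr_complex tendsto_of_real tendsto_add tendsto_divide tendsto_ident_at tendsto_const)
            (simp_all del: of_real_add)
      qed simp
      then show ?thesis unfolding f_def by measurable
    qed
    show "AE t in lborel. ((\<lambda>x. f x t) \<longlongrightarrow> h t) at_top"
    proof (rule AE_I2)
      fix t :: real
      have "((\<lambda>x. t / max 1 x) \<longlongrightarrow> 0) at_top" by real_asymp
      then have "((\<lambda>x. complex_of_real (1 + t / max 1 x)) \<longlongrightarrow> of_real (1 + 0)) at_top"
        by (intro tendsto_of_real tendsto_add tendsto_const)
      then have l1: "((\<lambda>x. complex_of_real (1 + t / max 1 x)) \<longlongrightarrow> 1) at_top" by (simp del: of_real_add)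
      have "((\<lambda>x. complex_of_real (1 + t / max 1 x) powr \<gamma>) \<longlongrightarrow> 1 powr \<gamma>) at_top"
        by (rule tendsto_powr_complex[OF _ l1 tendsto_const]) simp
      then have "((\<lambda>x. f x t) \<longlongrightarrow> of_real (exp (- t)) * (indicator {0<..} t *\<^sub>R (complex_of_real t powr (\<alpha> - 1) * 1 powr \<gamma>))) at_top"
        unfolding f_def by (intro tendsto_mult tendsto_scaleR tendsto_const)
      then show "((\<lambda>x. f x t) \<longlongrightarrow> h t) at_top" by (simp add: h_def)
    qed
    show "\<forall>\<^sub>F x in at_top. AE t in lborel. norm (f x t) \<le> C * (indicator {0<..} t * (t powr (Re \<alpha> - 1) * exp (- (1 / 2 * t))))"
      using eventually_ge_at_top[of 1]
    proof eventually_elim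
      case (elim x)
      show ?case
      proof (rule AE_I2)
        fix t
        show "norm (f x t) \<le> C * (indicator {0<..} t * (t powr (Re \<alpha> - 1) * exp (- (1 / 2 * t))))"
        proof (cases "t > 0")
          case True
          have "t / x \<le> t" using elim True by (simp add: field_simps)
          have "cmod (of_real (1 + t / x) powr \<gamma>) = (1 + t / x) powr Re \<gamma>"
            using True elim by (subst norm_powr_real_powr) (auto simp del: of_real_add of_real_divide)
          also have "\<dots> \<le> (1 + t / x) powr \<bar>Re \<gamma>\<bar>" using True elim by (intro powr_mono) auto
          also have "\<dots> \<le> (1 + t) powr \<bar>Re \<gamma>\<bar>" using True elim \<open>t / x \<le> t\<close> by (intro powr_mono2) auto
          also have "\<dots> \<le> C * exp (1 / 2 * t)" using C(1) True by simp
          finally have "norm (f x t) \<le> exp (- t) * (t powr (Re \<alpha> - 1) * (C * exp (1 / 2 * t)))"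
            using True elim by (simp add: f_def max_def norm_mult norm_powr_real_powr mult_left_mono del: of_real_add)
          also have "\<dots> = C * (t powr (Re \<alpha> - 1) * (exp (- t) * exp (1 / 2 * t)))" by (simp add: mult_ac)
          also have "exp (- t) * exp (1 / 2 * t) = exp (- (1 / 2 * t))" by (simp add: exp_add[symmetric])
          finally show ?thesis using True by simp
        qed (simp add: f_def)
      qed
    qed
  qed
  moreover have "(\<integral>t. h t \<partial>lborel) = Gamma \<alpha>"
  proof -
    have eq: "of_real (exp (- (1 * t))) * tricomi_weight \<alpha> 0 t =
        indicator {0<..} t *\<^sub>R (complex_of_real t powr (\<alpha> - 1) / of_real (exp t))" for t
      by (auto simp: tricomi_weight_def indicator_def exp_minus field_simps simp del: of_real_add)
    have 1: "set_integrable lborel {0<..} (\<lambda>t. complex_of_real t powr (\<alpha> - 1) / of_real (exp t))"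
      using integrable_tricomi[OF \<alpha>, of 1 0] unfolding set_integrable_def eq by simp
    have "(\<integral>t. h t \<partial>lborel) = (LINT t:{0<..}|lborel. complex_of_real t powr (\<alpha> - 1) / of_real (exp t))"
      unfolding set_lebesgue_integral_def h_def
      by (intro Bochner_Integration.integral_cong) (auto simp: indicator_def exp_minus field_simps)
    also have "\<dots> = integral {0<..} (\<lambda>t. complex_of_real t powr (\<alpha> - 1) / of_real (exp t))"
      by (rule set_borel_integral_eq_integral[OF 1])
    also have "\<dots> = Gamma \<alpha>" using Gamma_integral_complex'[OF \<alpha>] by (rule integral_unique)
    finally show ?thesis .
  qed
  ultimately have "((\<lambda>x. \<integral>t. f x t \<partial>lborel) \<longlongrightarrow> Gamma \<alpha>) at_top" by simp
  then show ?thesis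
    by (rule tendsto_cong[THEN iffD1, rotated], intro eventually_mono[OF eventually_ge_at_top[of 1]]) (rule eq[symmetric])
qed

text \<open>Kummer's equation for the integral.  The function \<open>F\<close>, which is
  $e^{-xs} s^\alpha (1+s)^{\gamma+1}$, vanishes at 0 and at infinity, so the integral of its
  derivative is 0; that derivative is the combination of the three integrands.\<close>

lemma kummer_relation:
  assumes \<alpha>: "Re \<alpha> > 0" and x: "x > 0"
  shows "of_real x * tricomi_integral (\<alpha> + 2) \<gamma> x =
    \<alpha> * tricomi_integral \<alpha> \<gamma> x + (\<alpha> + \<gamma> + 1 - of_real x) * tricomi_integral (\<alpha> + 1) \<gamma> x"
proof -
  define e where "e s = complex_of_real (exp (- (x * s)))" for s
  define F where "F s = e s * (of_real s powr \<alpha> * of_real (1 + s) powr (\<gamma> + 1))" for s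
  define f where "f s = \<alpha> * (e s * tricomi_weight \<alpha> \<gamma> s) + (\<alpha> + \<gamma> + 1 - of_real x) * (e s * tricomi_weight (\<alpha> + 1) \<gamma> s)
     - of_real x * (e s * tricomi_weight (\<alpha> + 2) \<gamma> s)" for s
  have i: "integrable lborel (\<lambda>s. e s * tricomi_weight \<alpha> \<gamma> s)"
    "integrable lborel (\<lambda>s. e s * tricomi_weight (\<alpha> + 1) \<gamma> s)"
    "integrable lborel (\<lambda>s. e s * tricomi_weight (\<alpha> + 2) \<gamma> s)"
    unfolding e_def using \<alpha> x by (auto intro!: integrable_tricomi)
  have fi: "integrable lborel f"
    unfolding f_def by (intro Bochner_Integration.integrable_diff Bochner_Integration.integrable_add integrable_mult_right i)
  have "(\<integral>s. f s \<partial>lborel) = \<alpha> * tricomi_integral \<alpha> \<gamma> x + (\<alpha> + \<gamma> + 1 - of_real x) * tricomi_integral (\<alpha> + 1) \<gamma> x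
     - of_real x * tricomi_integral (\<alpha> + 2) \<gamma> x"
    unfolding f_def tricomi_integral_def e_def[symmetric]
    using i by simp
  moreover have "(\<integral>s. f s \<partial>lborel) = (LBINT s=0..\<infinity>. f s)"
    unfolding interval_lebesgue_integral_0_infty set_lebesgue_integral_def
    by (intro Bochner_Integration.integral_cong) (auto simp: f_def tricomi_weight_def indicator_def)
  moreover have "(LBINT s=0..\<infinity>. f s) = 0 - 0"
  proof (rule interval_integral_FTC_integrable)
    show "(0::ereal) < \<infinity>" by simp
    show "set_integrable lborel (einterval 0 \<infinity>) f"
      using fi unfolding set_integrable_def by (intro integrable_mult_indicator) auto
    have nF: "norm (F s) = exp (- (x * s)) * (s powr Re \<alpha> * (1 + s) powr (Re \<gamma> + 1))" if "s > 0" for s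
      using that by (simp add: F_def e_def norm_mult norm_powr_real_powr del: of_real_add)
    have "(F \<longlongrightarrow> 0) (at_right 0)"
    proof (rule tendsto_norm_zero_cancel, rule tendsto_cong[THEN iffD1])
      show "\<forall>\<^sub>F s in at_right 0. exp (- (x * s)) * (s powr Re \<alpha> * (1 + s) powr (Re \<gamma> + 1)) = norm (F s)"
        using eventually_at_right_less[of 0] by eventually_elim (simp add: nF)
      have "((\<lambda>s. exp (- (x * s)) * (s powr Re \<alpha> * (1 + s) powr (Re \<gamma> + 1))) \<longlongrightarrow>
          exp (- (x * 0)) * (0 * (1 + 0) powr (Re \<gamma> + 1))) (at_right 0)"
        using tendsto_powr'[of "\<lambda>s. s" 0 "at_right 0" "\<lambda>_. Re \<alpha>" "Re \<alpha>"] \<alpha>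
        by (intro tendsto_mult tendsto_exp tendsto_minus tendsto_powr tendsto_add tendsto_const tendsto_ident_at)
          (auto simp: eventually_at_filter)
      then show "((\<lambda>s. exp (- (x * s)) * (s powr Re \<alpha> * (1 + s) powr (Re \<gamma> + 1))) \<longlongrightarrow> 0) (at_right 0)"
        by simp
    qed
    then show "((F \<circ> real_of_ereal) \<longlongrightarrow> 0) (at_right 0)"
      by (simp add: zero_ereal_def ereal_tendsto_simps)
    have "(F \<longlongrightarrow> 0) at_top"
    proof (rule tendsto_norm_zero_cancel, rule tendsto_cong[THEN iffD1])
      show "\<forall>\<^sub>F s in at_top. exp (- (x * s)) * (s powr Re \<alpha> * (1 + s) powr (Re \<gamma> + 1)) = norm (F s)"
        using eventually_gt_at_top[of 0] by eventually_elim (simp add: nF)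
      obtain C where C: "\<And>s. s \<ge> 0 \<Longrightarrow> (1 + s) powr (Re \<alpha> + (Re \<gamma> + 1)) \<le> C * exp (x / 2 * s)" "C > 0"
        using one_plus_powr_le_exp[of "x / 2"] x by (metis half_gt_zero)
      have lim: "((\<lambda>s. C * exp (- (x / 2 * s))) \<longlongrightarrow> 0) at_top" using x by real_asymp
      show "((\<lambda>s. exp (- (x * s)) * (s powr Re \<alpha> * (1 + s) powr (Re \<gamma> + 1))) \<longlongrightarrow> 0) at_top"
      proof (rule tendsto_sandwich[OF _ _ tendsto_const lim])
        show "\<forall>\<^sub>F s in at_top. exp (- (x * s)) * (s powr Re \<alpha> * (1 + s) powr (Re \<gamma> + 1)) \<le> C * exp (- (x / 2 * s))"
          using eventually_gt_at_top[of 0]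
        proof eventually_elim
          case (elim s)
          have "s powr Re \<alpha> * (1 + s) powr (Re \<gamma> + 1) \<le> (1 + s) powr Re \<alpha> * (1 + s) powr (Re \<gamma> + 1)"
            using elim \<alpha> by (intro mult_right_mono powr_mono2) auto
          also have "\<dots> \<le> C * exp (x / 2 * s)" using C(1)[of s] elim by (simp add: powr_add)
          finally have "exp (- (x * s)) * (s powr Re \<alpha> * (1 + s) powr (Re \<gamma> + 1)) \<le> exp (- (x * s)) * (C * exp (x / 2 * s))"
            by (intro mult_left_mono) auto
          also have "\<dots> = C * (exp (- (x * s)) * exp (x / 2 * s))" by simp
          also have "exp (- (x * s)) * exp (x / 2 * s) = exp (- (x / 2 * s))" by (simp add: exp_add[symmetric])
          finally show ?case .
        qed
      qed auto
    qed
    then show "((F \<circ> real_of_ereal) \<longlongrightarrow> 0) (at_left \<infinity>)"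
      by (simp add: ereal_tendsto_simps)
    have pd: "((\<lambda>s. complex_of_real (p + s) powr r) has_vector_derivative r * of_real (p + s) powr (r - 1)) (at s)"
      if "s > 0" "p \<ge> 0" for r s and p :: real
    proof -
      have "((\<lambda>z. (of_real p + z) powr r) has_field_derivative r * (of_real p + of_real s) powr (r - 1)) (at (complex_of_real s))"
        using that by (auto intro!: derivative_eq_intros simp: complex_nonpos_Reals_iff)
      from has_vector_derivative_real_field[OF this] show ?thesis by simp
    qed
    have f_eq: "f s = e s * (of_real s powr (\<alpha> - 1) * of_real (1 + s) powr \<gamma> *
        (\<alpha> + (\<alpha> + \<gamma> + 1 - of_real x) * of_real s - of_real x * (of_real s * of_real s)))" if "s > 0" for s
    proof -
      have "tricomi_weight (\<alpha> + 1) \<gamma> s = of_real s * tricomi_weight \<alpha> \<gamma> s"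
        by (simp add: tricomi_weight_Suc)
      moreover have "tricomi_weight (\<alpha> + 2) \<gamma> s = of_real s * (of_real s * tricomi_weight \<alpha> \<gamma> s)"
        by (simp add: tricomi_weight_Suc add.assoc)
      moreover have "tricomi_weight \<alpha> \<gamma> s = of_real s powr (\<alpha> - 1) * of_real (1 + s) powr \<gamma>"
        using that by (simp add: tricomi_weight_def)
      ultimately show ?thesis unfolding f_def by (simp add: algebra_simps)
    qed
    show "(F has_vector_derivative f s) (at s)" if "0 < ereal s" "ereal s < \<infinity>" for s
    proof -
      have s: "s > 0" using that by simp
      have e': "(e has_vector_derivative of_real (- (x * exp (- (x * s))))) (at s)"
        unfolding e_def by (auto intro!: derivative_eq_intros)
      have "(F has_vector_derivative e s * (of_real s powr \<alpha> * ((\<gamma> + 1) * of_real (1 + s) powr (\<gamma> + 1 - 1)) +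
          (\<alpha> * of_real s powr (\<alpha> - 1)) * of_real (1 + s) powr (\<gamma> + 1)) +
          of_real (- (x * exp (- (x * s)))) * (of_real s powr \<alpha> * of_real (1 + s) powr (\<gamma> + 1))) (at s)"
        unfolding F_def using pd[of s 0 \<alpha>] pd[of s 1 "\<gamma> + 1"] s
        by (intro has_vector_derivative_mult e') auto
      also have "of_real (1 + s) powr (\<gamma> + 1) = of_real (1 + s) * complex_of_real (1 + s) powr \<gamma>"
        using s by (simp add: powr_add complex_eq_iff)
      also have "complex_of_real s powr \<alpha> = of_real s * complex_of_real s powr (\<alpha> - 1)"
        using s by (simp add: powr_diff)
      also have "of_real (- (x * exp (- (x * s)))) = - (of_real x * e s)" by (simp add: e_def)
      finally show ?thesis
        by (rule has_vector_derivative_eq_rhs) (simp add: f_eq[OF s] algebra_simps)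
    qed
    show "isCont f s" if "0 < ereal s" "ereal s < \<infinity>" for s
    proof -
      have s: "s > 0" using that by simp
      have "isCont (\<lambda>s. e s * (of_real s powr (\<alpha> - 1) * of_real (1 + s) powr \<gamma> *
        (\<alpha> + (\<alpha> + \<gamma> + 1 - of_real x) * of_real s - of_real x * (of_real s * of_real s)))) s"
        unfolding e_def using s by (intro continuous_intros) (auto simp: complex_nonpos_Reals_iff)
      moreover have "\<forall>\<^sub>F s in nhds s. f s = e s * (of_real s powr (\<alpha> - 1) * of_real (1 + s) powr \<gamma> *
        (\<alpha> + (\<alpha> + \<gamma> + 1 - of_real x) * of_real s - of_real x * (of_real s * of_real s)))"
        using eventually_nhds_in_open[of "{0<..}" s] s by (auto elim!: eventually_mono simp: f_eq)
      ultimately show ?thesis by (subst isCont_cong)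
    qed
  qed
  ultimately show ?thesis by (simp add: algebra_simps)
qed

section \<open>Existence of the Whittaker functions\<close>

text \<open>The classical recurrences for Whittaker functions as a first-order system for
  $u = W_{c+1,b}$ and $v = W_{c,b}$, with $\tau = (c+1/2)^2 - b^2$.\<close>

definition whittaker_system :: "real \<Rightarrow> real \<Rightarrow> (real \<Rightarrow> complex) \<Rightarrow> (real \<Rightarrow> complex) \<Rightarrow> bool" where
  "whittaker_system c \<tau> u v \<longleftrightarrow> (\<forall>x>0.
     (v has_vector_derivative (of_real (x / 2 - c) * v x - u x) / of_real x) (at x) \<and>
     (u has_vector_derivative (of_real (c + 1 - x / 2) * u x + of_real \<tau> * v x) / of_real x) (at x))"

lemma whittaker_system_ode:
  assumes sys: "whittaker_system c \<tau> u v" and \<tau>: "\<tau> = (c + 1/2)\<^sup>2 - \<beta>"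
  shows "whittaker_ode c \<beta> v (\<lambda>x. (of_real (x / 2 - c) * v x - u x) / of_real x)"
    and "whittaker_ode (c + 1) \<beta> u (\<lambda>x. (of_real (c + 1 - x / 2) * u x + of_real \<tau> * v x) / of_real x)"
proof -
  define v' where "v' x = (of_real (x / 2 - c) * v x - u x) / of_real x" for x
  define u' where "u' x = (of_real (c + 1 - x / 2) * u x + of_real \<tau> * v x) / of_real x" for x
  have v': "(v has_vector_derivative v' x) (at x)" and u': "(u has_vector_derivative u' x) (at x)" if "x > 0" for x
    using sys that unfolding whittaker_system_def v'_def u'_def by auto
  have "(v' has_vector_derivative - (of_real (whittaker_coeff c \<beta> x) * v x)) (at x)" if x: "x > 0" for x
  proof -
    have l: "((\<lambda>x. complex_of_real (x / 2 - c)) has_vector_derivative of_real (1/2)) (at x)"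
      by (rule has_vector_derivative_of_real) (auto intro!: derivative_eq_intros)
    have i: "(complex_of_real has_vector_derivative of_real 1) (at x)"
      by (rule has_vector_derivative_of_real) (auto intro!: derivative_eq_intros)
    have X: "complex_of_real x \<noteq> 0" using x by simp
    have "(v' has_vector_derivative (((of_real (x / 2 - c) * v' x + of_real (1/2) * v x) - u' x) * of_real x
        - (of_real (x / 2 - c) * v x - u x) * of_real 1) / (of_real x * of_real x)) (at x)"
      unfolding v'_def[abs_def]
      by (intro has_vector_derivative_quotient has_vector_derivative_diff has_vector_derivative_mult l i
          u'[OF x] v'[OF x, unfolded v'_def] X)
    also have "((of_real (x / 2 - c) * v' x + of_real (1/2) * v x) - u' x) * of_real x
        - (of_real (x / 2 - c) * v x - u x) * of_real 1 =
        of_real (x / 2 - c) * (of_real x * v' x) + of_real (1/2) * v x * of_real x - of_real x * u' x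
        - (of_real (x / 2 - c) * v x - u x)" by (simp add: algebra_simps)
    also have "of_real x * v' x = of_real (x / 2 - c) * v x - u x" using X by (simp add: v'_def)
    also have "of_real x * u' x = of_real (c + 1 - x / 2) * u x + of_real \<tau> * v x" using X by (simp add: u'_def)
    also have "of_real (x / 2 - c) * (of_real (x / 2 - c) * v x - u x) + of_real (1/2) * v x * of_real x
        - (of_real (c + 1 - x / 2) * u x + of_real \<tau> * v x) - (of_real (x / 2 - c) * v x - u x) =
        - (of_real (- x\<^sup>2 / 4 + c * x + (1/4 - \<beta>)) * v x)"
      unfolding \<tau> by (simp add: field_simps power2_eq_square)
    also have "\<dots> / (of_real x * of_real x) = - (of_real ((- x\<^sup>2 / 4 + c * x + (1/4 - \<beta>)) / (x * x)) * v x)"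
      by simp
    also have "(- x\<^sup>2 / 4 + c * x + (1/4 - \<beta>)) / (x * x) = whittaker_coeff c \<beta> x"
      unfolding whittaker_coeff_def using x by (simp add: field_simps power2_eq_square)
    finally show ?thesis .
  qed
  then show "whittaker_ode c \<beta> v v'" unfolding whittaker_ode_def using v' by blast
  have "(u' has_vector_derivative - (of_real (whittaker_coeff (c + 1) \<beta> x) * u x)) (at x)" if x: "x > 0" for x
  proof -
    have l: "((\<lambda>x. complex_of_real (c + 1 - x / 2)) has_vector_derivative of_real (- 1/2)) (at x)"
      by (rule has_vector_derivative_of_real) (auto intro!: derivative_eq_intros)
    have i: "(complex_of_real has_vector_derivative of_real 1) (at x)"
      by (rule has_vector_derivative_of_real) (auto intro!: derivative_eq_intros)
    have X: "complex_of_real x \<noteq> 0" using x by simp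
    have "(u' has_vector_derivative (((of_real (c + 1 - x / 2) * u' x + of_real (- 1/2) * u x) + of_real \<tau> * v' x) * of_real x
        - (of_real (c + 1 - x / 2) * u x + of_real \<tau> * v x) * of_real 1) / (of_real x * of_real x)) (at x)"
      unfolding u'_def[abs_def]
      by (intro has_vector_derivative_quotient has_vector_derivative_add has_vector_derivative_mult
          has_vector_derivative_mult_right l i v'[OF x] u'[OF x, unfolded u'_def] X)
    also have "((of_real (c + 1 - x / 2) * u' x + of_real (- 1/2) * u x) + of_real \<tau> * v' x) * of_real x
        - (of_real (c + 1 - x / 2) * u x + of_real \<tau> * v x) * of_real 1 =
        of_real (c + 1 - x / 2) * (of_real x * u' x) + of_real (- 1/2) * u x * of_real x + of_real \<tau> * (of_real x * v' x)
        - (of_real (c + 1 - x / 2) * u x + of_real \<tau> * v x)" by (simp add: algebra_simps)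
    also have "of_real x * v' x = of_real (x / 2 - c) * v x - u x" using X by (simp add: v'_def)
    also have "of_real x * u' x = of_real (c + 1 - x / 2) * u x + of_real \<tau> * v x" using X by (simp add: u'_def)
    also have "of_real (c + 1 - x / 2) * (of_real (c + 1 - x / 2) * u x + of_real \<tau> * v x) + of_real (- 1/2) * u x * of_real x
        + of_real \<tau> * (of_real (x / 2 - c) * v x - u x) - (of_real (c + 1 - x / 2) * u x + of_real \<tau> * v x) =
        - (of_real (- x\<^sup>2 / 4 + (c + 1) * x + (1/4 - \<beta>)) * u x)"
      unfolding \<tau> by (simp add: field_simps power2_eq_square)
    also have "\<dots> / (of_real x * of_real x) = - (of_real ((- x\<^sup>2 / 4 + (c + 1) * x + (1/4 - \<beta>)) / (x * x)) * u x)"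
      by simp
    also have "(- x\<^sup>2 / 4 + (c + 1) * x + (1/4 - \<beta>)) / (x * x) = whittaker_coeff (c + 1) \<beta> x"
      unfolding whittaker_coeff_def using x by (simp add: field_simps power2_eq_square)
    finally show ?thesis .
  qed
  then show "whittaker_ode (c + 1) \<beta> u u'" unfolding whittaker_ode_def using u' by blast
qed

text \<open>The function \<open>v\<close> is the Laplace integral with the usual prefactor, and \<open>u\<close> is defined through
  the first equation of the system, since its own integral need not converge.  The second
  equation then is Kummer's relation.\<close>

lemma whittaker_pair_exists:
  assumes b: "b\<^sup>2 = of_real \<beta>" and \<alpha>0: "Re (b - of_real c + 1/2) > 0"
  obtains u v where "whittaker_system c ((c + 1/2)\<^sup>2 - \<beta>) u v"
    "((\<lambda>x. v x / of_real (exp (- x / 2) * x powr c)) \<longlongrightarrow> 1) at_top"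
    "((\<lambda>x. u x / of_real (exp (- x / 2) * x powr (c + 1))) \<longlongrightarrow> 1) at_top"
proof -
  \<comment> \<open>With these parameters $W_{c,b}(x) = e^{-x/2} x^{b+1/2} U(\alpha, 1 + 2 b, x)$.\<close>
  define \<alpha> where "\<alpha> = b - of_real c + 1/2"
  define \<gamma> where "\<gamma> = b + of_real c - 1/2"
  have \<alpha>: "Re \<alpha> > 0" using \<alpha>0 by (simp add: \<alpha>_def)
  have \<Gamma>: "Gamma \<alpha> \<noteq> 0" using \<alpha> by (auto simp: Gamma_eq_zero_iff elim!: nonpos_Ints_cases)
  define E where "E x = of_real (exp (- x / 2)) * of_real x powr (b + 1/2) / Gamma \<alpha>" for x :: real
  define P where "P x = E x * tricomi_integral \<alpha> \<gamma> x" for x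
  define Q where "Q x = E x * tricomi_integral (\<alpha> + 1) \<gamma> x" for x
  \<comment> \<open>The constant for which \<open>u\<close> below satisfies the first equation of the system with \<open>v = P\<close>.\<close>
  define m where "m = of_real c + b + 1/2"
  define u where "u x = (of_real x - m) * P x + of_real x * Q x" for x
  define k where "k x = - (1/2) + (b + 1/2) / of_real x" for x
  have E': "(E has_vector_derivative k x * E x) (at x)" if x: "x > 0" for x
  proof -
    have "((\<lambda>z. z powr (b + 1/2)) has_field_derivative (b + 1/2) * of_real x powr (b + 1/2 - 1)) (at (complex_of_real x))"
      using x by (intro has_field_derivative_powr) (auto simp: complex_nonpos_Reals_iff)
    from has_vector_derivative_real_field[OF this]
    have pw: "((\<lambda>x. complex_of_real x powr (b + 1/2)) has_vector_derivative (b + 1/2) * of_real x powr (b + 1/2 - 1)) (at x)" .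
    have ex: "((\<lambda>x. complex_of_real (exp (- x / 2))) has_vector_derivative of_real (- exp (- x / 2) / 2)) (at x)"
      by (rule has_vector_derivative_of_real) (auto intro!: derivative_eq_intros)
    have "(E has_vector_derivative (of_real (exp (- x / 2)) * ((b + 1/2) * of_real x powr (b + 1/2 - 1)) +
       of_real (- exp (- x / 2) / 2) * of_real x powr (b + 1/2)) / Gamma \<alpha>) (at x)"
      unfolding E_def by (intro has_vector_derivative_divide has_vector_derivative_mult ex pw)
    moreover have "complex_of_real x powr (b + 1/2 - 1) = of_real x powr (b + 1/2) / of_real x"
      using x by (subst powr_diff) simp
    ultimately show ?thesis
      by (elim has_vector_derivative_eq_rhs) (simp add: E_def k_def field_simps \<Gamma>)
  qed
  have P': "(P has_vector_derivative k x * P x - Q x) (at x)" if x: "x > 0" for x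
    unfolding P_def Q_def
    by (rule has_vector_derivative_eq_rhs, rule has_vector_derivative_mult[OF E'[OF x] has_vector_derivative_tricomi[OF \<alpha> x]])
      (simp add: algebra_simps)
  have Q': "(Q has_vector_derivative k x * Q x - (\<alpha> * P x + (1 + 2 * b - of_real x) * Q x) / of_real x) (at x)" if x: "x > 0" for x
  proof -
    have "(Q has_vector_derivative E x * - tricomi_integral (\<alpha> + 1 + 1) \<gamma> x + k x * E x * tricomi_integral (\<alpha> + 1) \<gamma> x) (at x)"
      unfolding Q_def using \<alpha> x by (intro has_vector_derivative_mult E' has_vector_derivative_tricomi) auto
    moreover have "tricomi_integral (\<alpha> + 2) \<gamma> x =
      (\<alpha> * tricomi_integral \<alpha> \<gamma> x + (\<alpha> + \<gamma> + 1 - of_real x) * tricomi_integral (\<alpha> + 1) \<gamma> x) / of_real x"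
      using kummer_relation[OF \<alpha> x, of \<gamma>] x by (simp add: field_simps)
    moreover have "\<alpha> + 1 + 1 = \<alpha> + 2" by simp
    moreover have "\<alpha> + \<gamma> + 1 = 1 + 2 * b" by (simp add: \<alpha>_def \<gamma>_def)
    ultimately show ?thesis
      by (simp only:) (elim has_vector_derivative_eq_rhs, use x in \<open>simp add: P_def Q_def field_simps\<close>)
  qed
  have "whittaker_system c ((c + 1/2)\<^sup>2 - \<beta>) u P"
    unfolding whittaker_system_def
  proof (intro allI impI conjI)
    fix x :: real assume x: "x > 0"
    have X: "complex_of_real x \<noteq> 0" using x by simp
    have kX: "of_real x * k x = - of_real x / 2 + b + 1/2" using X by (simp add: k_def field_simps)
    show "(P has_vector_derivative (of_real (x / 2 - c) * P x - u x) / of_real x) (at x)"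
    proof (rule has_vector_derivative_eq_rhs[OF P'[OF x]])
      have "of_real x * (k x * P x - Q x) = (- of_real x / 2 + b + 1/2) * P x - of_real x * Q x"
        unfolding kX[symmetric] by (simp add: algebra_simps)
      also have "\<dots> = of_real (x / 2 - c) * P x - u x"
        by (simp add: u_def m_def field_simps)
      finally show "k x * P x - Q x = (of_real (x / 2 - c) * P x - u x) / of_real x"
        using X by (simp add: field_simps)
    qed
    have i: "(complex_of_real has_vector_derivative of_real 1) (at x)"
      by (rule has_vector_derivative_of_real) (auto intro!: derivative_eq_intros)
    have "(u has_vector_derivative ((of_real x - m) * (k x * P x - Q x) + (of_real 1 - 0) * P x) +
        (of_real x * (k x * Q x - (\<alpha> * P x + (1 + 2 * b - of_real x) * Q x) / of_real x) + of_real 1 * Q x)) (at x)"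
      unfolding u_def
      by (intro has_vector_derivative_add has_vector_derivative_mult has_vector_derivative_diff i has_vector_derivative_const P'[OF x] Q'[OF x])
    then show "(u has_vector_derivative (of_real (c + 1 - x / 2) * u x + of_real ((c + 1 / 2)\<^sup>2 - \<beta>) * P x) / of_real x) (at x)"
    proof (rule has_vector_derivative_eq_rhs)
      have "of_real x * (((of_real x - m) * (k x * P x - Q x) + (of_real 1 - 0) * P x) +
        (of_real x * (k x * Q x - (\<alpha> * P x + (1 + 2 * b - of_real x) * Q x) / of_real x) + of_real 1 * Q x)) =
        (of_real x - m) * ((of_real x * k x) * P x - of_real x * Q x) + of_real x * P x +
        (of_real x * ((of_real x * k x) * Q x) - of_real x * (\<alpha> * P x + (1 + 2 * b - of_real x) * Q x)) + of_real x * Q x"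
        using X by (simp add: field_simps)
      also have "\<dots> = of_real (c + 1 - x / 2) * u x + ((of_real c + 1 / 2)\<^sup>2 - b\<^sup>2) * P x"
        unfolding kX u_def m_def \<alpha>_def by (simp add: field_simps power2_eq_square)
      also have "(of_real c + 1 / 2)\<^sup>2 - b\<^sup>2 = of_real ((c + 1 / 2)\<^sup>2 - \<beta>)" using b by simp
      finally show "((of_real x - m) * (k x * P x - Q x) + (of_real 1 - 0) * P x) +
        (of_real x * (k x * Q x - (\<alpha> * P x + (1 + 2 * b - of_real x) * Q x) / of_real x) + of_real 1 * Q x) =
        (of_real (c + 1 - x / 2) * u x + of_real ((c + 1 / 2)\<^sup>2 - \<beta>) * P x) / of_real x"
        using X by (metis nonzero_mult_div_cancel_left)
    qed
  qed
  moreover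
  have pc: "complex_of_real x powr (b + 1/2) = of_real (x powr c) * of_real x powr \<alpha>" if "x > 0" for x
  proof -
    have "complex_of_real x powr (b + 1/2) = of_real x powr (of_real c + \<alpha>)" by (simp add: \<alpha>_def algebra_simps)
    then show ?thesis using that by (simp add: powr_add powr_of_real)
  qed
  have lim0: "((\<lambda>x. of_real x powr \<alpha> * tricomi_integral \<alpha> \<gamma> x / Gamma \<alpha>) \<longlongrightarrow> 1) at_top"
    using tendsto_divide[OF tricomi_integral_asymptotics[OF \<alpha>] tendsto_const \<Gamma>] \<Gamma> by simp
  then have limP: "((\<lambda>x. P x / of_real (exp (- x / 2) * x powr c)) \<longlongrightarrow> 1) at_top"
    by (rule tendsto_cong[THEN iffD1, rotated], intro eventually_mono[OF eventually_gt_at_top[of 0]])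
      (simp add: P_def E_def pc)
  moreover have "((\<lambda>x. u x / of_real (exp (- x / 2) * x powr (c + 1))) \<longlongrightarrow> 1) at_top"
  proof -
    have inv0: "((\<lambda>x. complex_of_real (1 / x)) \<longlongrightarrow> of_real 0) at_top"
      by (intro tendsto_of_real) real_asymp
    have "((\<lambda>x. of_real x powr (\<alpha> + 1) * tricomi_integral (\<alpha> + 1) \<gamma> x) \<longlongrightarrow> Gamma (\<alpha> + 1)) at_top"
      using \<alpha> by (intro tricomi_integral_asymptotics) auto
    then have "((\<lambda>x. (1 - m * of_real (1 / x)) * (of_real x powr \<alpha> * tricomi_integral \<alpha> \<gamma> x / Gamma \<alpha>) +
        of_real (1 / x) * ((of_real x powr (\<alpha> + 1) * tricomi_integral (\<alpha> + 1) \<gamma> x) / Gamma \<alpha>)) \<longlongrightarrow>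
        (1 - m * of_real 0) * 1 + of_real 0 * (Gamma (\<alpha> + 1) / Gamma \<alpha>)) at_top"
      by (intro tendsto_intros inv0 lim0 \<Gamma>)
    then have lim: "((\<lambda>x. (1 - m * of_real (1 / x)) * (of_real x powr \<alpha> * tricomi_integral \<alpha> \<gamma> x / Gamma \<alpha>) +
        of_real (1 / x) * ((of_real x powr (\<alpha> + 1) * tricomi_integral (\<alpha> + 1) \<gamma> x) / Gamma \<alpha>)) \<longlongrightarrow> 1) at_top"
      by simp
    then show ?thesis
    proof (rule tendsto_cong[THEN iffD1, rotated], intro eventually_mono[OF eventually_gt_at_top[of 0]])
      fix x :: real assume x: "x > 0"
      have pa: "complex_of_real x powr (\<alpha> + 1) = of_real x * of_real x powr \<alpha>" using x by (simp add: powr_add)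
      have pr: "x powr (c + 1) = x * x powr c" using x by (simp add: powr_add)
      have nz: "complex_of_real (exp (- x / 2)) \<noteq> 0" "complex_of_real (x powr c) \<noteq> 0" "complex_of_real x \<noteq> 0"
        using x by auto
      have "u x = of_real (exp (- x / 2)) * of_real (x powr c) * ((of_real x - m) * (of_real x powr \<alpha> * tricomi_integral \<alpha> \<gamma> x / Gamma \<alpha>)
         + of_real x * (of_real x powr \<alpha> * tricomi_integral (\<alpha> + 1) \<gamma> x / Gamma \<alpha>))"
        unfolding u_def P_def Q_def E_def pc[OF x] by (simp add: field_simps \<Gamma>)
      then have "u x / of_real (exp (- x / 2) * x powr (c + 1)) =
         ((of_real x - m) * (of_real x powr \<alpha> * tricomi_integral \<alpha> \<gamma> x / Gamma \<alpha>)
         + of_real x * (of_real x powr \<alpha> * tricomi_integral (\<alpha> + 1) \<gamma> x / Gamma \<alpha>)) / of_real x"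
        unfolding pr of_real_mult using nz by (simp add: field_simps)
      also have "\<dots> = (1 - m * of_real (1 / x)) * (of_real x powr \<alpha> * tricomi_integral \<alpha> \<gamma> x / Gamma \<alpha>) +
        of_real (1 / x) * ((of_real x powr (\<alpha> + 1) * tricomi_integral (\<alpha> + 1) \<gamma> x) / Gamma \<alpha>)"
        unfolding pa using nz \<Gamma> by (simp add: field_simps)
      finally show "(1 - m * of_real (1 / x)) * (of_real x powr \<alpha> * tricomi_integral \<alpha> \<gamma> x / Gamma \<alpha>) +
        of_real (1 / x) * ((of_real x powr (\<alpha> + 1) * tricomi_integral (\<alpha> + 1) \<gamma> x) / Gamma \<alpha>) =
        u x / of_real (exp (- x / 2) * x powr (c + 1))" by simp
    qed
  qed
  ultimately show thesis using that[of u P] by blast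
qed

section \<open>A factorised bound for the Whittaker kernel\<close>

text \<open>Near 0 the energy estimate bounds \<open>v\<close> and \<open>x v'\<close>, and \<open>u\<close> is a bounded combination of the
  two.  At infinity the normalisation gives the factor $e^{-x}$, half of which pays for the
  powers of \<open>x\<close>.\<close>

lemma whittaker_pair_decay:
  assumes sys: "whittaker_system c \<tau> u v" and \<tau>: "\<tau> = (c + 1/2)\<^sup>2 - \<beta>" and \<beta>: "\<beta> < 1/4"
    and limv: "((\<lambda>x. v x / of_real (exp (- x / 2) * x powr c)) \<longlongrightarrow> 1) at_top"
    and limu: "((\<lambda>x. u x / of_real (exp (- x / 2) * x powr (c + 1))) \<longlongrightarrow> 1) at_top"
  obtains C where "C > 0" "\<And>x. x > 0 \<Longrightarrow> (cmod (u x))\<^sup>2 + (cmod (v x))\<^sup>2 \<le> C * exp (- x / 2)"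
proof -
  define g where "g x = ((cmod (u x))\<^sup>2 + (cmod (v x))\<^sup>2) * exp (x / 2)" for x
  obtain x0 B where x0: "x0 > 0" and B: "\<And>x. 0 < x \<Longrightarrow> x \<le> x0 \<Longrightarrow>
      cmod (v x) \<le> B \<and> cmod (of_real x * ((of_real (x / 2 - c) * v x - u x) / of_real x)) \<le> B"
    using whittaker_ode_bounded_near_zero[OF whittaker_system_ode(1)[OF sys \<tau>] \<beta>] by metis
  define B' where "B' = (x0 / 2 + \<bar>c\<bar>) * B + B"
  have g_near: "g x \<le> (B'\<^sup>2 + B\<^sup>2) * exp (x0 / 2)" if x: "0 < x" "x \<le> x0" for x
  proof -
    have v: "cmod (v x) \<le> B" and w: "cmod (of_real (x / 2 - c) * v x - u x) \<le> B" using B[OF x] x by auto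
    have B0: "B \<ge> 0" using v norm_ge_zero order_trans by blast
    have "cmod (u x) = cmod (of_real (x / 2 - c) * v x - (of_real (x / 2 - c) * v x - u x))" by simp
    also have "\<dots> \<le> cmod (of_real (x / 2 - c) * v x) + cmod (of_real (x / 2 - c) * v x - u x)"
      by (rule norm_triangle_ineq4)
    also have "\<dots> \<le> (x0 / 2 + \<bar>c\<bar>) * B + B"
    proof (rule add_mono[OF _ w])
      have "cmod (of_real (x / 2 - c) * v x) = \<bar>x / 2 - c\<bar> * cmod (v x)" by (simp only: norm_mult norm_of_real)
      also have "\<dots> \<le> (x0 / 2 + \<bar>c\<bar>) * B"
        using x by (intro mult_mono v) (auto simp: abs_if)
      finally show "cmod (of_real (x / 2 - c) * v x) \<le> (x0 / 2 + \<bar>c\<bar>) * B" .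
    qed
    finally have "cmod (u x) \<le> B'" by (simp add: B'_def)
    then show ?thesis unfolding g_def using v x
      by (intro mult_mono add_mono power_mono) (auto simp: add_nonneg_nonneg)
  qed
  have lim_aux: "((\<lambda>x. (cmod (w x))\<^sup>2 * exp (x / 2)) \<longlongrightarrow> 0) at_top"
    if w: "((\<lambda>x. w x / of_real (exp (- x / 2) * x powr r)) \<longlongrightarrow> 1) at_top" for w :: "real \<Rightarrow> complex" and r
  proof -
    have "((\<lambda>x::real. (exp (- x / 2) * x powr r)\<^sup>2 * exp (x / 2)) \<longlongrightarrow> 0) at_top" by real_asymp
    then have "((\<lambda>x. (cmod (w x / of_real (exp (- x / 2) * x powr r)))\<^sup>2 * ((exp (- x / 2) * x powr r)\<^sup>2 * exp (x / 2))) \<longlongrightarrow> (cmod 1)\<^sup>2 * 0) at_top"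
      by (intro tendsto_intros w)
    then have "((\<lambda>x. (cmod (w x / of_real (exp (- x / 2) * x powr r)))\<^sup>2 * ((exp (- x / 2) * x powr r)\<^sup>2 * exp (x / 2))) \<longlongrightarrow> 0) at_top"
      by simp
    then show ?thesis
      by (rule tendsto_cong[THEN iffD1, rotated], intro eventually_mono[OF eventually_gt_at_top[of 0]])
        (auto simp: norm_divide norm_mult power_divide power_mult_distrib)
  qed
  have "((\<lambda>x. (cmod (u x))\<^sup>2 * exp (x / 2) + (cmod (v x))\<^sup>2 * exp (x / 2)) \<longlongrightarrow> 0 + 0) at_top"
    by (intro tendsto_add lim_aux[OF limu] lim_aux[OF limv])
  then have "(g \<longlongrightarrow> 0) at_top" by (simp add: g_def[abs_def] distrib_right)
  then have "\<forall>\<^sub>F x in at_top. g x < 1" by (rule order_tendstoD) simp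
  then obtain R where R: "\<And>x. x \<ge> R \<Longrightarrow> g x < 1" by (auto simp: eventually_at_top_linorder)
  have "continuous_on {x0..max x0 R} g"
  proof -
    have "continuous_on {x0..max x0 R} u" "continuous_on {x0..max x0 R} v"
      using sys x0 unfolding whittaker_system_def
      by (intro continuous_at_imp_continuous_on ballI;
          metis atLeastAtMost_iff has_vector_derivative_continuous less_le_trans)+
    then show ?thesis unfolding g_def by (intro continuous_intros) auto
  qed
  then have "bounded (g ` {x0..max x0 R})"
    by (intro compact_imp_bounded compact_continuous_image) auto
  then obtain G where "\<And>x. x \<in> {x0..max x0 R} \<Longrightarrow> \<bar>g x\<bar> \<le> G"
    unfolding bounded_iff real_norm_def by (metis imageI)
  then have G: "g x \<le> G" if "x0 \<le> x" "x \<le> R" for x using that by (smt (verit) atLeastAtMost_iff max.coboundedI2)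
  define C where "C = max 1 (max ((B'\<^sup>2 + B\<^sup>2) * exp (x0 / 2)) G)"
  have "g x \<le> C" if "x > 0" for x
    using g_near[of x] G[of x] R[of x] that unfolding C_def by (smt (verit) max_def)
  then have "(cmod (u x))\<^sup>2 + (cmod (v x))\<^sup>2 \<le> C * exp (- x / 2)" if "x > 0" for x
    using that by (simp add: g_def exp_minus field_simps)
  moreover have "C > 0" by (simp add: C_def)
  ultimately show thesis using that by blast
qed

text \<open>The point is to gain the factor \<open>|x - y|\<close> that cancels the denominator of the kernel.  For
  \<open>N(t) = u(t x) v(t y) - v(t x) u(t y)\<close> the system gives
  \<open>(N(t) / t)' = (y - x) (u(t x) v(t y) + v(t x) u(t y)) / (2 t)\<close>, and \<open>N(t) / t\<close> vanishes at
  infinity.  The derivative is dominated by that of the explicit function \<open>g\<close>, so comparing the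
  increments over \<open>[1, \<infinity>)\<close> yields the bound.\<close>

lemma whittaker_wronskian_bound:
  assumes sys: "whittaker_system c \<tau> u v"
    and C: "C > 0" "\<And>x. x > 0 \<Longrightarrow> (cmod (u x))\<^sup>2 + (cmod (v x))\<^sup>2 \<le> C * exp (- x / 2)"
    and x: "x > 0" and y: "y > 0"
  shows "cmod (u x * v y - v x * u y) \<le> \<bar>x - y\<bar> * (C / 2) * (x * y) powr (- 1/4) * exp (- (x + y) / 4)"
proof -
  define N where "N t = u (t * x) * v (t * y) - v (t * x) * u (t * y)" for t
  define f where "f t = N t / of_real t" for t
  define f' where "f' t = of_real ((y - x) / (2 * t)) * (u (t * x) * v (t * y) + v (t * x) * u (t * y))" for t
  define K where "K = \<bar>x - y\<bar> * (C / 2) * (x * y) powr (- 1/4)"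
  define g where "g t = - (K * t powr (- 1/2) * exp (- t * (x + y) / 4))" for t
  define g' where "g' t = K * exp (- t * (x + y) / 4) * (t powr (- 3/2) / 2 + t powr (- 1/2) * ((x + y) / 4))" for t
  have K: "K \<ge> 0" using C by (simp add: K_def)
  have scale: "((\<lambda>t. w (t * r)) has_vector_derivative r *\<^sub>R D) (at t)"
    if "(w has_vector_derivative D) (at (t * r))" for w :: "real \<Rightarrow> complex" and D r t
  proof -
    have "((\<lambda>t. t * r) has_vector_derivative r) (at t)" by (auto intro!: derivative_eq_intros)
    from vector_diff_chain_at[OF this that] show ?thesis by (simp add: o_def)
  qed
  have f': "(f has_vector_derivative f' t) (at t)" if t: "t > 0" for t
  proof -
    have tx: "t * x > 0" and ty: "t * y > 0" using t x y by auto
    have T: "complex_of_real t \<noteq> 0" "complex_of_real x \<noteq> 0" "complex_of_real y \<noteq> 0" using t x y by auto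
    have i: "(complex_of_real has_vector_derivative of_real 1) (at t)"
      by (rule has_vector_derivative_of_real) (auto intro!: derivative_eq_intros)
    define dv where "dv r = (of_real (t * r / 2 - c) * v (t * r) - u (t * r)) / of_real t" for r
    define du where "du r = (of_real (c + 1 - t * r / 2) * u (t * r) + of_real \<tau> * v (t * r)) / of_real t" for r
    have dv: "((\<lambda>t. v (t * r)) has_vector_derivative dv r) (at t)" if r: "r > 0" for r
    proof -
      have "t * r > 0" using t r by simp
      then have "(v has_vector_derivative (of_real (t * r / 2 - c) * v (t * r) - u (t * r)) / of_real (t * r)) (at (t * r))"
        using sys unfolding whittaker_system_def by blast
      from scale[OF this] show ?thesis
        by (rule has_vector_derivative_eq_rhs) (use t r in \<open>simp add: dv_def scaleR_conv_of_real\<close>)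
    qed
    have du: "((\<lambda>t. u (t * r)) has_vector_derivative du r) (at t)" if r: "r > 0" for r
    proof -
      have "t * r > 0" using t r by simp
      then have "(u has_vector_derivative (of_real (c + 1 - t * r / 2) * u (t * r) + of_real \<tau> * v (t * r)) / of_real (t * r)) (at (t * r))"
        using sys unfolding whittaker_system_def by blast
      from scale[OF this] show ?thesis
        by (rule has_vector_derivative_eq_rhs) (use t r in \<open>simp add: du_def scaleR_conv_of_real\<close>)
    qed
    have "(f has_vector_derivative (((u (t * x) * dv y + du x * v (t * y)) - (v (t * x) * du y + dv x * u (t * y))) * of_real t
        - N t * of_real 1) / (of_real t * of_real t)) (at t)"
      unfolding f_def N_def
      by (intro has_vector_derivative_quotient has_vector_derivative_diff has_vector_derivative_mult i T du dv x y)
    also have "((u (t * x) * dv y + du x * v (t * y)) - (v (t * x) * du y + dv x * u (t * y))) * of_real t - N t * of_real 1 =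
       u (t * x) * (of_real t * dv y) + (of_real t * du x) * v (t * y) - (v (t * x) * (of_real t * du y) + (of_real t * dv x) * u (t * y)) - N t"
      by (simp add: algebra_simps)
    also have "\<dots> = of_real (t * (y - x) / 2) * (u (t * x) * v (t * y) + v (t * x) * u (t * y))"
      unfolding dv_def du_def N_def using T by (simp add: field_simps)
    also have "\<dots> / (of_real t * of_real t) = f' t"
      unfolding f'_def using t by (simp add: field_simps)
    finally show ?thesis .
  qed
  have g': "(g has_vector_derivative g' t) (at t)" if t: "t > 0" for t
  proof -
    have "((\<lambda>t. t powr (- 1/2)) has_real_derivative (- 1/2) * t powr (- 1/2 - 1)) (at t)"
      using t by (auto intro!: derivative_eq_intros)
    moreover have "(- 1/2 - 1 :: real) = - 3/2" by simp
    ultimately have p: "((\<lambda>t. t powr (- 1/2)) has_real_derivative (- 1/2) * t powr (- 3/2)) (at t)" by metis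
    have e: "((\<lambda>t. exp (- t * (x + y) / 4)) has_real_derivative exp (- t * (x + y) / 4) * (- (x + y) / 4)) (at t)"
      by (auto intro!: derivative_eq_intros simp: field_simps)
    have "(g has_real_derivative - ((K * ((- 1/2) * t powr (- 3/2))) * exp (- t * (x + y) / 4) +
        exp (- t * (x + y) / 4) * (- (x + y) / 4) * (K * t powr (- 1/2)))) (at t)"
      unfolding g_def by (intro DERIV_minus DERIV_mult DERIV_cmult p e)
    also have "- ((K * ((- 1/2) * t powr (- 3/2))) * exp (- t * (x + y) / 4) +
        exp (- t * (x + y) / 4) * (- (x + y) / 4) * (K * t powr (- 1/2))) = g' t"
      unfolding g'_def by (simp add: field_simps)
    finally show ?thesis by (simp add: has_real_derivative_iff_has_vector_derivative)
  qed
  have le: "cmod (f' t) \<le> g' t" if t: "t > 0" for t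
  proof -
    have tx: "t * x > 0" and ty: "t * y > 0" using t x y by auto
    define a b c' d where "a = cmod (u (t * x))" "b = cmod (v (t * x))" "c' = cmod (v (t * y))" "d = cmod (u (t * y))"
    \<comment> \<open>Cauchy-Schwarz in the plane, and then the decay of \<open>|u|\<^sup>2 + |v|\<^sup>2\<close>.\<close>
    have "cmod (u (t * x) * v (t * y) + v (t * x) * u (t * y)) \<le> a * c' + b * d"
      unfolding a_b_c'_d_def by (metis norm_mult norm_triangle_ineq)
    also have "\<dots> \<le> sqrt ((a\<^sup>2 + b\<^sup>2) * (c'\<^sup>2 + d\<^sup>2))"
    proof (rule real_le_rsqrt)
      have "(a * c' + b * d)\<^sup>2 + (a * d - b * c')\<^sup>2 = (a\<^sup>2 + b\<^sup>2) * (c'\<^sup>2 + d\<^sup>2)" by (simp add: power2_eq_square algebra_simps)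
      then show "(a * c' + b * d)\<^sup>2 \<le> (a\<^sup>2 + b\<^sup>2) * (c'\<^sup>2 + d\<^sup>2)"
        by (smt (verit) zero_le_power2)
    qed
    also have "\<dots> \<le> sqrt ((C * exp (- (t * x) / 2)) * (C * exp (- (t * y) / 2)))"
      using C(2)[OF tx] C(2)[OF ty] C(1) unfolding a_b_c'_d_def
      by (intro real_sqrt_le_mono mult_mono) (auto simp: add.commute)
    also have "(C * exp (- (t * x) / 2)) * (C * exp (- (t * y) / 2)) = (C * exp (- t * (x + y) / 4))\<^sup>2"
      by (simp add: power_mult_distrib power2_eq_square exp_add[symmetric] field_simps)
    also have "sqrt ((C * exp (- t * (x + y) / 4))\<^sup>2) = C * exp (- t * (x + y) / 4)" using C(1) by simp
    finally have 1: "cmod (u (t * x) * v (t * y) + v (t * x) * u (t * y)) \<le> C * exp (- t * (x + y) / 4)" .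
    have "cmod (f' t) = \<bar>x - y\<bar> / (2 * t) * cmod (u (t * x) * v (t * y) + v (t * x) * u (t * y))"
      unfolding f'_def norm_mult norm_of_real using t by (simp add: abs_minus_commute)
    also have "\<dots> \<le> \<bar>x - y\<bar> / (2 * t) * (C * exp (- t * (x + y) / 4))"
      using t by (intro mult_left_mono 1) auto
    also have "\<dots> = \<bar>x - y\<bar> * (C / 2) * exp (- t * (x + y) / 4) * (1 / t)" using t by simp
    also have "\<dots> \<le> \<bar>x - y\<bar> * (C / 2) * exp (- t * (x + y) / 4) *
        ((x * y) powr (- 1/4) * (t powr (- 3/2) / 2 + t powr (- 1/2) * ((x + y) / 4)))"
    proof (intro mult_left_mono)
      define s where "s = t powr (1/2)"
      have s: "s > 0" "s\<^sup>2 = t" using t by (auto simp: s_def powr_half_sqrt)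
      have p1: "t powr (- 1/2) = 1 / s" using t by (simp add: s_def powr_minus_divide)
      have p3: "t powr (- 3/2) = 1 / (t * s)"
      proof -
        have "t powr (- 3/2) = t powr (- 1 + - 1/2)" by simp
        also have "\<dots> = t powr (- 1) * t powr (- 1/2)" by (rule powr_add)
        finally show ?thesis using t p1 by (simp add: powr_minus_divide)
      qed
      define q where "q = (x * y) powr (1/4)"
      have q: "q > 0" using x y by (simp add: q_def)
      have "q\<^sup>2 = (x * y) powr (1/2)" by (simp add: q_def power2_eq_square powr_add[symmetric])
      also have "\<dots> = sqrt (x * y)" using x y by (simp add: powr_half_sqrt)
      also have "\<dots> \<le> (x + y) / 2" using x y by (intro arith_geo_mean_sqrt) auto
      finally have q2: "q\<^sup>2 \<le> (x + y) / 2" .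
      \<comment> \<open>The power \<open>t powr (- 1/2)\<close> in \<open>g\<close> is chosen so that the two terms of \<open>g'\<close>, combined by the inequality of arithmetic and geometric means, dominate \<open>1 / t\<close>.\<close>
      have "2 * q * s \<le> 1 + q\<^sup>2 * s\<^sup>2" using sum_squares_bound[of 1 "q * s"] by (simp add: power_mult_distrib)
      also have "\<dots> \<le> 1 + (x + y) / 2 * s\<^sup>2" by (intro add_left_mono mult_right_mono q2) auto
      finally have "2 * q * s \<le> 1 + (x + y) / 2 * t" by (simp add: s(2))
      then have "1 \<le> (1 + (x + y) / 2 * t) / (2 * q * s)" using q s by (simp add: le_divide_eq)
      then have "1 / t \<le> (1 + (x + y) / 2 * t) / (2 * q * s) / t" using t by (intro divide_right_mono) auto
      also have "\<dots> = 1 / q * (1 / (t * s) / 2 + 1 / s * ((x + y) / 4))"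
        using t s(1) q by (simp add: field_simps)
      also have "1 / q = (x * y) powr (- 1/4)" by (simp add: q_def powr_minus_divide)
      finally show "1 / t \<le> (x * y) powr (- 1/4) * (t powr (- 3/2) / 2 + t powr (- 1/2) * ((x + y) / 4))"
        unfolding p1 p3 .
    qed (use C in auto)
    also have "\<dots> = g' t" unfolding g'_def K_def by (simp add: mult_ac)
    finally show ?thesis .
  qed
  have bound: "cmod (f T - f 1) \<le> - g 1" if T: "T > 1" for T
  proof -
    have "norm (f T - f 1) \<le> g T - g 1"
    proof (rule differentiable_bound_general[OF T])
      show "continuous_on {1..T} f"
        by (intro continuous_at_imp_continuous_on ballI has_vector_derivative_continuous[OF f']) simp
      show "continuous_on {1..T} g"
        by (intro continuous_at_imp_continuous_on ballI has_vector_derivative_continuous[OF g']) simp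
      fix t assume t: "1 < t" "t < T"
      show "(f has_vector_derivative f' t) (at t)" "(g has_vector_derivative g' t) (at t)" "norm (f' t) \<le> g' t"
        using f'[of t] g'[of t] le[of t] t by auto
    qed
    also have "\<dots> \<le> - g 1" using K by (simp add: g_def)
    finally show ?thesis .
  qed
  have "(f \<longlongrightarrow> 0) at_top"
  proof (rule tendsto_norm_zero_cancel, rule tendsto_sandwich[OF _ _ tendsto_const])
    show "((\<lambda>t. 2 * C / t) \<longlongrightarrow> 0) at_top" by real_asymp
    show "\<forall>\<^sub>F t in at_top. norm (f t) \<le> 2 * C / t"
      using eventually_gt_at_top[of 0]
    proof eventually_elim
      case (elim t)
      have sq: "cmod (w r) \<le> sqrt C" if "(cmod (w r))\<^sup>2 \<le> C * exp (- r / 2)" "r > 0" for w :: "real \<Rightarrow> complex" and r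
      proof (rule real_le_rsqrt)
        have "C * exp (- r / 2) \<le> C * 1" using C that by (intro mult_left_mono) auto
        then show "(cmod (w r))\<^sup>2 \<le> C" using that by simp
      qed
      have b: "cmod (u r) \<le> sqrt C \<and> cmod (v r) \<le> sqrt C" if "r > 0" for r
        using sq[of u r] sq[of v r] C(2)[OF that] that by (smt (verit) zero_le_power2)
      have "cmod (N t) \<le> cmod (u (t * x)) * cmod (v (t * y)) + cmod (v (t * x)) * cmod (u (t * y))"
        unfolding N_def by (metis norm_mult norm_triangle_ineq4)
      also have "\<dots> \<le> sqrt C * sqrt C + sqrt C * sqrt C"
        using b[of "t * x"] b[of "t * y"] x y elim C by (intro add_mono mult_mono) auto
      also have "\<dots> = 2 * C" using C by simp
      finally show ?case using elim by (simp add: f_def norm_divide divide_right_mono)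
    qed
  qed auto
  then have "((\<lambda>T. cmod (f T - f 1)) \<longlongrightarrow> cmod (0 - f 1)) at_top" by (intro tendsto_intros)
  then have "cmod (0 - f 1) \<le> - g 1"
    by (rule tendsto_upperbound) (auto intro: eventually_mono[OF eventually_gt_at_top[of 1] bound])
  then show ?thesis by (simp add: f_def N_def g_def K_def norm_minus_commute)
qed

text \<open>In the conjugate case \<open>b\<close> is purely imaginary; in the real case \<open>z\<close> and \<open>z'\<close> lie in a common
  interval of length 1, so that \<open>b\<close> is real and less than 1/2 in absolute value.\<close>

lemma admissible_parameters:
  assumes adm: "admissible z z'" and small: "cmod (z + z') < 1"
  obtains \<sigma> \<beta> where "z + z' = of_real \<sigma>" "\<bar>\<sigma>\<bar> < 1" "((z - z') / 2)\<^sup>2 = of_real \<beta>" "\<beta> < 1/4"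
    "\<bar>Re ((z - z') / 2)\<bar> < 1/2"
proof -
  from adm consider (conj) "z' = cnj z" "z \<notin> \<int>" | (real) "z \<in> \<real>" "z' \<in> \<real>" "\<bar>Re z - Re z'\<bar> < 1"
    unfolding admissible_def by fastforce
  then show thesis
  proof cases
    case conj
    have *: "z + z' = of_real (2 * Re z)" "(z - z') / 2 = \<i> * of_real (Im z)"
      by (simp_all add: conj complex_eq_iff)
    have "((z - z') / 2)\<^sup>2 = of_real (- (Im z)\<^sup>2)" unfolding *(2) by (simp add: power_mult_distrib)
    moreover have "\<bar>2 * Re z\<bar> < 1" using small unfolding *(1) norm_of_real .
    moreover have "- (Im z)\<^sup>2 < 1/4" using zero_le_power2[of "Im z"] by linarith
    ultimately show ?thesis using that[of "2 * Re z" "- (Im z)\<^sup>2"] *(1) *(2) by simp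
  next
    case real
    define d where "d = (Re z - Re z') / 2"
    have *: "z + z' = of_real (Re z + Re z')" "(z - z') / 2 = of_real d"
      using real by (simp_all add: d_def complex_eq_iff complex_is_Real_iff)
    have d: "\<bar>d\<bar> < 1/2" using real by (simp add: d_def)
    then have "\<bar>d\<bar>\<^sup>2 < (1/2)\<^sup>2" by (intro power_strict_mono) auto
    then have "d\<^sup>2 < 1/4" by (simp add: power2_eq_square)
    moreover have "\<bar>Re z + Re z'\<bar> < 1" using small unfolding *(1) norm_of_real .
    ultimately show ?thesis using that[of "Re z + Re z'" "d\<^sup>2"] * d by simp
  qed
qed

text \<open>The kernel on one half-line: the negative half-line is reflected onto the positive one, which
  changes only the sign \<open>s\<close> of the parameters.\<close>

definition whittaker_half_kernel :: "complex \<Rightarrow> complex \<Rightarrow> complex \<Rightarrow> real \<Rightarrow> real \<Rightarrow> complex" where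
  "whittaker_half_kernel s z z' x y =
    (whittaker_P s z z' x * whittaker_Q s z z' y - whittaker_Q s z z' x * whittaker_P s z z' y) / of_real (x - y)"

lemma powr_half_times_pos:
  fixes w :: complex
  assumes "x > 0"
  shows "(w * of_real x) powr (1/2) = w powr (1/2) * of_real (sqrt x)"
proof -
  have "(of_real x * w) powr (1/2) = of_real x powr (1/2) * w powr (1/2)"
    using assms by (intro powr_times_real_left) auto
  moreover have "complex_of_real x powr (1/2) = of_real (sqrt x)"
    using assms powr_of_real[of x "1/2"] by (simp add: powr_half_sqrt)
  ultimately show ?thesis by (simp add: mult.commute)
qed

text \<open>The bound \<open>|z + z'| < 1\<close> ensures that \<open>b - c + 1/2\<close> has positive real part for both signs, so
  that the integral representation is available.  Up to constant factors the numerator of the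
  kernel is the expression estimated above, divided by \<open>sqrt (x y)\<close>.\<close>

lemma whittaker_half_kernel_bound:
  assumes adm: "admissible z z'" and small: "cmod (z + z') < 1" and s: "s \<in> {1, - 1}"
  obtains C where "C > 0"
    "\<And>x y. x > 0 \<Longrightarrow> y > 0 \<Longrightarrow> x \<noteq> y \<Longrightarrow> cmod (whittaker_half_kernel s z z' x y) \<le>
       C * (x powr (- 3/4) * exp (- x / 4)) * (y powr (- 3/4) * exp (- y / 4))"
    "\<And>x. x > 0 \<Longrightarrow> \<exists>L. (whittaker_half_kernel s z z' x \<longlongrightarrow> L) (at x)"
proof -
  obtain \<sigma> \<beta> where \<sigma>: "z + z' = of_real \<sigma>" "\<bar>\<sigma>\<bar> < 1" and \<beta>: "((z - z') / 2)\<^sup>2 = of_real \<beta>" "\<beta> < 1/4"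
    and b: "\<bar>Re ((z - z') / 2)\<bar> < 1/2"
    by (rule admissible_parameters[OF adm small])
  define b where "b = (z - z') / 2"
  obtain r where r: "s = of_real r" "r \<in> {1, - 1}" using s by (auto intro: that[of 1] that[of "- 1"])
  define c where "c = (r * \<sigma> - 1) / 2"
  have "\<bar>r * \<sigma>\<bar> < 1" using r(2) \<sigma>(2) by auto
  then have \<alpha>: "Re (b - of_real c + 1/2) > 0" using b unfolding b_def[symmetric] c_def by (simp add: abs_if field_simps split: if_splits)
  obtain u v where sys: "whittaker_system c ((c + 1/2)\<^sup>2 - \<beta>) u v"
    and limv: "((\<lambda>x. v x / of_real (exp (- x / 2) * x powr c)) \<longlongrightarrow> 1) at_top"
    and limu: "((\<lambda>x. u x / of_real (exp (- x / 2) * x powr (c + 1))) \<longlongrightarrow> 1) at_top"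
    by (rule whittaker_pair_exists[OF \<beta>(1)[folded b_def] \<alpha>])
  obtain C where C: "C > 0" "\<And>x. x > 0 \<Longrightarrow> (cmod (u x))\<^sup>2 + (cmod (v x))\<^sup>2 \<le> C * exp (- x / 2)"
    using whittaker_pair_decay[OF sys refl \<beta>(2) limv limu] by blast
  have Wv: "whittaker_W (of_real c) b x = v x" if "x > 0" for x
    using whittaker_system_ode(1)[OF sys refl] limv that
    by (intro whittaker_W_eqI[OF \<beta>(1)[folded b_def]]) (auto simp: is_whittaker_W_real_iff[OF \<beta>(1)[folded b_def]])
  have Wu: "whittaker_W (of_real (c + 1)) b x = u x" if "x > 0" for x
  proof (rule whittaker_W_eqI[OF \<beta>(1)[folded b_def] _ that])
    show "is_whittaker_W (of_real (c + 1)) b u"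
      unfolding is_whittaker_W_real_iff[OF \<beta>(1)[folded b_def]]
      using whittaker_system_ode(2)[OF sys refl] limu by blast
  qed
  have ac: "(s * (z + z') - 1) / 2 = of_real c" "(s * (z + z') + 1) / 2 = of_real (c + 1)"
    by (simp_all add: r(1) \<sigma>(1) c_def field_simps)
  define G where "G = (Gamma (1 + s * z) * Gamma (1 + s * z')) powr (1/2)"
  define p q where "p = (z * z') powr (1/4) / G" "q = (z * z') powr (3/4) / G"
  have P: "whittaker_P s z z' x = p / of_real (sqrt x) * u x" if "x > 0" for x
    using Wu[OF that] unfolding whittaker_P_def ac powr_half_times_pos[OF that] p_q_def G_def b_def by simp
  have Q: "whittaker_Q s z z' x = q / of_real (sqrt x) * v x" if "x > 0" for x
    using Wv[OF that] unfolding whittaker_Q_def ac powr_half_times_pos[OF that] p_q_def G_def b_def by simp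
  have eq: "whittaker_half_kernel s z z' x y =
     p * q * ((u x * v y - v x * u y) / (of_real (sqrt x) * of_real (sqrt y) * of_real (x - y)))" if "x > 0" "y > 0" for x y
    unfolding whittaker_half_kernel_def P[OF that(1)] P[OF that(2)] Q[OF that(1)] Q[OF that(2)]
    using that by (simp add: field_simps del: of_real_diff)
  define D where "D = cmod (p * q) * (C / 2) + 1"
  have "D > 0" using C(1) by (simp add: D_def add_nonneg_pos)
  moreover have "cmod (whittaker_half_kernel s z z' x y) \<le>
       D * (x powr (- 3/4) * exp (- x / 4)) * (y powr (- 3/4) * exp (- y / 4))"
    if x: "x > 0" and y: "y > 0" and xy: "x \<noteq> y" for x y
  proof -
    have pw: "t powr (- 1/4) / sqrt t = t powr (- 3/4)" if "t > 0" for t :: real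
    proof -
      have "t powr (- 3/4) = t powr (- 1/4 - 1/2)" by simp
      also have "\<dots> = t powr (- 1/4) / t powr (1/2)" by (rule powr_diff)
      finally show ?thesis using that by (simp add: powr_half_sqrt)
    qed
    have "cmod (whittaker_half_kernel s z z' x y) =
        cmod (p * q) * (cmod (u x * v y - v x * u y) / (sqrt x * sqrt y * \<bar>x - y\<bar>))"
      unfolding eq[OF x y] norm_mult norm_divide norm_of_real using x y by simp
    also have "\<dots> \<le> cmod (p * q) * ((\<bar>x - y\<bar> * (C / 2) * (x * y) powr (- 1/4) * exp (- (x + y) / 4)) / (sqrt x * sqrt y * \<bar>x - y\<bar>))"
      using x y by (intro mult_left_mono divide_right_mono whittaker_wronskian_bound[OF sys C x y]) auto
    also have "\<dots> = cmod (p * q) * (C / 2) * ((x powr (- 1/4) / sqrt x) * (y powr (- 1/4) / sqrt y) * exp (- (x + y) / 4))"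
      using x y xy by (simp add: powr_mult field_simps)
    also have "\<dots> = cmod (p * q) * (C / 2) * (x powr (- 3/4) * y powr (- 3/4) * exp (- (x + y) / 4))"
      unfolding pw[OF x] pw[OF y] ..
    also have "\<dots> \<le> D * (x powr (- 3/4) * y powr (- 3/4) * exp (- (x + y) / 4))"
      by (intro mult_right_mono) (auto simp: D_def)
    also have "exp (- (x + y) / 4) = exp (- x / 4) * exp (- y / 4)"
      by (simp add: exp_add[symmetric] field_simps)
    finally show ?thesis by (simp add: mult_ac)
  qed
  moreover have "\<exists>L. (whittaker_half_kernel s z z' x \<longlongrightarrow> L) (at x)" if x: "x > 0" for x
  proof -
    define N where "N y = u x * v y - v x * u y" for y
    obtain du dv where "(u has_vector_derivative du) (at x)" "(v has_vector_derivative dv) (at x)"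
      using sys x unfolding whittaker_system_def by blast
    then have "(N has_vector_derivative (u x * dv - v x * du)) (at x)"
      unfolding N_def by (intro has_vector_derivative_diff has_vector_derivative_mult_right)
    then have lim: "((\<lambda>y. (N y - N x) / of_real (y - x)) \<longlongrightarrow> u x * dv - v x * du) (at x)"
      by (simp add: has_vector_derivative_iff_quotient_tendsto)
    have Nx: "N x = 0" by (simp add: N_def)
    have L: "((\<lambda>y. p * q * (- ((N y - N x) / of_real (y - x)) / (of_real (sqrt x) * of_real (sqrt y)))) \<longlongrightarrow>
        p * q * (- (u x * dv - v x * du) / (of_real (sqrt x) * of_real (sqrt x)))) (at x)"
      using x by (intro tendsto_mult tendsto_divide tendsto_minus tendsto_of_real tendsto_real_sqrt tendsto_const tendsto_ident_at lim) auto
    have E: "\<forall>\<^sub>F y in at x. p * q * (- ((N y - N x) / of_real (y - x)) / (of_real (sqrt x) * of_real (sqrt y))) =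
        whittaker_half_kernel s z z' x y"
    proof -
      have "\<forall>\<^sub>F y in at x. y \<in> {0<..}" using x by (intro eventually_at_in_open') auto
      moreover have "\<forall>\<^sub>F y in at x. y \<noteq> x" by (rule eventually_neq_at_within)
      ultimately show ?thesis
      proof eventually_elim
        case (elim y)
        have y: "y > 0" using elim by simp
        have flip: "complex_of_real (x - y) = - of_real (y - x)" by simp
        have frac: "- (A / d) / e = A / (e * (- d))" for A d e :: complex
          by (cases "d = 0"; cases "e = 0"; simp add: field_simps)
        show ?case unfolding eq[OF x y] flip Nx frac by (simp add: N_def)
      qed
    qed
    show ?thesis using tendsto_cong[THEN iffD1, OF E L] by blast
  qed
  ultimately show thesis using that by blast
qed

text \<open>Off the diagonal this is the bound for the half-line kernels; on the diagonal the kernel is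
  defined as a limit, and the bound passes to it by continuity of the right side.\<close>

lemma whittaker_kernel_bound:
  assumes adm: "admissible z z'" and small: "cmod (z + z') < 1"
  obtains C where "C > 0"
    "\<And>x y. x * y > 0 \<Longrightarrow> cmod (whittaker_kernel z z' x y) \<le>
       C * (\<bar>x\<bar> powr (- 3/4) * exp (- \<bar>x\<bar> / 4)) * (\<bar>y\<bar> powr (- 3/4) * exp (- \<bar>y\<bar> / 4))"
proof -
  define \<phi> where "\<phi> x = \<bar>x\<bar> powr (- 3/4) * exp (- \<bar>x\<bar> / 4)" for x :: real
  have off: "whittaker_kernel_offdiag z z' (r * x) (r * y) = whittaker_half_kernel (of_real r) z z' x y"
    if "x > 0" "y > 0" "r \<in> {1, - 1}" for x y r
    using that by (auto simp: whittaker_kernel_offdiag_def whittaker_half_kernel_def Let_def)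
  have half: "\<exists>C>0. \<forall>x>0. \<forall>y>0. cmod (whittaker_kernel z z' (r * x) (r * y)) \<le> C * \<phi> x * \<phi> y"
    if r: "r \<in> {1, - 1}" for r
  proof -
    have "complex_of_real r \<in> {1, - 1}" using r by auto
    note half_bound = whittaker_half_kernel_bound[OF adm small this]
    obtain C where C: "C > 0" and le: "\<And>x y. x > 0 \<Longrightarrow> y > 0 \<Longrightarrow> x \<noteq> y \<Longrightarrow>
        cmod (whittaker_half_kernel (of_real r) z z' x y) \<le> C * (x powr (- 3/4) * exp (- x / 4)) * (y powr (- 3/4) * exp (- y / 4))"
      and lim: "\<And>x. x > 0 \<Longrightarrow> \<exists>L. (whittaker_half_kernel (of_real r) z z' x \<longlongrightarrow> L) (at x)"
      using half_bound by blast
    have le': "cmod (whittaker_half_kernel (of_real r) z z' x y) \<le> C * \<phi> x * \<phi> y" if "x > 0" "y > 0" "x \<noteq> y" for x y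
      using le[OF that] that by (simp add: \<phi>_def)
    have "cmod (whittaker_kernel z z' (r * x) (r * y)) \<le> C * \<phi> x * \<phi> y" if x: "x > 0" and y: "y > 0" for x y
    proof (cases "x = y")
      case False
      then show ?thesis using le'[OF x y False] off[OF x y r] r by (auto simp: whittaker_kernel_def)
    next
      case True
      obtain L where L: "(whittaker_half_kernel (of_real r) z z' x \<longlongrightarrow> L) (at x)" using lim[OF x] by blast
      have pos: "\<forall>\<^sub>F y in at x. y \<in> {0<..}" using x by (intro eventually_at_in_open') auto
      have "((\<lambda>y. whittaker_kernel_offdiag z z' (r * x) (r * y)) \<longlongrightarrow> L) (at x)"
        using L by (rule tendsto_cong[THEN iffD1, rotated]) (use pos in eventually_elim, simp add: off[OF x _ r])
      then have "((\<lambda>y. whittaker_kernel_offdiag z z' (r * x) (r * (r * y))) \<longlongrightarrow> L) (at (r * x))"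
      proof (rule filterlim_compose)
        have "((\<lambda>y. r * y) \<longlongrightarrow> r * (r * x)) (at (r * x))" by (intro tendsto_intros)
        moreover have "\<forall>\<^sub>F y in at (r * x). r * y \<noteq> x"
          using eventually_neq_at_within[of "r * x"] by eventually_elim (use r in auto)
        moreover have "r * (r * x) = x" using r by auto
        ultimately show "filterlim (\<lambda>y. r * y) (at x) (at (r * x))" by (simp add: filterlim_at)
      qed
      moreover have "r * (r * y) = y" for y using r by auto
      ultimately have "(whittaker_kernel_offdiag z z' (r * x) \<longlongrightarrow> L) (at (r * x))" by simp
      then have "whittaker_kernel z z' (r * x) (r * y) = L"
        using True by (simp add: whittaker_kernel_def tendsto_Lim)
      moreover have "cmod L \<le> C * \<phi> x * \<phi> x"
      proof (rule tendsto_le[OF trivial_limit_at _ tendsto_norm[OF L]])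
        show "((\<lambda>y. C * \<phi> x * \<phi> y) \<longlongrightarrow> C * \<phi> x * \<phi> x) (at x)"
          unfolding \<phi>_def using x by (intro tendsto_intros) auto
        show "\<forall>\<^sub>F y in at x. cmod (whittaker_half_kernel (of_real r) z z' x y) \<le> C * \<phi> x * \<phi> y"
          using pos eventually_neq_at_within[of x] by eventually_elim (use le'[OF x] in auto)
      qed
      ultimately show ?thesis using True by simp
    qed
    then show ?thesis using C by blast
  qed
  obtain C1 where C1: "C1 > 0" "\<And>x y. x > 0 \<Longrightarrow> y > 0 \<Longrightarrow> cmod (whittaker_kernel z z' (1 * x) (1 * y)) \<le> C1 * \<phi> x * \<phi> y"
    using half[of 1] by auto
  obtain C2 where C2: "C2 > 0" "\<And>x y. x > 0 \<Longrightarrow> y > 0 \<Longrightarrow> cmod (whittaker_kernel z z' (- 1 * x) (- 1 * y)) \<le> C2 * \<phi> x * \<phi> y"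
    using half[of "- 1"] by auto
  have "cmod (whittaker_kernel z z' x y) \<le> max C1 C2 * \<phi> x * \<phi> y" if xy: "x * y > 0" for x y
  proof -
    have nn: "\<phi> x * \<phi> y \<ge> 0" by (simp add: \<phi>_def)
    consider "x > 0" "y > 0" | "x < 0" "y < 0" using xy by (auto simp: zero_less_mult_iff)
    then show ?thesis
    proof cases
      case 1
      have "C1 * (\<phi> x * \<phi> y) \<le> max C1 C2 * (\<phi> x * \<phi> y)" by (intro mult_right_mono nn) auto
      then show ?thesis using C1(2)[OF 1] by (simp add: mult.assoc)
    next
      case 2
      have "\<phi> (- x) = \<phi> x" "\<phi> (- y) = \<phi> y" by (simp_all add: \<phi>_def)
      moreover have "C2 * (\<phi> x * \<phi> y) \<le> max C1 C2 * (\<phi> x * \<phi> y)" by (intro mult_right_mono nn) auto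
      ultimately show ?thesis using C2(2)[of "- x" "- y"] 2 by (simp add: mult.assoc)
    qed
  qed
  moreover have "max C1 C2 > 0" using C1 by simp
  ultimately show thesis using that unfolding \<phi>_def by blast
qed

section \<open>Hadamard's inequality\<close>

text \<open>If $A A^* v = e v$, then $e |v|^2 = |A^* v|^2$, which exhibits \<open>e\<close> as a quotient of two
  nonnegative reals.  The vector \<open>A\<^sup>* v\<close> is written out below as \<open>w\<close>.\<close>

lemma eigenvalue_mult_adjoint_nonneg:
  fixes A :: "complex mat"
  assumes A: "A \<in> carrier_mat n n"
    and e: "eigenvalue (A * mat n n (\<lambda>(i, j). cnj (A $$ (j, i)))) e"
  shows "e \<in> \<real>" "Re e \<ge> 0"
proof -
  let ?B = "A * mat n n (\<lambda>(i, j). cnj (A $$ (j, i)))"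
  obtain v where v: "v \<in> carrier_vec n" "v \<noteq> 0\<^sub>v n" "?B *\<^sub>v v = e \<cdot>\<^sub>v v"
    using e A unfolding eigenvalue_def eigenvector_def by auto
  define w where "w j = (\<Sum>i<n. cnj (A $$ (i, j)) * v $ i)" for j
  have Bv: "(\<Sum>j<n. A $$ (i, j) * w j) = e * v $ i" if i: "i < n" for i
  proof -
    have "e * v $ i = (?B *\<^sub>v v) $ i" unfolding v(3) using v(1) i by simp
    also have "\<dots> = (\<Sum>k<n. (\<Sum>j<n. A $$ (i, j) * cnj (A $$ (k, j))) * v $ k)"
      using A i v(1) by (auto simp: scalar_prod_def atLeast0LessThan intro!: sum.cong)
    also have "\<dots> = (\<Sum>k<n. \<Sum>j<n. A $$ (i, j) * cnj (A $$ (k, j)) * v $ k)"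
      by (simp add: sum_distrib_right)
    also have "\<dots> = (\<Sum>j<n. \<Sum>k<n. A $$ (i, j) * cnj (A $$ (k, j)) * v $ k)"
      by (rule sum.swap)
    also have "\<dots> = (\<Sum>j<n. A $$ (i, j) * w j)"
      by (simp add: w_def sum_distrib_left mult.assoc)
    finally show ?thesis by simp
  qed
  have "e * (\<Sum>i<n. (cmod (v $ i))\<^sup>2) = (\<Sum>i<n. cnj (v $ i) * (e * v $ i))"
    by (simp add: sum_distrib_left complex_norm_square mult_ac del: of_real_power)
  also have "\<dots> = (\<Sum>i<n. \<Sum>j<n. cnj (v $ i) * (A $$ (i, j) * w j))"
    by (simp add: Bv[symmetric] sum_distrib_left)
  also have "\<dots> = (\<Sum>j<n. \<Sum>i<n. cnj (v $ i) * (A $$ (i, j) * w j))" by (rule sum.swap)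
  also have "\<dots> = (\<Sum>j<n. (cnj (w j)) * w j)"
    by (simp add: w_def sum_distrib_left sum_distrib_right mult_ac)
  also have "\<dots> = of_real (\<Sum>j<n. (cmod (w j))\<^sup>2)"
    by (simp add: complex_norm_square mult.commute del: of_real_power)
  finally have eq: "e * of_real (\<Sum>i<n. (cmod (v $ i))\<^sup>2) = of_real (\<Sum>j<n. (cmod (w j))\<^sup>2)" by simp
  have pos: "(\<Sum>i<n. (cmod (v $ i))\<^sup>2) > 0"
  proof -
    obtain i where "i < n" "v $ i \<noteq> 0"
      using v(1,2) by (metis carrier_vecD eq_vecI index_zero_vec(1) index_zero_vec(2))
    then show ?thesis by (intro sum_pos2[of _ i]) auto
  qed
  have "e = of_real ((\<Sum>j<n. (cmod (w j))\<^sup>2) / (\<Sum>i<n. (cmod (v $ i))\<^sup>2))"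
    unfolding of_real_divide eq[symmetric] using pos by (simp del: of_real_sum)
  then obtain r where r: "e = of_real r" "r \<ge> 0"
    using pos by (metis divide_nonneg_pos sum_nonneg zero_le_power2)
  show "e \<in> \<real>" "Re e \<ge> 0" using r by auto
qed

lemma trace_similar_mat_wit:
  fixes A :: "'a::comm_ring_1 mat"
  assumes A: "A \<in> carrier_mat n n" and sim: "similar_mat_wit A B P Q"
  shows "(\<Sum>i<n. A $$ (i, i)) = (\<Sum>i<n. B $$ (i, i))"
proof -
  note s = similar_mat_witD2[OF A sim]
  have "(\<Sum>i<n. A $$ (i, i)) = (\<Sum>i<n. \<Sum>j<n. P $$ (i, j) * (B * Q) $$ (j, i))"
    using s by (subst s(3), subst assoc_mult_mat[of _ n n _ n _ n])
      (auto simp: scalar_prod_def atLeast0LessThan intro!: sum.cong)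
  also have "\<dots> = (\<Sum>j<n. \<Sum>i<n. P $$ (i, j) * (B * Q) $$ (j, i))" by (rule sum.swap)
  also have "\<dots> = (\<Sum>j<n. ((B * Q) * P) $$ (j, j))"
    using s(4-7) by (auto simp del: assoc_mult_mat simp: scalar_prod_def atLeast0LessThan mult.commute intro!: sum.cong)
  also have "(B * Q) * P = B"
    using s by (simp add: assoc_mult_mat[of _ n n _ n _ n])
  finally show ?thesis .
qed

text \<open>A form of the inequality of arithmetic and geometric means that follows at once from
  \<open>x \<le> exp (x - 1)\<close>.\<close>

lemma prod_le_one_if_sum_le:
  fixes x :: "nat \<Rightarrow> real"
  assumes "\<And>i. i < n \<Longrightarrow> x i \<ge> 0" "(\<Sum>i<n. x i) \<le> real n"
  shows "(\<Prod>i<n. x i) \<le> 1"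
proof -
  have "(\<Prod>i<n. x i) \<le> (\<Prod>i<n. exp (x i - 1))"
  proof (rule prod_mono, intro conjI)
    fix i assume "i \<in> {..<n}"
    then show "0 \<le> x i" using assms by auto
    show "x i \<le> exp (x i - 1)" using exp_ge_add_one_self[of "x i - 1"] by simp
  qed
  also have "\<dots> = exp ((\<Sum>i<n. x i) - real n)" by (simp add: exp_sum[symmetric] sum_subtractf)
  also have "\<dots> \<le> 1" using assms by simp
  finally show ?thesis .
qed

text \<open>Hadamard's inequality for matrices with entries in the unit disc.  The number $|\det A|^2$ is
  the product of the eigenvalues of the positive semidefinite matrix $A A^*$.  Their sum, the
  trace of $A A^*$, is the sum of the squared absolute values of the entries, which is at most
  $n^2$; hence the product is at most $n^n$.  The gain over the trivial bound $n!$ is what makes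
  the series of factorial moments below converge without any smallness condition.\<close>

lemma hadamard_det_bound:
  fixes A :: "complex mat"
  assumes A: "A \<in> carrier_mat n n"
    and le: "\<And>i j. i < n \<Longrightarrow> j < n \<Longrightarrow> cmod (A $$ (i, j)) \<le> 1"
  shows "cmod (det A) \<le> sqrt (real n ^ n)"
proof (cases "n = 0")
  case True
  then show ?thesis using A by simp
next
  case False
  define H where "H = mat n n (\<lambda>(i, j). cnj (A $$ (j, i)))"
  define B where "B = A * H"
  have H: "H \<in> carrier_mat n n" by (simp add: H_def)
  have B: "B \<in> carrier_mat n n" using A H by (simp add: B_def)
  have "det H = cnj (det A)"
  proof -
    have "det H = det (transpose_mat H)" using det_transpose[OF H] by simp
    also have "transpose_mat H = mat n n (\<lambda>(i, j). cnj (A $$ (i, j)))"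
      by (rule eq_matI) (auto simp: H_def)
    also have "det \<dots> = cnj (det A)"
    proof -
      have "p i < n" if "p permutes {0..<n}" "i < n" for p i
        using permutes_in_image[OF that(1), of i] that(2) by simp
      then show ?thesis using A by (auto simp: det_def'[of _ n] intro!: sum.cong prod.cong)
    qed
    finally show ?thesis .
  qed
  then have detB: "det B = of_real ((cmod (det A))\<^sup>2)"
    using det_mult[OF A H] by (simp add: B_def complex_norm_square del: of_real_power)
  obtain es where es: "char_poly B = (\<Prod>a\<leftarrow>es. [:- a, 1:])"
    using char_poly_factorized[OF B] by blast
  obtain T P Q where TPQ: "schur_decomposition B es = (T, P, Q)"
    by (cases "schur_decomposition B es") auto
  note S = schur_decomposition[OF B es TPQ]
  have sim: "similar_mat_wit B T P Q" and ut: "upper_triangular T" and dg: "diag_mat T = es"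
    using S by auto
  have T: "T \<in> carrier_mat n n" using similar_mat_witD2[OF B sim] by auto
  have "similar_mat B T" using sim unfolding similar_mat_def by auto
  then have "det B = det T" by (rule det_similar)
  also have "\<dots> = (\<Prod>i<n. T $$ (i, i))"
    using det_upper_triangular[OF ut T] T by (simp add: prod_list_diag_prod atLeast0LessThan)
  finally have dB: "det B = (\<Prod>i<n. T $$ (i, i))" .
  have ev: "T $$ (i, i) \<in> \<real> \<and> Re (T $$ (i, i)) \<ge> 0" if "i < n" for i
  proof -
    have "T $$ (i, i) \<in> set es" using dg that T unfolding diag_mat_def by auto
    then have "poly (char_poly B) (T $$ (i, i)) = 0"
      unfolding es by (auto simp: poly_prod_list prod_list_zero_iff)
    then have "eigenvalue B (T $$ (i, i))" using eigenvalue_root_char_poly[OF B] by simp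
    then show ?thesis using eigenvalue_mult_adjoint_nonneg[OF A] unfolding B_def H_def by blast
  qed
  define x where "x i = Re (T $$ (i, i))" for i
  have Tx: "T $$ (i, i) = of_real (x i)" if "i < n" for i
    using ev[OF that] by (simp add: x_def complex_is_Real_iff complex_eq_iff)
  have x0: "x i \<ge> 0" if "i < n" for i using ev[OF that] by (simp add: x_def)
  have "of_real (\<Sum>i<n. x i) = (\<Sum>i<n. T $$ (i, i))" by (simp add: Tx)
  also have "\<dots> = (\<Sum>i<n. B $$ (i, i))" using trace_similar_mat_wit[OF B sim] by simp
  also have "\<dots> = (\<Sum>i<n. \<Sum>j<n. of_real ((cmod (A $$ (i, j)))\<^sup>2))"
    using A by (auto simp: B_def H_def scalar_prod_def atLeast0LessThan complex_norm_square simp del: of_real_power intro!: sum.cong)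
  also have "\<dots> = of_real (\<Sum>i<n. \<Sum>j<n. (cmod (A $$ (i, j)))\<^sup>2)" by simp
  finally have "(\<Sum>i<n. x i) = (\<Sum>i<n. \<Sum>j<n. (cmod (A $$ (i, j)))\<^sup>2)"
    by (simp only: of_real_eq_iff)
  also have "\<dots> \<le> (\<Sum>i<n. \<Sum>j<n. 1)"
    by (intro sum_mono) (auto intro!: power_le_one le)
  finally have sx: "(\<Sum>i<n. x i) \<le> real n * real n" by simp
  have "(\<Prod>i<n. x i / n) \<le> 1"
    using x0 sx False by (intro prod_le_one_if_sum_le) (auto simp: sum_divide_distrib[symmetric] field_simps)
  then have "(\<Prod>i<n. x i) \<le> real n ^ n" using False by (simp add: prod_dividef field_simps)
  moreover have "of_real ((cmod (det A))\<^sup>2) = complex_of_real (\<Prod>i<n. x i)"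
    using detB dB by (simp add: Tx)
  ultimately have "(cmod (det A))\<^sup>2 \<le> real n ^ n" by (simp only: of_real_eq_iff)
  then show ?thesis by (rule real_le_rsqrt)
qed

text \<open>In each term of the Leibniz expansion every row and every column occurs once.\<close>

lemma det_mat_scale:
  fixes B :: "nat \<Rightarrow> nat \<Rightarrow> 'a::comm_ring_1"
  shows "det (mat n n (\<lambda>(i, j). a i * B i j * b j)) =
    (\<Prod>i<n. a i) * (\<Prod>j<n. b j) * det (mat n n (\<lambda>(i, j). B i j))"
proof -
  have "(\<Prod>i = 0..<n. a i * B i (p i) * b (p i)) = (\<Prod>i<n. a i) * (\<Prod>j<n. b j) * (\<Prod>i = 0..<n. B i (p i))"
    if p: "p permutes {0..<n}" for p
  proof -
    have "(\<Prod>i = 0..<n. b (p i)) = (\<Prod>i = 0..<n. b i)"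
      using prod.permute[OF p, of b] by (simp add: o_def)
    then show ?thesis by (simp add: prod.distrib atLeast0LessThan mult_ac)
  qed
  moreover have "p i < n" if "p permutes {0..<n}" "i < n" for p i
    using permutes_in_image[OF that(1), of i] that(2) by simp
  ultimately show ?thesis
    by (auto simp: det_def'[of _ n] sum_distrib_left mult_ac intro!: sum.cong)
qed

lemma hadamard_det_bound_scaled:
  fixes A :: "nat \<Rightarrow> nat \<Rightarrow> complex" and a :: "nat \<Rightarrow> real"
  assumes le: "\<And>i j. i < n \<Longrightarrow> j < n \<Longrightarrow> cmod (A i j) \<le> a i * a j" and a: "\<And>i. a i \<ge> 0"
  shows "cmod (det (mat n n (\<lambda>(i, j). A i j))) \<le> sqrt (real n ^ n) * (\<Prod>i<n. (a i)\<^sup>2)"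
proof -
  define B where "B i j = A i j / (of_real (a i) * of_real (a j))" for i j
  have "A i j = of_real (a i) * B i j * of_real (a j)" if "i < n" "j < n" for i j
    using le[OF that] by (cases "a i = 0 \<or> a j = 0") (auto simp: B_def)
  then have "mat n n (\<lambda>(i, j). A i j) = mat n n (\<lambda>(i, j). of_real (a i) * B i j * of_real (a j))"
    by (intro eq_matI) auto
  then have "det (mat n n (\<lambda>(i, j). A i j)) =
      of_real (\<Prod>i<n. (a i)\<^sup>2) * det (mat n n (\<lambda>(i, j). B i j))"
    by (simp only: det_mat_scale) (simp add: power2_eq_square prod.distrib)
  then have "cmod (det (mat n n (\<lambda>(i, j). A i j))) =
      (\<Prod>i<n. (a i)\<^sup>2) * cmod (det (mat n n (\<lambda>(i, j). B i j)))"
    by (simp add: norm_mult abs_prod del: of_real_prod)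
  also have "\<dots> \<le> (\<Prod>i<n. (a i)\<^sup>2) * sqrt (real n ^ n)"
  proof (intro mult_left_mono hadamard_det_bound prod_nonneg)
    fix i j assume ij: "i < n" "j < n"
    have "cmod (B i j) \<le> 1"
      using le[OF ij] a[of i] a[of j] by (auto simp: B_def norm_divide norm_mult divide_le_eq_1 mult_less_0_iff less_le)
    then show "cmod (mat n n (\<lambda>(i, j). B i j) $$ (i, j)) \<le> 1" using ij by simp
  qed auto
  finally show ?thesis by (simp add: mult.commute)
qed

section \<open>Elementary symmetric functions\<close>

lemma add_power_ge_two_terms:
  fixes a b :: real
  assumes "a \<ge> 0" "b \<ge> 0"
  shows "a ^ Suc k + real (Suc k) * b * a ^ k \<le> (a + b) ^ Suc k"
proof (induction k)
  case (Suc k)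
  have "a ^ Suc (Suc k) + real (Suc (Suc k)) * b * a ^ Suc k
     = (a ^ Suc k + real (Suc k) * b * a ^ k) * a + b * a ^ Suc k" by (simp add: algebra_simps)
  also have "\<dots> \<le> (a + b) ^ Suc k * a + b * (a + b) ^ Suc k"
    using assms Suc.IH by (intro add_mono mult_right_mono mult_left_mono power_mono) auto
  finally show ?case by (simp add: algebra_simps)
qed simp

text \<open>Every product over a set of \<open>k\<close> indices appears \<open>k!\<close> times in the expansion of the power of
  the sum.  The induction adds one index \<open>i\<close> and splits the \<open>k\<close>-sets according to whether
  they contain \<open>i\<close>.\<close>

lemma elementary_symmetric_le:
  fixes r :: "'i \<Rightarrow> real"
  assumes "finite J" "\<And>j. j \<in> J \<Longrightarrow> r j \<ge> 0"
  shows "(\<Sum>S | S \<subseteq> J \<and> card S = k. \<Prod>j\<in>S. r j) \<le> (\<Sum>j\<in>J. r j) ^ k / fact k"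
  using assms
proof (induction J arbitrary: k rule: finite_induct)
  case empty
  have sub: "{S. S \<subseteq> {} \<and> card S = k} = (if k = 0 then {{}} else {})" by auto
  show ?case unfolding sub by (simp add: power_0_left)
next
  case (insert i J)
  have IH: "(\<Sum>S | S \<subseteq> J \<and> card S = k. \<Prod>j\<in>S. r j) \<le> (\<Sum>j\<in>J. r j) ^ k / fact k" for k
    using insert by auto
  have nn: "(\<Sum>j\<in>J. r j) \<ge> 0" "r i \<ge> 0" using insert by (auto intro: sum_nonneg)
  show ?case
  proof (cases k)
    case 0
    have "{S. S \<subseteq> insert i J \<and> card S = 0} = {{}}"
      using insert.hyps(1) by (auto dest: finite_subset simp: card_eq_0_iff)
    then show ?thesis using 0 by simp
  next
    case (Suc l)
    have split: "{S. S \<subseteq> insert i J \<and> card S = Suc l} =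
        {S. S \<subseteq> J \<and> card S = Suc l} \<union> insert i ` {S. S \<subseteq> J \<and> card S = l}" (is "?L = ?A \<union> ?B")
    proof (intro equalityI subsetI)
      fix S assume S: "S \<in> ?L"
      then have fS: "finite S" using insert.hyps(1) by (auto intro: finite_subset)
      show "S \<in> ?A \<union> ?B"
      proof (cases "i \<in> S")
        case True
        then have "S = insert i (S - {i})" "S - {i} \<subseteq> J" "card (S - {i}) = l" using S fS by auto
        then show ?thesis by blast
      qed (use S in auto)
    next
      fix S assume "S \<in> ?A \<union> ?B"
      then show "S \<in> ?L" using insert.hyps by (auto simp: card_insert_if finite_subset)
    qed
    have fin: "finite ?A" "finite ?B" using insert.hyps(1) by auto
    have disj: "?A \<inter> ?B = {}" using insert.hyps(2) by auto
    have inj: "inj_on (insert i) {S. S \<subseteq> J \<and> card S = l}"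
      using insert.hyps(2) by (intro inj_onI) (metis (no_types, lifting) insert_ident mem_Collect_eq subset_iff)
    have "(\<Sum>S\<in>?B. \<Prod>j\<in>S. r j) = (\<Sum>S | S \<subseteq> J \<and> card S = l. r i * (\<Prod>j\<in>S. r j))"
    proof (subst sum.reindex[OF inj], rule sum.cong[OF refl])
      fix S assume "S \<in> {S. S \<subseteq> J \<and> card S = l}"
      then have "finite S" "i \<notin> S" using insert.hyps by (auto intro: finite_subset)
      then show "((\<lambda>S. \<Prod>j\<in>S. r j) \<circ> insert i) S = r i * (\<Prod>j\<in>S. r j)" by simp
    qed
    also have "\<dots> = r i * (\<Sum>S | S \<subseteq> J \<and> card S = l. \<Prod>j\<in>S. r j)" by (simp add: sum_distrib_left)
    finally have "(\<Sum>S\<in>?L. \<Prod>j\<in>S. r j) = (\<Sum>S\<in>?A. \<Prod>j\<in>S. r j) + r i * (\<Sum>S | S \<subseteq> J \<and> card S = l. \<Prod>j\<in>S. r j)"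
      unfolding split by (simp add: sum.union_disjoint[OF fin disj])
    also have "\<dots> \<le> (\<Sum>j\<in>J. r j) ^ Suc l / fact (Suc l) + r i * ((\<Sum>j\<in>J. r j) ^ l / fact l)"
      by (intro add_mono mult_left_mono IH nn)
    also have "\<dots> = ((\<Sum>j\<in>J. r j) ^ Suc l + real (Suc l) * r i * (\<Sum>j\<in>J. r j) ^ l) / fact (Suc l)"
      unfolding fact_Suc add_divide_distrib by (simp del: of_nat_Suc)
    also have "\<dots> \<le> ((\<Sum>j\<in>J. r j) + r i) ^ Suc l / fact (Suc l)"
      by (intro divide_right_mono add_power_ge_two_terms nn) auto
    finally show ?thesis using insert.hyps Suc by (simp add: add.commute)
  qed
qed

text \<open>A summable majorant.  From $k^k \le e^k k!$ the left side is at most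
  $(\sqrt{e}\,T)^k/\sqrt{k!}$; this is the geometric mean of $2^{-k}$ and $(2eT^2)^k/k!$, and both
  of these are terms of convergent series.\<close>

lemma hadamard_weight_le:
  fixes T :: real
  assumes "T \<ge> 0"
  shows "sqrt (real k ^ k) * (T ^ k / fact k) \<le> ((1/2) ^ k + (2 * exp 1 * T\<^sup>2) ^ k / fact k) / 2"
proof -
  have "real k ^ k / fact k \<le> exp (real k)"
  proof -
    have "(\<Sum>i\<in>{k}. real k ^ i /\<^sub>R fact i) \<le> (\<Sum>i. real k ^ i /\<^sub>R fact i)"
      by (intro sum_le_suminf summable_exp_generic) auto
    then show ?thesis by (simp add: exp_def divide_inverse mult.commute)
  qed
  then have kk: "real k ^ k \<le> exp 1 ^ k * fact k"
    by (simp add: field_simps exp_of_nat_mult[symmetric])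
  define a where "a = sqrt ((1/2) ^ k)"
  define b where "b = sqrt ((2 * exp 1 * T\<^sup>2) ^ k / fact k)"
  have "sqrt (real k ^ k) * (T ^ k / fact k) \<le> sqrt (exp 1 ^ k * fact k) * (T ^ k / fact k)"
    using assms kk by (intro mult_right_mono real_sqrt_le_mono) auto
  also have "\<dots> = sqrt (exp 1 ^ k * fact k) * sqrt ((T ^ k / fact k)\<^sup>2)" using assms by simp
  also have "\<dots> = sqrt ((1/2) ^ k * ((2 * exp 1 * T\<^sup>2) ^ k / fact k))"
    unfolding real_sqrt_mult[symmetric]
    by (rule arg_cong[where f = sqrt]) (simp add: power_mult_distrib power_divide power2_eq_square field_simps)
  also have "\<dots> = a * b" unfolding a_def b_def by (rule real_sqrt_mult)
  also have "\<dots> \<le> (a\<^sup>2 + b\<^sup>2) / 2" using sum_squares_bound[of a b] by simp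
  also have "a\<^sup>2 = (1/2) ^ k" by (simp add: a_def)
  also have "b\<^sup>2 = (2 * exp 1 * T\<^sup>2) ^ k / fact k" by (simp add: b_def)
  finally show ?thesis by simp
qed

lemma sum_subsets_hadamard_weight_le:
  fixes r :: "'i \<Rightarrow> real"
  assumes J: "finite J" and r: "\<And>j. j \<in> J \<Longrightarrow> r j \<ge> 0" and T: "(\<Sum>j\<in>J. r j) \<le> T"
  shows "(\<Sum>S\<in>Pow J. sqrt (real (card S) ^ card S) * (\<Prod>j\<in>S. r j)) \<le> 1 + exp (2 * exp 1 * T\<^sup>2) / 2"
proof -
  have T0: "T \<ge> 0" using T r by (meson order_trans sum_nonneg)
  have grp: "(\<Sum>k\<in>{..card J}. \<Sum>S | S \<in> Pow J \<and> card S = k. sqrt (real (card S) ^ card S) * (\<Prod>j\<in>S. r j)) =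
     (\<Sum>S\<in>Pow J. sqrt (real (card S) ^ card S) * (\<Prod>j\<in>S. r j))"
    by (rule sum.group) (use J in \<open>auto intro: card_mono\<close>)
  have "(\<Sum>S | S \<in> Pow J \<and> card S = k. sqrt (real (card S) ^ card S) * (\<Prod>j\<in>S. r j)) \<le>
      ((1/2) ^ k + (2 * exp 1 * T\<^sup>2) ^ k / fact k) / 2" for k
  proof -
    have "(\<Sum>S | S \<in> Pow J \<and> card S = k. sqrt (real (card S) ^ card S) * (\<Prod>j\<in>S. r j)) =
       (\<Sum>S | S \<subseteq> J \<and> card S = k. sqrt (real k ^ k) * (\<Prod>j\<in>S. r j))" by (intro sum.cong) auto
    also have "\<dots> = sqrt (real k ^ k) * (\<Sum>S | S \<subseteq> J \<and> card S = k. \<Prod>j\<in>S. r j)" by (simp add: sum_distrib_left)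
    also have "\<dots> \<le> sqrt (real k ^ k) * ((\<Sum>j\<in>J. r j) ^ k / fact k)"
      by (intro mult_left_mono elementary_symmetric_le J r) auto
    also have "\<dots> \<le> sqrt (real k ^ k) * (T ^ k / fact k)"
      using T r by (intro mult_left_mono divide_right_mono power_mono) (auto intro: sum_nonneg)
    also have "\<dots> \<le> ((1/2) ^ k + (2 * exp 1 * T\<^sup>2) ^ k / fact k) / 2" by (rule hadamard_weight_le[OF T0])
    finally show ?thesis .
  qed
  then have "(\<Sum>S\<in>Pow J. sqrt (real (card S) ^ card S) * (\<Prod>j\<in>S. r j)) \<le>
     (\<Sum>k\<le>card J. ((1/2) ^ k + (2 * exp 1 * T\<^sup>2) ^ k / fact k) / 2)"
    unfolding grp[symmetric] by (intro sum_mono)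
  also have "\<dots> = ((\<Sum>k\<le>card J. (1/2) ^ k) + (\<Sum>k\<le>card J. (2 * exp 1 * T\<^sup>2) ^ k / fact k)) / 2"
    by (simp add: sum.distrib sum_divide_distrib[symmetric])
  also have "(\<Sum>k\<le>card J. (1/2::real) ^ k) \<le> (\<Sum>k. (1/2) ^ k)"
    by (intro sum_le_suminf summable_geometric) auto
  also have "(\<Sum>k. (1/2::real) ^ k) = 2" by (subst suminf_geometric) auto
  also have "(\<Sum>k\<le>card J. (2 * exp 1 * T\<^sup>2) ^ k / fact k) \<le> (\<Sum>k. (2 * exp 1 * T\<^sup>2) ^ k /\<^sub>R fact k)"
    by (simp only: divide_inverse_commute real_scaleR_def[symmetric], intro sum_le_suminf summable_exp_generic) auto
  also have "\<dots> = exp (2 * exp 1 * T\<^sup>2)" by (simp add: exp_def)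
  finally show ?thesis by (simp add: divide_right_mono add_mono)
qed

section \<open>Sums over configurations\<close>

lemma space_conf_space [simp]: "space conf_space = Conf"
  unfolding conf_space_def by (rule space_measure_of) auto

lemma Conf_finite_inter: "X \<in> Conf \<Longrightarrow> rel_compact_borel B \<Longrightarrow> finite (X \<inter> B)"
  unfolding Conf_def rel_compact_borel_def by (auto intro: finite_subset[rotated])

lemma measurable_card_inter [measurable (raw)]:
  assumes "rel_compact_borel B"
  shows "(\<lambda>X. card (X \<inter> B)) \<in> conf_space \<rightarrow>\<^sub>M count_space UNIV"
proof (rule measurableI)
  fix A :: "nat set"
  have "(\<lambda>X. card (X \<inter> B)) -` {m} \<inter> Conf \<in> sets conf_space" for m
    unfolding conf_space_def using assms by (intro sigma_sets.Basic in_measure_of) auto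
  then have "(\<Union>m\<in>A. (\<lambda>X. card (X \<inter> B)) -` {m} \<inter> Conf) \<in> sets conf_space"
    by (intro sets.countable_UN') auto
  also have "(\<Union>m\<in>A. (\<lambda>X. card (X \<inter> B)) -` {m} \<inter> Conf) = (\<lambda>X. card (X \<inter> B)) -` A \<inter> space conf_space" by auto
  finally show "(\<lambda>X. card (X \<inter> B)) -` A \<inter> space conf_space \<in> sets conf_space" .
qed simp

text \<open>An exhaustion of the punctured line by compact sets; it reduces counting in arbitrary Borel
  sets to counting in relatively compact ones.\<close>

definition annulus :: "nat \<Rightarrow> real set" where
  "annulus j = {x. 1 / real (Suc j) \<le> \<bar>x\<bar> \<and> \<bar>x\<bar> \<le> real (Suc j)}"

lemma annulus_eq: "annulus j = {- real (Suc j)..- (1 / real (Suc j))} \<union> {1 / real (Suc j)..real (Suc j)}"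
proof -
  define e where "e = 1 / real (Suc j)"
  have "e > 0" by (simp add: e_def)
  then show ?thesis unfolding annulus_def e_def[symmetric] by (auto simp: abs_if)
qed

lemma rel_compact_annulus: "B \<in> sets borel \<Longrightarrow> rel_compact_borel (B \<inter> annulus j)"
  unfolding rel_compact_borel_def
proof (intro conjI exI[of _ "annulus j"])
  assume B: "B \<in> sets borel"
  show "compact (annulus j)" unfolding annulus_eq by (intro compact_Un) auto
  then have "annulus j \<in> sets borel" by (intro borel_closed compact_imp_closed)
  with B show "B \<inter> annulus j \<in> sets borel" by auto
  show "annulus j \<subseteq> - {0}" by (auto simp: annulus_def)
qed auto

lemma incseq_annulus: "incseq annulus"
proof (rule incseq_SucI)
  fix j
  have "1 / real (Suc (Suc j)) \<le> 1 / real (Suc j)" by (simp add: field_simps)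
  then show "annulus j \<subseteq> annulus (Suc j)" unfolding annulus_def by auto
qed

lemma UN_annulus: "(\<Union>j. annulus j) = - {0}"
proof (intro equalityI subsetI)
  fix x :: real assume "x \<in> - {0}"
  then have x: "\<bar>x\<bar> > 0" by simp
  obtain j where j: "real j \<ge> max \<bar>x\<bar> (1 / \<bar>x\<bar>)" using real_arch_simple by blast
  have "1 / \<bar>x\<bar> \<le> real (Suc j)" using j by simp
  then have "1 / real (Suc j) \<le> \<bar>x\<bar>" using x by (simp add: field_simps)
  then show "x \<in> (\<Union>j. annulus j)" using j by (auto simp: annulus_def)
qed (auto simp: annulus_def)

lemma nn_integral_count_indicator:
  assumes X: "X \<in> Conf" and B: "B \<in> sets borel"
  shows "(\<integral>\<^sup>+x. indicator B x \<partial>count_space X) = (SUP j. ennreal (card (X \<inter> (B \<inter> annulus j))))"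
proof -
  have X0: "X \<subseteq> - {0}" using X by (auto simp: Conf_def)
  have "(\<integral>\<^sup>+x. indicator B x \<partial>count_space X) = (\<integral>\<^sup>+x. indicator (X \<inter> B) x \<partial>count_space X)"
    by (intro nn_integral_cong) (auto simp: indicator_def)
  also have "\<dots> = emeasure (count_space X) (X \<inter> B)" by simp
  also have "X \<inter> B = (\<Union>j. X \<inter> (B \<inter> annulus j))"
    using UN_annulus X0 by blast
  also have "emeasure (count_space X) \<dots> = (SUP j. emeasure (count_space X) (X \<inter> (B \<inter> annulus j)))"
    using incseq_annulus
    by (intro SUP_emeasure_incseq[symmetric]) (fastforce simp: incseq_def)+
  also have "\<dots> = (SUP j. ennreal (card (X \<inter> (B \<inter> annulus j))))"
    by (intro SUP_cong refl, subst emeasure_count_space_finite)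
      (auto simp: Conf_finite_inter[OF X rel_compact_annulus[OF B]] ennreal_of_nat_eq_real_of_nat)
  finally show ?thesis .
qed

text \<open>Sums over the points of a configuration are integrals against its counting measure.\<close>

lemma measurable_nn_integral_count [measurable (raw)]:
  fixes f :: "real \<Rightarrow> ennreal"
  assumes "f \<in> borel_measurable borel"
  shows "(\<lambda>X. \<integral>\<^sup>+x. f x \<partial>count_space X) \<in> borel_measurable conf_space"
  using assms
proof (induction f rule: borel_measurable_induct)
  case (cong f g)
  then have "f = g" by auto
  with cong show ?case by simp
next
  case (set A)
  have "(\<lambda>X. SUP j. ennreal (card (X \<inter> (A \<inter> annulus j)))) \<in> borel_measurable conf_space"
    using rel_compact_annulus[OF set] by measurable
  then show ?case
    by (rule measurable_cong[THEN iffD2, rotated]) (use nn_integral_count_indicator[OF _ set] in simp)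
next
  case (mult u c)
  then show ?case by (simp add: nn_integral_cmult)
next
  case (add u v)
  then show ?case by (simp add: nn_integral_add)
next
  case (seq U)
  have "(\<integral>\<^sup>+x. (SUP i. U i) x \<partial>count_space X) = (SUP i. \<integral>\<^sup>+x. U i x \<partial>count_space X)" for X
    unfolding SUP_apply using seq by (intro nn_integral_monotone_convergence_SUP) auto
  then show ?case using seq by simp
qed

section \<open>Factorial moments of dominated determinantal processes\<close>

text \<open>All that is used of the Whittaker kernel: a factorised bound for pairs of points of the same
  sign.  It makes \<open>\<phi>\<^sup>2\<close> a majorant of the intensity.\<close>

locale dominated_determinantal =
  fixes M :: "real set measure" and K :: "real \<Rightarrow> real \<Rightarrow> complex" and \<phi> :: "real \<Rightarrow> real"
  assumes determinantal: "determinantal M K"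
    and \<phi>_measurable [measurable]: "\<phi> \<in> borel_measurable borel"
    and \<phi>_nonneg: "\<phi> x \<ge> 0"
    and kernel_bound: "x * y > 0 \<Longrightarrow> cmod (K x y) \<le> \<phi> x * \<phi> y"
begin

lemma sets_M [measurable_cong, simp]: "sets M = sets conf_space"
  using determinantal unfolding determinantal_def point_process_def by blast

lemma space_M [simp]: "space M = Conf"
  using sets_eq_imp_space_eq[OF sets_M] by simp

sublocale prob_space M
  using determinantal unfolding determinantal_def point_process_def by blast

definition intensity :: "real measure" where
  "intensity = density lborel (\<lambda>x. ennreal ((\<phi> x)\<^sup>2))"

lemma sets_intensity [measurable_cong, simp]: "sets intensity = sets borel"
  by (simp add: intensity_def)

lemma nn_integral_intensity:
  "f \<in> borel_measurable borel \<Longrightarrow> (\<integral>\<^sup>+x. f x \<partial>intensity) = (\<integral>\<^sup>+x. ennreal ((\<phi> x)\<^sup>2) * f x \<partial>lborel)"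
  unfolding intensity_def by (subst nn_integral_density) auto

text \<open>The points of all cells lie on one half-line, where the kernel bound and Hadamard's inequality
  apply, and the resulting product integrates cell by cell.\<close>

lemma expectation_prod_card_le:
  fixes D :: "nat \<Rightarrow> real set"
  assumes D: "\<And>i. i < k \<Longrightarrow> rel_compact_borel (D i)" and disj: "disjoint_family_on D {..<k}"
    and r: "r \<noteq> 0" and side: "\<And>i x. i < k \<Longrightarrow> x \<in> D i \<Longrightarrow> r * x > 0"
  shows "(\<integral>\<^sup>+X. (\<Prod>i<k. ennreal (real (card (X \<inter> D i)))) \<partial>M) \<le>
    ennreal (sqrt (real k ^ k)) * (\<Prod>i<k. emeasure intensity (D i))"
proof (cases "k = 0")
  case True
  then show ?thesis by (simp add: emeasure_space_1[simplified])
next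
  case False
  interpret product_sigma_finite "\<lambda>_. lborel :: real measure" by standard
  define d where "d x = det (mat k k (\<lambda>(i, j). K (x i) (x j)))" for x
  have Db: "D i \<in> sets borel" if "i < k" for i using D[OF that] by (simp add: rel_compact_borel_def)
  have int: "integrable M (\<lambda>X. \<Prod>i<k. real (card (X \<inter> D i)))"
    and intd: "set_integrable (Pi\<^sub>M {..<k} (\<lambda>_. lborel)) (Pi\<^sub>E {..<k} D) d"
    and eq: "complex_of_real (\<integral>X. (\<Prod>i<k. real (card (X \<inter> D i))) \<partial>M) =
          set_lebesgue_integral (Pi\<^sub>M {..<k} (\<lambda>_. lborel)) (Pi\<^sub>E {..<k} D) d"
    using determinantal False D disj unfolding determinantal_def d_def by force+
  have pt: "ennreal (cmod (indicator (Pi\<^sub>E {..<k} D) x *\<^sub>R d x)) \<le>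
      ennreal (sqrt (real k ^ k)) * (\<Prod>i<k. ennreal ((\<phi> (x i))\<^sup>2) * indicator (D i) (x i))" for x
  proof (cases "x \<in> Pi\<^sub>E {..<k} D")
    case True
    have xi: "x i \<in> D i" if "i < k" for i using True that by auto
    have "cmod (d x) \<le> sqrt (real k ^ k) * (\<Prod>i<k. (\<phi> (x i))\<^sup>2)"
      unfolding d_def
    proof (rule hadamard_det_bound_scaled)
      fix i j assume ij: "i < k" "j < k"
      have "(r * x i) * (r * x j) > 0" using side[OF ij(1) xi[OF ij(1)]] side[OF ij(2) xi[OF ij(2)]] by simp
      then have "r\<^sup>2 * (x i * x j) > 0" by (simp add: power2_eq_square mult_ac)
      then have "x i * x j > 0" using r by (simp add: zero_less_mult_iff)
      then show "cmod (K (x i) (x j)) \<le> \<phi> (x i) * \<phi> (x j)" by (rule kernel_bound)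
    qed (rule \<phi>_nonneg)
    then have "ennreal (cmod (d x)) \<le> ennreal (sqrt (real k ^ k) * (\<Prod>i<k. (\<phi> (x i))\<^sup>2))"
      by (rule ennreal_leI)
    also have "\<dots> = ennreal (sqrt (real k ^ k)) * (\<Prod>i<k. ennreal ((\<phi> (x i))\<^sup>2))"
      by (simp add: ennreal_mult prod_nonneg prod_ennreal)
    also have "(\<Prod>i<k. ennreal ((\<phi> (x i))\<^sup>2)) = (\<Prod>i<k. ennreal ((\<phi> (x i))\<^sup>2) * indicator (D i) (x i))"
      using xi by (intro prod.cong) auto
    finally show ?thesis using True by simp
  qed simp
  have "(\<integral>\<^sup>+X. (\<Prod>i<k. ennreal (real (card (X \<inter> D i)))) \<partial>M) = (\<integral>\<^sup>+X. ennreal (\<Prod>i<k. real (card (X \<inter> D i))) \<partial>M)"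
    by (simp add: prod_ennreal)
  also have "\<dots> = ennreal (\<integral>X. (\<Prod>i<k. real (card (X \<inter> D i))) \<partial>M)"
    using int by (intro nn_integral_eq_integral) (auto intro!: AE_I2 prod_nonneg)
  also have "\<dots> = ennreal (cmod (complex_of_real (\<integral>X. (\<Prod>i<k. real (card (X \<inter> D i))) \<partial>M)))"
    by (simp add: integral_nonneg_AE prod_nonneg)
  also have "\<dots> \<le> (\<integral>\<^sup>+x. ennreal (cmod (indicator (Pi\<^sub>E {..<k} D) x *\<^sub>R d x)) \<partial>Pi\<^sub>M {..<k} (\<lambda>_. lborel))"
    unfolding eq set_lebesgue_integral_def
    using intd unfolding set_integrable_def by (rule integral_norm_bound_ennreal)
  also have "\<dots> \<le> (\<integral>\<^sup>+x. ennreal (sqrt (real k ^ k)) * (\<Prod>i<k. ennreal ((\<phi> (x i))\<^sup>2) * indicator (D i) (x i)) \<partial>Pi\<^sub>M {..<k} (\<lambda>_. lborel))"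
    by (intro nn_integral_mono pt)
  also have "\<dots> = ennreal (sqrt (real k ^ k)) * (\<integral>\<^sup>+x. (\<Prod>i<k. ennreal ((\<phi> (x i))\<^sup>2) * indicator (D i) (x i)) \<partial>Pi\<^sub>M {..<k} (\<lambda>_. lborel))"
  proof (intro nn_integral_cmult borel_measurable_prod_ennreal)
    fix i assume i: "i \<in> {..<k}"
    then have "(\<lambda>y. ennreal ((\<phi> y)\<^sup>2) * indicator (D i) y) \<in> borel_measurable lborel" using Db by simp
    from measurable_compose[OF measurable_component_singleton[OF i] this]
    show "(\<lambda>x. ennreal ((\<phi> (x i))\<^sup>2) * indicator (D i) (x i)) \<in> borel_measurable (Pi\<^sub>M {..<k} (\<lambda>_. lborel))" .
  qed
  also have "(\<integral>\<^sup>+x. (\<Prod>i<k. ennreal ((\<phi> (x i))\<^sup>2) * indicator (D i) (x i)) \<partial>Pi\<^sub>M {..<k} (\<lambda>_. lborel)) =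
     (\<Prod>i<k. \<integral>\<^sup>+x. ennreal ((\<phi> x)\<^sup>2) * indicator (D i) x \<partial>lborel)"
    using Db by (intro product_nn_integral_prod[where f = "\<lambda>i y. ennreal ((\<phi> y)\<^sup>2) * indicator (D i) y"]) auto
  also have "\<dots> = (\<Prod>i<k. emeasure intensity (D i))"
    using Db by (intro prod.cong refl) (simp add: intensity_def emeasure_density)
  finally show ?thesis .
qed

lemma measurable_nn_integral_count_M:
  "f \<in> borel_measurable borel \<Longrightarrow> (\<lambda>X. \<integral>\<^sup>+x. f x \<partial>count_space X) \<in> borel_measurable M"
  using measurable_nn_integral_count measurable_cong_sets[OF sets_M refl] by blast

text \<open>Campbell's formula as an inequality.  For a Borel set it is the case of a single cell in the
  previous bound, applied to each half-line and to growing annuli; it then extends to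
  nonnegative functions in the usual way.\<close>

lemma expectation_count_le:
  assumes f: "f \<in> borel_measurable borel"
  shows "(\<integral>\<^sup>+X. (\<integral>\<^sup>+x. f x \<partial>count_space X) \<partial>M) \<le> (\<integral>\<^sup>+x. f x \<partial>intensity)"
  using f
proof (induction f rule: borel_measurable_induct)
  case (cong f g)
  then have "f = g" by auto
  with cong show ?case by simp
next
  case (set A)
  have le: "(\<integral>\<^sup>+X. ennreal (real (card (X \<inter> (A \<inter> annulus j)))) \<partial>M) \<le> emeasure intensity A" for j
  proof -
    define B where "B r = A \<inter> annulus j \<inter> {x. r * x > 0}" for r :: real
    have Bb: "B r = (A \<inter> {x. r * x > 0}) \<inter> annulus j" "A \<inter> {x. r * x > 0} \<in> sets borel" for r
      using set by (auto simp: B_def)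
    have rc: "rel_compact_borel (B r)" for r unfolding Bb(1) by (rule rel_compact_annulus[OF Bb(2)])
    have Bs: "B r \<in> sets borel" for r using rc[of r] by (simp add: rel_compact_borel_def)
    have one: "(\<integral>\<^sup>+X. ennreal (real (card (X \<inter> B r))) \<partial>M) \<le> emeasure intensity (B r)" if "r \<noteq> 0" for r
    proof -
      have "(\<integral>\<^sup>+X. (\<Prod>i<Suc 0. ennreal (real (card (X \<inter> B r)))) \<partial>M) \<le>
        ennreal (sqrt (real (Suc 0) ^ Suc 0)) * (\<Prod>i<Suc 0. emeasure intensity (B r))"
      proof (rule expectation_prod_card_le)
        show "disjoint_family_on (\<lambda>i. B r) {..<Suc 0}" by (simp add: disjoint_family_on_def)
        show "r * x > 0" if "x \<in> B r" for x using that by (simp add: B_def)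
      qed (use rc that in auto)
      then show ?thesis by simp
    qed
    have union: "A \<inter> annulus j = B 1 \<union> B (- 1)" and disj: "B 1 \<inter> B (- 1) = {}"
    proof -
      have nz: "x \<noteq> 0" if "x \<in> annulus j" for x using UN_annulus that by blast
      show "A \<inter> annulus j = B 1 \<union> B (- 1)"
        by (auto simp: B_def) (metis nz not_less_iff_gr_or_eq)
    qed (auto simp: B_def)
    have "(\<integral>\<^sup>+X. ennreal (real (card (X \<inter> (A \<inter> annulus j)))) \<partial>M) =
        (\<integral>\<^sup>+X. ennreal (real (card (X \<inter> B 1))) + ennreal (real (card (X \<inter> B (- 1)))) \<partial>M)"
    proof (rule nn_integral_cong)
      fix X assume "X \<in> space M"
      then have "finite (X \<inter> B r)" for r using Conf_finite_inter[OF _ rc[of r]] by simp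
      moreover have "X \<inter> (A \<inter> annulus j) = (X \<inter> B 1) \<union> (X \<inter> B (- 1))" "(X \<inter> B 1) \<inter> (X \<inter> B (- 1)) = {}"
        using union disj by auto
      ultimately have "card (X \<inter> (A \<inter> annulus j)) = card (X \<inter> B 1) + card (X \<inter> B (- 1))"
        by (simp add: card_Un_disjoint)
      then show "ennreal (real (card (X \<inter> (A \<inter> annulus j)))) = ennreal (real (card (X \<inter> B 1))) + ennreal (real (card (X \<inter> B (- 1))))"
        by simp
    qed
    also have "\<dots> = (\<integral>\<^sup>+X. ennreal (real (card (X \<inter> B 1))) \<partial>M) + (\<integral>\<^sup>+X. ennreal (real (card (X \<inter> B (- 1)))) \<partial>M)"
      using rc by (intro nn_integral_add) measurable
    also have "\<dots> \<le> emeasure intensity (B 1) + emeasure intensity (B (- 1))"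
      by (intro add_mono one) auto
    also have "\<dots> = emeasure intensity (B 1 \<union> B (- 1))" using Bs disj by (intro plus_emeasure) auto
    also have "\<dots> \<le> emeasure intensity A" using set by (intro emeasure_mono) (auto simp: B_def)
    finally show ?thesis .
  qed
  have "(\<integral>\<^sup>+X. (\<integral>\<^sup>+x. indicator A x \<partial>count_space X) \<partial>M) = (\<integral>\<^sup>+X. (SUP j. ennreal (card (X \<inter> (A \<inter> annulus j)))) \<partial>M)"
    by (intro nn_integral_cong nn_integral_count_indicator) (use set in auto)
  also have "\<dots> = (\<integral>\<^sup>+X. liminf (\<lambda>j. ennreal (card (X \<inter> (A \<inter> annulus j)))) \<partial>M)"
  proof (rule nn_integral_cong)
    fix X assume "X \<in> space M"
    then have X: "X \<in> Conf" by simp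
    have "incseq (\<lambda>j. ennreal (card (X \<inter> (A \<inter> annulus j))))"
    proof (rule incseq_SucI)
      fix j
      have "X \<inter> (A \<inter> annulus j) \<subseteq> X \<inter> (A \<inter> annulus (Suc j))"
        using incseq_SucD[OF incseq_annulus] by blast
      then show "ennreal (card (X \<inter> (A \<inter> annulus j))) \<le> ennreal (card (X \<inter> (A \<inter> annulus (Suc j))))"
        by (intro ennreal_leI of_nat_mono card_mono Conf_finite_inter[OF X rel_compact_annulus[OF set]])
    qed
    then have "(\<lambda>j. ennreal (card (X \<inter> (A \<inter> annulus j)))) \<longlonglongrightarrow> (SUP j. ennreal (card (X \<inter> (A \<inter> annulus j))))"
      by (rule LIMSEQ_SUP)
    then show "(SUP j. ennreal (card (X \<inter> (A \<inter> annulus j)))) = liminf (\<lambda>j. ennreal (card (X \<inter> (A \<inter> annulus j))))"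
      by (rule lim_imp_Liminf[symmetric, rotated]) simp
  qed
  also have "\<dots> \<le> liminf (\<lambda>j. \<integral>\<^sup>+X. ennreal (card (X \<inter> (A \<inter> annulus j))) \<partial>M)"
    using rel_compact_annulus[OF set] by (intro nn_integral_liminf) measurable
  also have "\<dots> \<le> emeasure intensity A"
    by (intro Liminf_le always_eventually allI le) simp
  finally show ?case using set by simp
next
  case (mult u c)
  then show ?case by (simp add: nn_integral_cmult measurable_nn_integral_count_M mult_left_mono)
next
  case (add u v)
  then show ?case by (simp add: nn_integral_add measurable_nn_integral_count_M add_mono)
next
  case (seq U)
  have 1: "(\<integral>\<^sup>+x. (SUP i. U i) x \<partial>count_space X) = (SUP i. \<integral>\<^sup>+x. U i x \<partial>count_space X)" for X
    unfolding SUP_apply using seq by (intro nn_integral_monotone_convergence_SUP) auto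
  have 3: "(\<integral>\<^sup>+x. (SUP i. U i) x \<partial>intensity) = (SUP i. \<integral>\<^sup>+x. U i x \<partial>intensity)"
    unfolding SUP_apply using seq
    by (intro nn_integral_monotone_convergence_SUP) (auto simp: measurable_cong_sets[OF sets_intensity refl])
  have 2: "incseq (\<lambda>i X. \<integral>\<^sup>+x. U i x \<partial>count_space X)"
    using seq(3) by (auto simp: incseq_def le_fun_def intro!: nn_integral_mono)
  have "(\<integral>\<^sup>+X. (\<integral>\<^sup>+x. (SUP i. U i) x \<partial>count_space X) \<partial>M) = (\<integral>\<^sup>+X. (SUP i. \<integral>\<^sup>+x. U i x \<partial>count_space X) \<partial>M)"
    by (simp only: 1)
  also have "\<dots> = (SUP i. \<integral>\<^sup>+X. (\<integral>\<^sup>+x. U i x \<partial>count_space X) \<partial>M)"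
    using seq 2 by (intro nn_integral_monotone_convergence_SUP measurable_nn_integral_count_M) auto
  also have "\<dots> \<le> (SUP i. \<integral>\<^sup>+x. U i x \<partial>intensity)"
    using seq by (intro SUP_mono') auto
  also have "\<dots> = (\<integral>\<^sup>+x. (SUP i. U i) x \<partial>intensity)" by (simp only: 3)
  finally show ?case .
qed

end

section \<open>Exponential moments\<close>

context dominated_determinantal
begin

text \<open>Expanding the product over all subsets of cells gives a sum of factorial moments.  Those with
  \<open>k\<close> cells contribute at most \<open>sqrt (k\<^sup>k) T\<^sup>k / k!\<close>, and the total is bounded independently
  of the number of cells.\<close>

lemma expectation_generating_product_le:
  fixes D :: "nat \<Rightarrow> real set" and c :: "nat \<Rightarrow> real"
  assumes J: "finite J" and D: "\<And>j. j \<in> J \<Longrightarrow> rel_compact_borel (D j)" and disj: "disjoint_family_on D J"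
    and r: "r \<noteq> 0" and side: "\<And>j x. j \<in> J \<Longrightarrow> x \<in> D j \<Longrightarrow> r * x > 0"
    and c: "\<And>j. j \<in> J \<Longrightarrow> c j \<ge> 0" and T: "T \<ge> 0"
    and sum: "(\<Sum>j\<in>J. ennreal (c j) * emeasure intensity (D j)) \<le> ennreal T"
  shows "(\<integral>\<^sup>+X. (\<Prod>j\<in>J. 1 + ennreal (c j) * ennreal (real (card (X \<inter> D j)))) \<partial>M) \<le>
    ennreal (1 + exp (2 * exp 1 * T\<^sup>2) / 2)"
proof -
  define w where "w j = enn2real (ennreal (c j) * emeasure intensity (D j))" for j
  have fin: "ennreal (c j) * emeasure intensity (D j) < \<top>" if "j \<in> J" for j
    using sum J that by (metis ennreal_less_top le_less_trans member_le_sum order_refl zero_le)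
  have w: "ennreal (w j) = ennreal (c j) * emeasure intensity (D j)" if "j \<in> J" for j
    using fin[OF that] by (simp add: w_def)
  have w0: "w j \<ge> 0" for j by (simp add: w_def)
  have sum_w: "(\<Sum>j\<in>J. w j) \<le> T"
  proof -
    have "ennreal (\<Sum>j\<in>J. w j) = (\<Sum>j\<in>J. ennreal (c j) * emeasure intensity (D j))"
      by (simp add: sum_ennreal[symmetric] w0 w cong: sum.cong)
    then have "ennreal (\<Sum>j\<in>J. w j) \<le> ennreal T" using sum by (simp only:)
    then show ?thesis using T by (simp only: ennreal_le_iff)
  qed
  have meas: "(\<lambda>X. ennreal (real (card (X \<inter> D j)))) \<in> borel_measurable M" if "j \<in> J" for j
    using D[OF that] by measurable
  have subset_bound: "(\<integral>\<^sup>+X. (\<Prod>j\<in>S. ennreal (c j) * ennreal (real (card (X \<inter> D j)))) \<partial>M) \<le>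
      ennreal (sqrt (real (card S) ^ card S) * (\<Prod>j\<in>S. w j))" if S: "S \<in> Pow J" for S
  proof -
    have fS: "finite S" using S J by (auto intro: finite_subset)
    obtain h where h: "bij_betw h {..<card S} S" using ex_bij_betw_nat_finite[OF fS] by (auto simp: atLeast0LessThan)
    have hS: "h i \<in> S" "h i \<in> J" if "i < card S" for i using h that S by (auto simp: bij_betw_def)
    have reidx: "(\<Prod>j\<in>S. f j) = (\<Prod>i<card S. f (h i))" for f :: "nat \<Rightarrow> ennreal"
      using prod.reindex_bij_betw[OF h, of f] by simp
    have "(\<integral>\<^sup>+X. (\<Prod>j\<in>S. ennreal (c j) * ennreal (real (card (X \<inter> D j)))) \<partial>M) =
        (\<integral>\<^sup>+X. (\<Prod>j\<in>S. ennreal (c j)) * (\<Prod>j\<in>S. ennreal (real (card (X \<inter> D j)))) \<partial>M)"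
      by (simp add: prod.distrib)
    also have "\<dots> = (\<Prod>j\<in>S. ennreal (c j)) * (\<integral>\<^sup>+X. (\<Prod>j\<in>S. ennreal (real (card (X \<inter> D j)))) \<partial>M)"
      using meas S by (intro nn_integral_cmult borel_measurable_prod_ennreal) auto
    also have "(\<integral>\<^sup>+X. (\<Prod>j\<in>S. ennreal (real (card (X \<inter> D j)))) \<partial>M) =
        (\<integral>\<^sup>+X. (\<Prod>i<card S. ennreal (real (card (X \<inter> D (h i))))) \<partial>M)" by (simp only: reidx)
    also have "\<dots> \<le> ennreal (sqrt (real (card S) ^ card S)) * (\<Prod>i<card S. emeasure intensity (D (h i)))"
    proof (rule expectation_prod_card_le[OF _ _ r])
      show "disjoint_family_on (\<lambda>i. D (h i)) {..<card S}"
        using disj h hS unfolding disjoint_family_on_def bij_betw_def inj_on_def by (metis lessThan_iff)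
      show "rel_compact_borel (D (h i))" if "i < card S" for i using hS(2)[OF that] D by blast
      show "r * x > 0" if "i < card S" "x \<in> D (h i)" for i x using hS(2)[OF that(1)] that(2) side by blast
    qed
    also have "(\<Prod>i<card S. emeasure intensity (D (h i))) = (\<Prod>j\<in>S. emeasure intensity (D j))" by (simp only: reidx)
    finally have "(\<integral>\<^sup>+X. (\<Prod>j\<in>S. ennreal (c j) * ennreal (real (card (X \<inter> D j)))) \<partial>M) \<le>
       (\<Prod>j\<in>S. ennreal (c j)) * (ennreal (sqrt (real (card S) ^ card S)) * (\<Prod>j\<in>S. emeasure intensity (D j)))"
      by (simp add: mult_left_mono)
    also have "\<dots> = ennreal (sqrt (real (card S) ^ card S)) * (\<Prod>j\<in>S. ennreal (c j) * emeasure intensity (D j))"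
      by (simp add: prod.distrib mult_ac)
    also have "(\<Prod>j\<in>S. ennreal (c j) * emeasure intensity (D j)) = (\<Prod>j\<in>S. ennreal (w j))"
      using w S by (intro prod.cong) auto
    also have "ennreal (sqrt (real (card S) ^ card S)) * (\<Prod>j\<in>S. ennreal (w j)) =
        ennreal (sqrt (real (card S) ^ card S) * (\<Prod>j\<in>S. w j))"
      by (simp add: prod_ennreal w0 ennreal_mult prod_nonneg)
    finally show ?thesis .
  qed
  have "(\<integral>\<^sup>+X. (\<Prod>j\<in>J. 1 + ennreal (c j) * ennreal (real (card (X \<inter> D j)))) \<partial>M) =
     (\<integral>\<^sup>+X. (\<Sum>S\<in>Pow J. (\<Prod>j\<in>S. ennreal (c j) * ennreal (real (card (X \<inter> D j))))) \<partial>M)"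
    by (subst add.commute, subst prod_add[OF J]) simp
  also have "\<dots> = (\<Sum>S\<in>Pow J. \<integral>\<^sup>+X. (\<Prod>j\<in>S. ennreal (c j) * ennreal (real (card (X \<inter> D j)))) \<partial>M)"
    using meas by (intro nn_integral_sum borel_measurable_prod_ennreal) auto
  also have "\<dots> \<le> (\<Sum>S\<in>Pow J. ennreal (sqrt (real (card S) ^ card S) * (\<Prod>j\<in>S. w j)))"
    by (intro sum_mono subset_bound)
  also have "\<dots> = ennreal (\<Sum>S\<in>Pow J. sqrt (real (card S) ^ card S) * (\<Prod>j\<in>S. w j))"
    by (intro sum_ennreal mult_nonneg_nonneg prod_nonneg) (auto simp: w0)
  also have "\<dots> \<le> ennreal (1 + exp (2 * exp 1 * T\<^sup>2) / 2)"
    by (intro ennreal_leI sum_subsets_hadamard_weight_le J w0 sum_w)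
  finally show ?thesis .
qed

end

text \<open>Half-open cells of length \<open>2\<^sup>-\<^sup>m\<close> on the half-line with sign \<open>r\<close>; the cell with index 0
  touches the origin and is left out in applications.\<close>

definition dyadic_cell :: "real \<Rightarrow> nat \<Rightarrow> nat \<Rightarrow> real set" where
  "dyadic_cell r m j = {x. real j / 2 ^ m < r * x \<and> r * x \<le> (real j + 1) / 2 ^ m}"

definition dyadic_index :: "real \<Rightarrow> nat \<Rightarrow> real \<Rightarrow> nat" where
  "dyadic_index r m x = nat (\<lceil>r * x * 2 ^ m\<rceil> - 1)"

lemma dyadic_index_cell:
  assumes "r * x > 0"
  shows "x \<in> dyadic_cell r m (dyadic_index r m x)"
proof -
  have pos: "r * x * 2 ^ m > 0" using assms by simp
  then have "real (dyadic_index r m x) = of_int \<lceil>r * x * 2 ^ m\<rceil> - 1"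
    unfolding dyadic_index_def by (subst of_nat_nat) (auto simp: le_diff_eq less_ceiling_iff[symmetric])
  then have "real (dyadic_index r m x) < r * x * 2 ^ m" "r * x * 2 ^ m \<le> real (dyadic_index r m x) + 1"
    by linarith+
  then show ?thesis by (simp add: dyadic_cell_def field_simps)
qed

lemma dyadic_cell_disjoint: "disjoint_family_on (dyadic_cell r m) J"
proof -
  have "j \<le> i" if "x \<in> dyadic_cell r m i" "x \<in> dyadic_cell r m j" for x i j
  proof -
    have "real j / 2 ^ m < (real i + 1) / 2 ^ m" using that by (auto simp: dyadic_cell_def)
    then have "real j < real i + 1" by (simp add: divide_less_cancel)
    then show ?thesis by linarith
  qed
  then show ?thesis unfolding disjoint_family_on_def by (metis IntE antisym ex_in_conv)
qed

lemma rel_compact_dyadic_cell: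
  assumes r: "r \<in> {1, - 1}" and j: "j \<ge> 1"
  shows "rel_compact_borel (dyadic_cell r m j)"
proof -
  define a b where "a = real j / 2 ^ m" and "b = (real j + 1) / 2 ^ m"
  have a: "a > 0" using j by (simp add: a_def)
  consider "r = 1" | "r = - 1" using r by auto
  then show ?thesis
  proof cases
    case 1
    then have "dyadic_cell r m j = {a<..b}" by (auto simp: dyadic_cell_def a_def b_def)
    then show ?thesis unfolding rel_compact_borel_def using a by (auto intro!: exI[of _ "{a..b}"])
  next
    case 2
    then have "dyadic_cell r m j = {- b..<- a}" by (auto simp: dyadic_cell_def a_def b_def)
    then show ?thesis unfolding rel_compact_borel_def using a by (auto intro!: exI[of _ "{- b..- a}"])
  qed
qed

lemma dyadic_index_tendsto:
  assumes "r * x > 0"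
  shows "(\<lambda>m. real (dyadic_index r m x) / 2 ^ m) \<longlonglongrightarrow> r * x"
proof (rule tendsto_sandwich[of "\<lambda>m. r * x - (1/2) ^ m" _ _ "\<lambda>_. r * x"])
  have "(\<lambda>m. r * x - (1/2) ^ m) \<longlonglongrightarrow> r * x - 0"
    by (intro tendsto_intros LIMSEQ_power_zero) auto
  then show "(\<lambda>m. r * x - (1/2) ^ m) \<longlonglongrightarrow> r * x" by simp
  have c: "real (dyadic_index r m x) / 2 ^ m < r * x \<and> r * x \<le> (real (dyadic_index r m x) + 1) / 2 ^ m" for m
    using dyadic_index_cell[OF assms, of m] by (simp add: dyadic_cell_def)
  show "\<forall>\<^sub>F m in sequentially. real (dyadic_index r m x) / 2 ^ m \<le> r * x"
    using c by (intro always_eventually allI less_imp_le) auto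
  show "\<forall>\<^sub>F m in sequentially. r * x - (1/2) ^ m \<le> real (dyadic_index r m x) / 2 ^ m"
    using c by (intro always_eventually allI) (auto simp: add_divide_distrib power_divide algebra_simps)
qed simp

lemma eventually_dyadic_index:
  assumes "r * x > 0"
  shows "\<forall>\<^sub>F m in sequentially. dyadic_index r m x \<in> {1..<4 ^ m}"
proof -
  have lim: "(\<lambda>m. real (dyadic_index r m x) / 2 ^ m) \<longlonglongrightarrow> r * x" by (rule dyadic_index_tendsto[OF assms])
  have "\<forall>\<^sub>F m in sequentially. real (dyadic_index r m x) / 2 ^ m > 0"
    using lim assms by (rule order_tendstoD)
  moreover have "\<forall>\<^sub>F m in sequentially. real (dyadic_index r m x) / 2 ^ m < r * x + 1"
    using lim by (rule order_tendstoD) simp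
  moreover have "\<forall>\<^sub>F m in sequentially. r * x + 1 < (2::real) ^ m"
  proof -
    obtain N where N: "r * x + 1 < 2 ^ N" using real_arch_pow[of 2 "r * x + 1"] by auto
    have "r * x + 1 < 2 ^ m" if "m \<ge> N" for m
      using N power_increasing[OF that, of "2::real"] by linarith
    then show ?thesis by (auto simp: eventually_sequentially)
  qed
  ultimately show ?thesis
  proof eventually_elim
    case (elim m)
    have "real (dyadic_index r m x) / 2 ^ m < 2 ^ m" using elim(2,3) by (rule less_trans)
    then have "real (dyadic_index r m x) < 2 ^ m * 2 ^ m" by (simp only: pos_divide_less_eq zero_less_power zero_less_numeral)
    also have "(2::real) ^ m * 2 ^ m = real (4 ^ m)" by (simp add: power_mult_distrib[symmetric])
    finally have "dyadic_index r m x < 4 ^ m" by (simp only: of_nat_less_iff)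
    moreover have "dyadic_index r m x > 0" using elim(1) by (simp add: zero_less_divide_iff)
    ultimately show ?case by simp
  qed
qed

lemma eventually_inj_on_dyadic_index:
  assumes F: "finite F" and pos: "\<And>x. x \<in> F \<Longrightarrow> r * x > 0"
  shows "\<forall>\<^sub>F m in sequentially. inj_on (dyadic_index r m) F"
proof -
  have "\<forall>\<^sub>F m in sequentially. dyadic_index r m x \<noteq> dyadic_index r m y" if "x \<in> F" "y \<in> F" "x \<noteq> y" for x y
  proof -
    have "r \<noteq> 0" using pos[OF that(1)] by auto
    have "(\<lambda>m. real (dyadic_index r m x) / 2 ^ m - real (dyadic_index r m y) / 2 ^ m) \<longlonglongrightarrow> r * x - r * y"
      by (intro tendsto_diff dyadic_index_tendsto pos that)
    moreover have "r * x - r * y \<noteq> 0" using that(3) \<open>r \<noteq> 0\<close> by simp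
    ultimately have "\<forall>\<^sub>F m in sequentially. real (dyadic_index r m x) / 2 ^ m - real (dyadic_index r m y) / 2 ^ m \<noteq> 0"
      by (rule tendsto_imp_eventually_ne)
    then show ?thesis by eventually_elim auto
  qed
  then have "\<forall>\<^sub>F m in sequentially. \<forall>x\<in>F. \<forall>y\<in>F. x \<noteq> y \<longrightarrow> dyadic_index r m x \<noteq> dyadic_index r m y"
    using F by (simp add: eventually_ball_finite_distrib)
  then show ?thesis by eventually_elim (auto simp: inj_on_def)
qed

lemma summable_on_iff_integrable_count_space:
  fixes f :: "'a \<Rightarrow> real"
  shows "f summable_on A \<longleftrightarrow> integrable (count_space A) f"
  using summable_on_iff_abs_summable_on_real[of f A] abs_summable_equivalent[of f A]
  unfolding Infinite_Set_Sum.abs_summable_on_def by blast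

lemma infsum_eq_integral_count_space:
  fixes f :: "'a \<Rightarrow> real"
  shows "infsum f A = (\<integral>x. f x \<partial>count_space A)"
proof (cases "integrable (count_space A) f")
  case True
  then have "Infinite_Set_Sum.abs_summable_on f A" by (simp add: Infinite_Set_Sum.abs_summable_on_def)
  from infsetsum_infsum[OF this] show ?thesis by (simp add: infsetsum_def)
next
  case False
  then show ?thesis
    by (simp add: infsum_not_exists summable_on_iff_integrable_count_space not_integrable_integral_eq)
qed

text \<open>The function \<open>min |x| 1\<close> on the half-line with sign \<open>r\<close>, and 0 on the other one.\<close>

definition side_weight :: "real \<Rightarrow> real \<Rightarrow> real" where
  "side_weight r x = max 0 (min (r * x) 1)"

definition side_sum :: "real \<Rightarrow> real set \<Rightarrow> ennreal" where
  "side_sum r X = (\<integral>\<^sup>+x. ennreal (side_weight r x) \<partial>count_space X)"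

lemma side_weight_measurable [measurable]: "side_weight r \<in> borel_measurable borel"
  unfolding side_weight_def by measurable

lemma side_sum_measurable [measurable]: "side_sum r \<in> borel_measurable conf_space"
  unfolding side_sum_def by measurable

lemma exp_mult_le_chord:
  fixes C t :: real
  assumes "0 \<le> t" "t \<le> 1"
  shows "exp (C * t) \<le> 1 + (exp C - 1) * t"
proof -
  have "convex_on UNIV (exp :: real \<Rightarrow> real)" by (rule exp_convex)
  from convex_onD[OF this, of t 0 C] show ?thesis using assms by (simp add: algebra_simps)
qed

context dominated_determinantal
begin

text \<open>As \<open>exp (C t) \<le> 1 + C' t\<close> on \<open>[0, 1]\<close>, it suffices to bound the expectation of the product
  of \<open>1 + C' side_weight r x\<close> over the points.  Replace the weight by its infimum over each dyadic
  cell and \<open>1 + c\<close> per point by \<open>1 + c N\<close> per cell, where \<open>N\<close> is the number of points in the cell.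
  The expectation of this product is bounded uniformly in the mesh.  Once the mesh separates the
  points of a given finite set, the product over cells dominates the product over that set,
  up to an error that vanishes with the mesh, so Fatou's lemma concludes.\<close>

lemma exponential_moment:
  assumes r: "r \<in> {1, - 1}" and C: "C \<ge> 0"
    and fin: "(\<integral>\<^sup>+x. ennreal (side_weight r x) \<partial>intensity) < \<infinity>"
  shows "(\<integral>\<^sup>+X. (if side_sum r X < \<infinity> then ennreal (exp (C * enn2real (side_sum r X))) else 0) \<partial>M) < \<infinity>"
proof -
  define C' where "C' = exp C - 1"
  have C': "C' \<ge> 0" using C by (simp add: C'_def)
  define I where "I = enn2real (\<integral>\<^sup>+x. ennreal (side_weight r x) \<partial>intensity)"
  have I: "ennreal I = (\<integral>\<^sup>+x. ennreal (side_weight r x) \<partial>intensity)" using fin by (simp add: I_def)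
  define T where "T = C' * I"
  have T: "T \<ge> 0" using C' by (simp add: T_def I_def)
  define c where "c m j = C' * min (real j / 2 ^ m) 1" for m j :: nat
  \<comment> \<open>The cells with these indices cover \<open>(2\<^sup>-\<^sup>m, 2\<^sup>m]\<close>.\<close>
  define J where "J m = {1..<(4::nat) ^ m}" for m
  define Y where "Y m X = (\<Prod>j\<in>J m. 1 + ennreal (c m j) * ennreal (real (card (X \<inter> dyadic_cell r m j))))" for m X
  have rc: "rel_compact_borel (dyadic_cell r m j)" if "j \<in> J m" for m j
    using that r by (intro rel_compact_dyadic_cell) (auto simp: J_def)
  have cell_pos: "r * x > 0" if "x \<in> dyadic_cell r m j" for m j x
    using that by (auto simp: dyadic_cell_def intro: le_less_trans[rotated])
  have EY: "(\<integral>\<^sup>+X. Y m X \<partial>M) \<le> ennreal (1 + exp (2 * exp 1 * T\<^sup>2) / 2)" for m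
    unfolding Y_def
  proof (rule expectation_generating_product_le[where r = r])
    show "finite (J m)" by (simp add: J_def)
    show "disjoint_family_on (dyadic_cell r m) (J m)" by (rule dyadic_cell_disjoint)
    show "r \<noteq> 0" using r by auto
    show "c m j \<ge> 0" for j using C' by (simp add: c_def)
    have "(\<Sum>j\<in>J m. ennreal (c m j) * emeasure intensity (dyadic_cell r m j)) =
        (\<Sum>j\<in>J m. \<integral>\<^sup>+x. ennreal (c m j) * indicator (dyadic_cell r m j) x \<partial>intensity)"
      using rc by (intro sum.cong refl, subst nn_integral_cmult_indicator) (auto simp: rel_compact_borel_def)
    also have "\<dots> = (\<integral>\<^sup>+x. (\<Sum>j\<in>J m. ennreal (c m j) * indicator (dyadic_cell r m j) x) \<partial>intensity)"
      using rc unfolding rel_compact_borel_def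
      by (intro nn_integral_sum[symmetric] borel_measurable_times_ennreal borel_measurable_const borel_measurable_indicator) simp
    also have "\<dots> \<le> (\<integral>\<^sup>+x. ennreal C' * ennreal (side_weight r x) \<partial>intensity)"
    proof (intro nn_integral_mono)
      fix x
      \<comment> \<open>The cells are disjoint, so at most one term is nonzero.\<close>
      show "(\<Sum>j\<in>J m. ennreal (c m j) * indicator (dyadic_cell r m j) x) \<le> ennreal C' * ennreal (side_weight r x)"
      proof (cases "\<exists>i\<in>J m. x \<in> dyadic_cell r m i")
        case True
        then obtain i where i: "i \<in> J m" "x \<in> dyadic_cell r m i" by blast
        have "x \<notin> dyadic_cell r m j" if "j \<in> J m - {i}" for j
          using dyadic_cell_disjoint[of r m "J m"] i that unfolding disjoint_family_on_def by blast
        then have "(\<Sum>j\<in>J m. ennreal (c m j) * indicator (dyadic_cell r m j) x) = ennreal (c m i)"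
          using i by (subst sum.remove[OF _ i(1)]) (auto simp: J_def)
        also have "\<dots> \<le> ennreal (C' * side_weight r x)"
          using i(2) C' unfolding c_def side_weight_def dyadic_cell_def
          by (intro ennreal_leI mult_left_mono) auto
        also have "\<dots> = ennreal C' * ennreal (side_weight r x)" using C' by (simp add: ennreal_mult side_weight_def)
        finally show ?thesis .
      next
        case False
        then show ?thesis by (subst sum.neutral) auto
      qed
    qed
    also have "\<dots> = ennreal C' * ennreal I" unfolding I by (intro nn_integral_cmult) simp
    also have "\<dots> = ennreal T" using C' by (simp add: T_def ennreal_mult I_def)
    finally show "(\<Sum>j\<in>J m. ennreal (c m j) * emeasure intensity (dyadic_cell r m j)) \<le> ennreal T" .
  qed (use rc cell_pos T in auto)
  have Ym: "Y m \<in> borel_measurable M" for m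
    unfolding Y_def using rc by (intro borel_measurable_prod_ennreal) measurable
  \<comment> \<open>Fatou's lemma needs this lower bound for the products over all finite sets of points.\<close>
  have finite_le: "(\<Prod>x\<in>F. ennreal (1 + C' * side_weight r x)) \<le> liminf (\<lambda>m. Y m X)"
    if X: "X \<in> Conf" and F: "finite F" "F \<subseteq> X" "\<And>x. x \<in> F \<Longrightarrow> r * x > 0" for X F
  proof -
    have "(\<lambda>m. ennreal (\<Prod>x\<in>F. 1 + c m (dyadic_index r m x))) \<longlonglongrightarrow> ennreal (\<Prod>x\<in>F. 1 + C' * min (r * x) 1)"
      unfolding c_def by (intro tendsto_ennrealI tendsto_intros dyadic_index_tendsto F(3))
    then have "liminf (\<lambda>m. ennreal (\<Prod>x\<in>F. 1 + c m (dyadic_index r m x))) = ennreal (\<Prod>x\<in>F. 1 + C' * min (r * x) 1)"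
      by (intro lim_imp_Liminf) auto
    also have "(\<Prod>x\<in>F. 1 + C' * min (r * x) 1) = (\<Prod>x\<in>F. 1 + C' * side_weight r x)"
      using F(3) by (intro prod.cong refl) (auto simp: side_weight_def max_def min_def less_imp_le)
    finally have eq: "ennreal (\<Prod>x\<in>F. 1 + C' * side_weight r x) = liminf (\<lambda>m. ennreal (\<Prod>x\<in>F. 1 + c m (dyadic_index r m x)))" ..
    have "\<forall>\<^sub>F m in sequentially. \<forall>x\<in>F. dyadic_index r m x \<in> J m"
      unfolding J_def using F by (intro eventually_ball_finite eventually_dyadic_index ballI)
    moreover have "\<forall>\<^sub>F m in sequentially. inj_on (dyadic_index r m) F"
      using F by (intro eventually_inj_on_dyadic_index)
    ultimately have "\<forall>\<^sub>F m in sequentially. ennreal (\<Prod>x\<in>F. 1 + c m (dyadic_index r m x)) \<le> Y m X"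
    proof eventually_elim
      case (elim m)
      have c0: "c m j \<ge> 0" for j using C' by (simp add: c_def)
      define p where "p j = 1 + c m j * real (card (X \<inter> dyadic_cell r m j))" for j
      have p1: "p j \<ge> 1" for j using c0[of j] by (simp add: p_def)
      have "(\<Prod>x\<in>F. 1 + c m (dyadic_index r m x)) = (\<Prod>j\<in>dyadic_index r m ` F. 1 + c m j)"
        using elim(2) by (simp only: prod.reindex o_def)
      also have "\<dots> \<le> (\<Prod>j\<in>dyadic_index r m ` F. p j)"
      proof (rule prod_mono, intro conjI)
        fix j assume "j \<in> dyadic_index r m ` F"
        then obtain x where x: "x \<in> F" "j = dyadic_index r m x" by blast
        have "x \<in> X \<inter> dyadic_cell r m j" using x F by (auto intro: dyadic_index_cell)
        moreover have "finite (X \<inter> dyadic_cell r m j)"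
          using elim(1) x by (intro Conf_finite_inter[OF X] rc) auto
        ultimately have "card (X \<inter> dyadic_cell r m j) \<ge> 1" by (metis One_nat_def Suc_leI card_gt_0_iff empty_iff)
        then show "1 + c m j \<le> p j"
          using c0[of j] by (simp add: p_def mult_le_cancel_left1)
        show "0 \<le> 1 + c m j" using c0[of j] by simp
      qed
      also have "\<dots> \<le> (\<Prod>j\<in>J m. p j)"
        using elim(1) p1 by (intro prod_mono2) (auto simp: J_def intro: order_trans[OF zero_le_one])
      finally have "ennreal (\<Prod>x\<in>F. 1 + c m (dyadic_index r m x)) \<le> ennreal (\<Prod>j\<in>J m. p j)"
        by (rule ennreal_leI)
      also have "\<dots> = (\<Prod>j\<in>J m. ennreal (p j))"
        using p1 by (intro prod_ennreal[symmetric]) (auto intro: order_trans[OF zero_le_one])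
      also have "\<dots> = Y m X"
        unfolding Y_def p_def using c0 by (intro prod.cong refl) (simp add: ennreal_plus ennreal_mult)
      finally show ?case .
    qed
    then have "liminf (\<lambda>m. ennreal (\<Prod>x\<in>F. 1 + c m (dyadic_index r m x))) \<le> liminf (\<lambda>m. Y m X)"
      by (rule Liminf_mono)
    then show ?thesis
      unfolding eq[symmetric] by (subst prod_ennreal) (auto simp: C' side_weight_def)
  qed
  have pointwise: "ennreal (exp (C * enn2real (side_sum r X))) \<le> liminf (\<lambda>m. Y m X)"
    if X: "X \<in> Conf" and sfin: "side_sum r X < \<infinity>" for X
  proof (cases "liminf (\<lambda>m. Y m X) = \<infinity>")
    case False
    define L where "L = enn2real (liminf (\<lambda>m. Y m X))"
    have L: "liminf (\<lambda>m. Y m X) = ennreal L" using False by (simp add: L_def less_top)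
    have bound: "exp (C * (\<Sum>x\<in>F. side_weight r x)) \<le> L" if F: "finite F" "F \<subseteq> X" for F
    proof -
      define G where "G = {x\<in>F. r * x > 0}"
      have "(\<Sum>x\<in>F. side_weight r x) = (\<Sum>x\<in>G. side_weight r x)"
      proof (rule sum.mono_neutral_right)
        show "\<forall>x\<in>F - G. side_weight r x = 0"
        proof
          fix x assume "x \<in> F - G"
          then have "r * x \<le> 0" by (simp add: G_def not_less)
          then show "side_weight r x = 0" by (simp add: side_weight_def max.absorb1)
        qed
      qed (use F in \<open>auto simp: G_def\<close>)
      then have "exp (C * (\<Sum>x\<in>F. side_weight r x)) = (\<Prod>x\<in>G. exp (C * side_weight r x))"
        using F by (simp add: sum_distrib_left exp_sum G_def)
      also have "\<dots> \<le> (\<Prod>x\<in>G. 1 + C' * side_weight r x)"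
        unfolding C'_def by (intro prod_mono conjI exp_mult_le_chord) (auto simp: side_weight_def)
      finally have "ennreal (exp (C * (\<Sum>x\<in>F. side_weight r x))) \<le> ennreal (\<Prod>x\<in>G. 1 + C' * side_weight r x)"
        by (rule ennreal_leI)
      also have "\<dots> = (\<Prod>x\<in>G. ennreal (1 + C' * side_weight r x))"
        by (subst prod_ennreal) (auto simp: C' side_weight_def)
      also have "\<dots> \<le> ennreal L" unfolding L[symmetric] using F by (intro finite_le[OF X]) (auto simp: G_def)
      finally have "ennreal (exp (C * (\<Sum>x\<in>F. side_weight r x))) \<le> ennreal L" .
      then show ?thesis by (subst (asm) ennreal_le_iff) (simp_all add: L_def)
    qed
    have L1: "L \<ge> 1" using bound[of "{}"] by simp
    have swnn: "side_weight r x \<ge> 0" for x by (simp add: side_weight_def)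
    have int: "integrable (count_space X) (side_weight r)"
      using sfin swnn by (intro integrableI_bounded) (auto simp: side_sum_def)
    have eq: "enn2real (side_sum r X) = infsum (side_weight r) X"
    proof -
      have "side_sum r X = ennreal (integral\<^sup>L (count_space X) (side_weight r))"
        unfolding side_sum_def using int swnn by (intro nn_integral_eq_integral) auto
      also have "integral\<^sup>L (count_space X) (side_weight r) = infsum (side_weight r) X"
        by (rule infsum_eq_integral_count_space[symmetric])
      finally show ?thesis by (simp add: infsum_nonneg swnn)
    qed
    have sm: "side_weight r summable_on X"
      using int by (simp add: summable_on_iff_integrable_count_space)
    have "exp (C * infsum (side_weight r) X) \<le> L"
    proof (cases "C = 0")
      case False
      then have Cp: "C > 0" using C by simp
      have "infsum (side_weight r) X \<le> ln L / C"
      proof (rule infsum_le_finite_sums[OF sm])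
        fix F assume "finite F" "F \<subseteq> X"
        from bound[OF this] have "C * (\<Sum>x\<in>F. side_weight r x) \<le> ln L"
          using L1 by (simp add: ln_ge_iff)
        then show "(\<Sum>x\<in>F. side_weight r x) \<le> ln L / C" using Cp by (simp add: field_simps)
      qed
      then have "C * infsum (side_weight r) X \<le> ln L" using Cp by (simp add: field_simps)
      then show ?thesis using L1 by (simp add: ln_ge_iff)
    qed (use L1 in simp)
    then show ?thesis unfolding L eq by (rule ennreal_leI)
  qed simp
  have "(\<integral>\<^sup>+X. (if side_sum r X < \<infinity> then ennreal (exp (C * enn2real (side_sum r X))) else 0) \<partial>M) \<le>
      (\<integral>\<^sup>+X. liminf (\<lambda>m. Y m X) \<partial>M)"
    using pointwise by (intro nn_integral_mono) auto
  also have "\<dots> \<le> liminf (\<lambda>m. \<integral>\<^sup>+X. Y m X \<partial>M)" by (intro nn_integral_liminf Ym)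
  also have "\<dots> \<le> ennreal (1 + exp (2 * exp 1 * T\<^sup>2) / 2)"
    by (intro Liminf_le always_eventually allI EY) simp
  also have "\<dots> < \<infinity>" by simp
  finally show ?thesis .
qed

end

section \<open>Convergence of truncated sums\<close>

lemma infsum_inter_eq_integral:
  fixes f :: "real \<Rightarrow> real"
  shows "infsum f (X \<inter> B) = (\<integral>x. indicator B x * f x \<partial>count_space X)"
proof -
  have "infsum f (X \<inter> B) = infsum (\<lambda>x. indicator B x * f x) X"
    by (rule infsum_cong_neutral) (auto simp: indicator_def)
  then show ?thesis by (simp add: infsum_eq_integral_count_space)
qed

text \<open>The sum is a difference of two integrals against the counting measure when it converges
  absolutely, and 0 otherwise; the two cases form a measurable partition.\<close>

lemma infsum_inter_measurable [measurable (raw)]: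
  fixes f :: "real \<Rightarrow> real"
  assumes f[measurable]: "f \<in> borel_measurable borel" and B[measurable]: "B \<in> sets borel"
  shows "(\<lambda>X. infsum f (X \<inter> B)) \<in> borel_measurable conf_space"
proof -
  define g where "g x = indicator B x * f x" for x
  have g[measurable]: "g \<in> borel_measurable borel" unfolding g_def by measurable
  have eq: "infsum f (X \<inter> B) = (if (\<integral>\<^sup>+x. ennreal (norm (g x)) \<partial>count_space X) < \<infinity>
      then enn2real (\<integral>\<^sup>+x. ennreal (g x) \<partial>count_space X) - enn2real (\<integral>\<^sup>+x. ennreal (- g x) \<partial>count_space X) else 0)" for X
  proof (cases "integrable (count_space X) g")
    case True
    then have "(\<integral>\<^sup>+x. ennreal (norm (g x)) \<partial>count_space X) < \<infinity>" by (simp add: integrable_iff_bounded)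
    then show ?thesis using real_lebesgue_integral_def[OF True]
      by (simp add: infsum_inter_eq_integral g_def[symmetric])
  next
    case False
    then have "\<not> (\<integral>\<^sup>+x. ennreal (norm (g x)) \<partial>count_space X) < \<infinity>" by (simp add: integrable_iff_bounded)
    then show ?thesis using not_integrable_integral_eq[OF False]
      by (simp add: infsum_inter_eq_integral g_def[symmetric])
  qed
  show ?thesis unfolding eq by measurable
qed

lemma integral_dominated_convergence_at_right:
  fixes s :: "real \<Rightarrow> 'a \<Rightarrow> real"
  assumes "f \<in> borel_measurable M" "\<And>\<delta>. s \<delta> \<in> borel_measurable M" "integrable M w"
    and lim: "AE x in M. ((\<lambda>\<delta>. s \<delta> x) \<longlongrightarrow> f x) (at_right 0)"
    and bound: "\<And>\<delta>. AE x in M. norm (s \<delta> x) \<le> w x"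
  shows "((\<lambda>\<delta>. \<integral>x. s \<delta> x \<partial>M) \<longlongrightarrow> (\<integral>x. f x \<partial>M)) (at_right 0)"
  unfolding tendsto_at_iff_sequentially comp_def
proof (intro allI impI)
  fix \<delta> assume \<delta>: "\<forall>i::nat. \<delta> i \<in> {0::real<..} - {0}" "\<delta> \<longlonglongrightarrow> 0"
  show "(\<lambda>i. \<integral>x. s (\<delta> i) x \<partial>M) \<longlonglongrightarrow> (\<integral>x. f x \<partial>M)"
  proof (rule integral_dominated_convergence)
    show "AE x in M. (\<lambda>i. s (\<delta> i) x) \<longlonglongrightarrow> f x"
      using lim by eventually_elim (use \<delta> in \<open>simp add: tendsto_at_iff_sequentially comp_def\<close>)
    show "AE x in M. norm (s (\<delta> i) x) \<le> w x" for i by (rule bound)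
  qed (use assms(1-3) in auto)
qed

lemma indicator_side_tendsto:
  fixes r x :: real
  shows "((\<lambda>\<delta>. indicator {x. r * x > \<delta>} x :: real) \<longlongrightarrow> indicator {x. r * x > 0} x) (at_right 0)"
proof (rule tendsto_eventually)
  show "\<forall>\<^sub>F \<delta> in at_right 0. (indicator {x. r * x > \<delta>} x :: real) = indicator {x. r * x > 0} x"
  proof (cases "r * x > 0")
    case True
    then have "\<forall>\<^sub>F \<delta> in at_right 0. \<delta> < r * x"
      unfolding eventually_at_right_field by (intro exI[of _ "r * x"]) auto
    then show ?thesis using True by (auto elim!: eventually_mono)
  next
    case False
    have "\<forall>\<^sub>F \<delta> in at_right 0. \<delta> > (0::real)" by (rule eventually_at_right_less)
    then show ?thesis using False by (auto elim!: eventually_mono)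
  qed
qed

lemma side_set_borel [measurable]: "{x. r * x > (\<delta>::real)} \<in> sets borel"
  by measurable

text \<open>For an absolutely summable function this is dominated convergence for the counting measure
  of the configuration.\<close>

lemma tendsto_infsum_side:
  fixes f :: "real \<Rightarrow> real"
  assumes "f summable_on X"
  shows "((\<lambda>\<delta>. infsum f (X \<inter> {x. r * x > \<delta>})) \<longlongrightarrow> infsum f (X \<inter> {x. r * x > 0})) (at_right 0)"
  unfolding infsum_inter_eq_integral
proof (rule integral_dominated_convergence_at_right)
  have "integrable (count_space X) f" using assms by (simp add: summable_on_iff_integrable_count_space)
  then show "integrable (count_space X) (\<lambda>x. norm (f x))" by (rule integrable_norm)
  show "AE x in count_space X. ((\<lambda>\<delta>. indicator {x. r * x > \<delta>} x * f x) \<longlongrightarrow> indicator {x. r * x > 0} x * f x) (at_right 0)"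
    by (intro AE_I2 tendsto_mult tendsto_const indicator_side_tendsto)
  show "AE x in count_space X. norm (indicator {x. r * x > \<delta>} x * f x) \<le> norm (f x)" for \<delta>
    by (intro AE_I2) (simp add: indicator_def)
qed auto

context dominated_determinantal
begin

lemma measurable_infsum_inter_M [measurable (raw)]:
  fixes f :: "real \<Rightarrow> real"
  shows "f \<in> borel_measurable borel \<Longrightarrow> B \<in> sets borel \<Longrightarrow> (\<lambda>X. infsum f (X \<inter> B)) \<in> borel_measurable M"
  using infsum_inter_measurable measurable_cong_sets[OF sets_M refl] by blast

context
  fixes f :: "real \<Rightarrow> real"
  assumes f [measurable]: "f \<in> borel_measurable borel"
    and fin: "(\<integral>\<^sup>+x. ennreal \<bar>f x\<bar> \<partial>intensity) < \<infinity>"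
begin

lemma expectation_abs_sum_finite: "(\<integral>\<^sup>+X. (\<integral>\<^sup>+x. ennreal \<bar>f x\<bar> \<partial>count_space X) \<partial>M) < \<infinity>"
  using expectation_count_le[of "\<lambda>x. ennreal \<bar>f x\<bar>"] fin by (simp add: le_less_trans)

lemma AE_abs_sum_finite: "AE X in M. (\<integral>\<^sup>+x. ennreal \<bar>f x\<bar> \<partial>count_space X) < \<infinity>"
proof -
  have "(\<lambda>X. \<integral>\<^sup>+x. ennreal \<bar>f x\<bar> \<partial>count_space X) \<in> borel_measurable M"
    by (rule measurable_nn_integral_count_M) measurable
  moreover have "(\<integral>\<^sup>+X. (\<integral>\<^sup>+x. ennreal \<bar>f x\<bar> \<partial>count_space X) \<partial>M) \<noteq> \<infinity>"
    using expectation_abs_sum_finite by (rule less_imp_neq)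
  ultimately have "AE X in M. (\<integral>\<^sup>+x. ennreal \<bar>f x\<bar> \<partial>count_space X) \<noteq> \<infinity>"
    by (rule nn_integral_noteq_infinite)
  then show ?thesis by eventually_elim (simp add: less_top)
qed

lemma AE_summable: "AE X in M. f summable_on X"
  using AE_abs_sum_finite
  by eventually_elim (simp add: summable_on_iff_integrable_count_space integrable_iff_bounded)

definition abs_sum :: "real set \<Rightarrow> real" where
  "abs_sum X = enn2real (\<integral>\<^sup>+x. ennreal \<bar>f x\<bar> \<partial>count_space X)"

lemma integrable_abs_sum: "integrable M abs_sum"
proof (rule integrableI_bounded)
  show "abs_sum \<in> borel_measurable M"
    unfolding abs_sum_def[abs_def]
    by (intro borel_measurable_enn2real measurable_nn_integral_count_M) measurable
  have "(\<integral>\<^sup>+X. ennreal (norm (abs_sum X)) \<partial>M) \<le> (\<integral>\<^sup>+X. (\<integral>\<^sup>+x. ennreal \<bar>f x\<bar> \<partial>count_space X) \<partial>M)"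
    by (intro nn_integral_mono) (simp add: abs_sum_def ennreal_enn2real_if)
  then show "(\<integral>\<^sup>+X. ennreal (norm (abs_sum X)) \<partial>M) < \<infinity>"
    using expectation_abs_sum_finite by (rule le_less_trans)
qed

lemma infsum_le_abs_sum:
  assumes "(\<integral>\<^sup>+x. ennreal \<bar>f x\<bar> \<partial>count_space X) < \<infinity>"
  shows "\<bar>infsum f (X \<inter> B)\<bar> \<le> abs_sum X"
proof -
  have int: "integrable (count_space X) f" using assms by (simp add: integrable_iff_bounded)
  have int2: "integrable (count_space X) (\<lambda>x. indicator B x * f x)"
    using int by (rule Bochner_Integration.integrable_bound) (auto simp: indicator_def)
  have "\<bar>infsum f (X \<inter> B)\<bar> \<le> (\<integral>x. \<bar>indicator B x * f x\<bar> \<partial>count_space X)"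
    unfolding infsum_inter_eq_integral by (rule integral_abs_bound)
  also have "\<dots> \<le> (\<integral>x. \<bar>f x\<bar> \<partial>count_space X)"
    using int int2 by (intro integral_mono integrable_abs) (auto simp: indicator_def)
  also have "\<dots> = abs_sum X"
    unfolding abs_sum_def using int by (subst nn_integral_eq_integral) auto
  finally show ?thesis .
qed

lemma AE_infsum_le_abs_sum: "AE X in M. norm (infsum f (X \<inter> B)) \<le> abs_sum X"
  using AE_abs_sum_finite by eventually_elim (simp add: infsum_le_abs_sum)

lemma integrable_infsum_inter:
  assumes "B \<in> sets borel"
  shows "integrable M (\<lambda>X. infsum f (X \<inter> B))"
proof (rule Bochner_Integration.integrable_bound[OF integrable_abs_sum])
  show "AE X in M. norm (infsum f (X \<inter> B)) \<le> norm (abs_sum X)"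
    using AE_infsum_le_abs_sum[of B] by eventually_elim simp
qed (use assms in measurable)

lemma tendsto_expectation_infsum_side:
  "((\<lambda>\<delta>. \<integral>X. infsum f (X \<inter> {x. r * x > \<delta>}) \<partial>M) \<longlongrightarrow> (\<integral>X. infsum f (X \<inter> {x. r * x > 0}) \<partial>M)) (at_right 0)"
proof (rule integral_dominated_convergence_at_right[OF _ _ integrable_abs_sum])
  show "AE X in M. ((\<lambda>\<delta>. infsum f (X \<inter> {x. r * x > \<delta>})) \<longlongrightarrow> infsum f (X \<inter> {x. r * x > 0})) (at_right 0)"
    using AE_summable by eventually_elim (rule tendsto_infsum_side)
qed (use AE_infsum_le_abs_sum in measurable)

end

end

section \<open>Measurability of one-sided limits\<close>

text \<open>A function that is locally constant from the right takes all its values near 0 at rational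
  points, so that Cauchy's criterion over the rationals decides whether the limit exists.  Only
  countably many conditions remain.\<close>

lemma right_limit_iff_rational_Cauchy:
  fixes d :: "real \<Rightarrow> real"
  assumes rc: "\<And>\<delta>. \<delta> > 0 \<Longrightarrow> \<exists>\<eta>>\<delta>. \<forall>\<delta>'\<in>{\<delta>..<\<eta>}. d \<delta>' = d \<delta>"
  shows "(\<exists>L. (d \<longlongrightarrow> L) (at_right 0)) \<longleftrightarrow>
    (\<forall>k::nat. \<exists>m::nat. \<forall>q q'::rat. 0 < q \<and> q < 1 / of_nat (Suc m) \<and> 0 < q' \<and> q' < 1 / of_nat (Suc m) \<longrightarrow>
      \<bar>d (of_rat q) - d (of_rat q')\<bar> \<le> 1 / real (Suc k))" (is "_ \<longleftrightarrow> (\<forall>k. \<exists>m. ?Q k m)")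
proof
  assume "\<exists>L. (d \<longlongrightarrow> L) (at_right 0)"
  then obtain L where L: "(d \<longlongrightarrow> L) (at_right 0)" by blast
  show "\<forall>k. \<exists>m. ?Q k m"
  proof
    fix k
    have "\<forall>\<^sub>F \<delta> in at_right 0. dist (d \<delta>) L < 1 / (2 * real (Suc k))"
      using L by (rule tendstoD) simp
    then obtain b where b: "b > 0" "\<And>\<delta>. 0 < \<delta> \<Longrightarrow> \<delta> < b \<Longrightarrow> dist (d \<delta>) L < 1 / (2 * real (Suc k))"
      unfolding eventually_at_right_field by auto
    obtain m where m: "1 / real (Suc m) < b" using nat_approx_posE[OF b(1)] by blast
    have "?Q k m"
    proof (intro allI impI)
      fix q q' :: rat
      assume *: "0 < q \<and> q < 1 / of_nat (Suc m) \<and> 0 < q' \<and> q' < 1 / of_nat (Suc m)"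
      have close: "dist (d (of_rat p)) L < 1 / (2 * real (Suc k))" if "0 < p" "p < 1 / of_nat (Suc m)" for p :: rat
      proof (rule b(2))
        show "0 < (of_rat p :: real)" using that by simp
        have "(of_rat p :: real) < of_rat (1 / of_nat (Suc m))" using that by (simp only: of_rat_less)
        also have "\<dots> = 1 / real (Suc m)" by (simp add: of_rat_divide del: of_nat_Suc)
        finally show "(of_rat p :: real) < b" using m by simp
      qed
      have "\<bar>d (of_rat q) - d (of_rat q')\<bar> < 1 / (2 * real (Suc k)) + 1 / (2 * real (Suc k))"
        using close[of q] close[of q'] * by (simp add: dist_real_def)
      also have "\<dots> = 1 / real (Suc k)" by (simp add: field_simps)
      finally show "\<bar>d (of_rat q) - d (of_rat q')\<bar> \<le> 1 / real (Suc k)" by simp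
    qed
    then show "\<exists>m. ?Q k m" ..
  qed
next
  assume Q: "\<forall>k. \<exists>m. ?Q k m"
  have Qr: "\<exists>m. \<forall>\<delta> \<delta>'. 0 < \<delta> \<and> \<delta> < 1 / real (Suc m) \<and> 0 < \<delta>' \<and> \<delta>' < 1 / real (Suc m) \<longrightarrow> \<bar>d \<delta> - d \<delta>'\<bar> \<le> 1 / real (Suc k)" for k
  proof -
    obtain m where m: "?Q k m" using Q by blast
    have rat: "\<exists>q::rat. 0 < q \<and> q < 1 / of_nat (Suc m) \<and> d (of_rat q) = d \<delta>" if \<delta>: "0 < \<delta>" "\<delta> < 1 / real (Suc m)" for \<delta>
    proof -
      obtain \<eta> where \<eta>: "\<eta> > \<delta>" "\<forall>\<delta>'\<in>{\<delta>..<\<eta>}. d \<delta>' = d \<delta>" using rc[OF \<delta>(1)] by blast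
      obtain q where q: "\<delta> < of_rat q" "of_rat q < min \<eta> (1 / real (Suc m))"
        using of_rat_dense[of \<delta> "min \<eta> (1 / real (Suc m))"] \<delta> \<eta>(1) by auto
      have "(of_rat q :: real) < of_rat (1 / of_nat (Suc m))" using q by (simp add: of_rat_divide del: of_nat_Suc)
      then have "q < 1 / of_nat (Suc m)" by (simp only: of_rat_less)
      moreover have "0 < q" using q(1) \<delta>(1) by (metis less_trans zero_less_of_rat_iff)
      moreover have "of_rat q \<in> {\<delta>..<\<eta>}" using q by (simp add: less_imp_le)
      then have "d (of_rat q) = d \<delta>" using \<eta>(2) by blast
      ultimately show ?thesis by blast
    qed
    show ?thesis
    proof (intro exI[of _ m] allI impI)
      fix \<delta> \<delta>' assume *: "0 < \<delta> \<and> \<delta> < 1 / real (Suc m) \<and> 0 < \<delta>' \<and> \<delta>' < 1 / real (Suc m)"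
      then obtain q q' where "0 < q" "q < 1 / of_nat (Suc m)" "d (of_rat q) = d \<delta>"
        "0 < q'" "q' < 1 / of_nat (Suc m)" "d (of_rat q') = d \<delta>'" using rat[of \<delta>] rat[of \<delta>'] by blast
      then show "\<bar>d \<delta> - d \<delta>'\<bar> \<le> 1 / real (Suc k)" using m by metis
    qed
  qed
  \<comment> \<open>The shift by two keeps the point strictly below \<open>1 / (N + 1)\<close> for all \<open>n \<ge> N\<close>.\<close>
  define a where "a n = d (1 / real (Suc (Suc n)))" for n
  have a_close: "\<exists>N. \<forall>n\<ge>N. \<forall>\<delta>. 0 < \<delta> \<and> \<delta> < 1 / real (Suc N) \<longrightarrow> \<bar>d \<delta> - a n\<bar> \<le> 1 / real (Suc k)" for k
  proof -
    obtain m where m: "\<forall>\<delta> \<delta>'. 0 < \<delta> \<and> \<delta> < 1 / real (Suc m) \<and> 0 < \<delta>' \<and> \<delta>' < 1 / real (Suc m) \<longrightarrow> \<bar>d \<delta> - d \<delta>'\<bar> \<le> 1 / real (Suc k)"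
      using Qr by blast
    have "1 / real (Suc (Suc n)) < 1 / real (Suc m)" if "n \<ge> m" for n
      using that by (intro divide_strict_left_mono) auto
    then show ?thesis using m unfolding a_def by (intro exI[of _ m]) auto
  qed
  have "Cauchy a"
  proof (rule metric_CauchyI)
    fix e :: real assume "e > 0"
    then obtain k where k: "1 / real (Suc k) < e" using nat_approx_posE by blast
    obtain N where N: "\<forall>n\<ge>N. \<forall>\<delta>. 0 < \<delta> \<and> \<delta> < 1 / real (Suc N) \<longrightarrow> \<bar>d \<delta> - a n\<bar> \<le> 1 / real (Suc k)"
      using a_close by blast
    have "1 / real (Suc (Suc n)) < 1 / real (Suc N)" if "n \<ge> N" for n
      using that by (intro divide_strict_left_mono) auto
    then have "\<bar>a m - a n\<bar> \<le> 1 / real (Suc k)" if "m \<ge> N" "n \<ge> N" for m n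
      using N that unfolding a_def[of m] by simp
    then show "\<exists>N. \<forall>m\<ge>N. \<forall>n\<ge>N. dist (a m) (a n) < e" using k by (force simp: dist_real_def)
  qed
  then obtain L where L: "a \<longlonglongrightarrow> L" using Cauchy_convergent convergent_def by blast
  have "(d \<longlongrightarrow> L) (at_right 0)"
  proof (rule tendstoI)
    fix e :: real assume "e > 0"
    then obtain k where k: "1 / real (Suc k) < e" using nat_approx_posE by blast
    obtain N where N: "\<forall>n\<ge>N. \<forall>\<delta>. 0 < \<delta> \<and> \<delta> < 1 / real (Suc N) \<longrightarrow> \<bar>d \<delta> - a n\<bar> \<le> 1 / real (Suc k)"
      using a_close by blast
    have "dist (d \<delta>) L < e" if "0 < \<delta>" "\<delta> < 1 / real (Suc N)" for \<delta>
    proof -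
      have "(\<lambda>n. \<bar>d \<delta> - a n\<bar>) \<longlonglongrightarrow> \<bar>d \<delta> - L\<bar>" by (intro tendsto_intros L)
      then have "\<bar>d \<delta> - L\<bar> \<le> 1 / real (Suc k)"
        using N that by (intro LIMSEQ_le_const2[of _ _ "1 / real (Suc k)"]) auto
      then show ?thesis using k by (simp add: dist_real_def)
    qed
    then show "\<forall>\<^sub>F \<delta> in at_right 0. dist (d \<delta>) L < e"
      unfolding eventually_at_right_field by (intro exI[of _ "1 / real (Suc N)"]) auto
  qed
  then show "\<exists>L. (d \<longlongrightarrow> L) (at_right 0)" by blast
qed

text \<open>The set where the limit exists is measurable by the criterion above; on that set the limit is
  taken along the sequence \<open>1 / (n + 1)\<close>.\<close>

lemma borel_measurable_right_limit:
  fixes d :: "real \<Rightarrow> 'a \<Rightarrow> real"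
  assumes d[measurable]: "\<And>\<delta>. d \<delta> \<in> borel_measurable M"
    and rc: "\<And>X \<delta>. X \<in> space M \<Longrightarrow> \<delta> > 0 \<Longrightarrow> \<exists>\<eta>>\<delta>. \<forall>\<delta>'\<in>{\<delta>..<\<eta>}. d \<delta>' X = d \<delta> X"
  shows "(\<lambda>X. if \<exists>L. ((\<lambda>\<delta>. d \<delta> X) \<longlongrightarrow> L) (at_right 0) then Lim (at_right 0) (\<lambda>\<delta>. d \<delta> X) else c)
    \<in> borel_measurable M"
proof -
  define P where "P X \<longleftrightarrow> (\<forall>k::nat. \<exists>m::nat. \<forall>q q'::rat. 0 < q \<and> q < 1 / of_nat (Suc m) \<and> 0 < q' \<and> q' < 1 / of_nat (Suc m) \<longrightarrow>
      \<bar>d (of_rat q) X - d (of_rat q') X\<bar> \<le> 1 / real (Suc k))" for X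
  have P[measurable]: "Measurable.pred M P" unfolding P_def by measurable
  have "(\<lambda>X. if P X then lim (\<lambda>n. d (1 / real (Suc n)) X) else c) \<in> borel_measurable M" by measurable
  also have "?this \<longleftrightarrow> ?thesis"
  proof (rule measurable_cong)
    fix X assume X: "X \<in> space M"
    have PX: "P X \<longleftrightarrow> (\<exists>L. ((\<lambda>\<delta>. d \<delta> X) \<longlongrightarrow> L) (at_right 0))"
      unfolding P_def by (rule right_limit_iff_rational_Cauchy[symmetric]) (rule rc[OF X])
    have "lim (\<lambda>n. d (1 / real (Suc n)) X) = Lim (at_right 0) (\<lambda>\<delta>. d \<delta> X)" if L: "((\<lambda>\<delta>. d \<delta> X) \<longlongrightarrow> L) (at_right 0)" for L
    proof -
      have "(\<lambda>n. 1 / real (Suc n)) \<longlonglongrightarrow> 0" using LIMSEQ_inverse_real_of_nat by (simp add: inverse_eq_divide)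
      then have "(\<lambda>n. d (1 / real (Suc n)) X) \<longlonglongrightarrow> L"
        using L[unfolded tendsto_at_iff_sequentially comp_def, rule_format, of "\<lambda>n. 1 / real (Suc n)"] by simp
      then show ?thesis using L by (simp add: limI tendsto_Lim)
    qed
    then show "(if P X then lim (\<lambda>n. d (1 / real (Suc n)) X) else c) =
      (if \<exists>L. ((\<lambda>\<delta>. d \<delta> X) \<longlongrightarrow> L) (at_right 0) then Lim (at_right 0) (\<lambda>\<delta>. d \<delta> X) else c)"
      unfolding PX by auto
  qed
  finally show ?thesis .
qed

section \<open>Estimates for the logarithmic summand\<close>

definition log_ratio :: "real \<Rightarrow> real \<Rightarrow> real \<Rightarrow> real" where
  "log_ratio a b x = ln (\<bar>(x / a - 1) / (x / b - 1)\<bar>\<^sup>2)"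

lemma log_ratio_measurable [measurable]: "log_ratio a b \<in> borel_measurable borel"
  unfolding log_ratio_def by measurable

lemma log_ratio_side:
  assumes r: "r \<in> {1, - 1}" and a: "r * a > 0" and b: "r * b < 0" and x: "r * x > 0" and ne: "x \<noteq> a"
  shows "log_ratio a b x = 2 * ln \<bar>r * x / (r * a) - 1\<bar> - 2 * ln (1 + r * x / (- (r * b)))"
proof -
  have xa: "r * x / (r * a) = x / a" and xb: "r * x / (- (r * b)) = - (x / b)" using r by auto
  have "x / b < 0"
    using b x r by (auto simp: divide_less_0_iff mult_less_0_iff zero_less_mult_iff)
  then have p: "1 + r * x / (- (r * b)) > 0" and ab: "\<bar>x / b - 1\<bar> = 1 + r * x / (- (r * b))"
    unfolding xb by auto
  have "a \<noteq> 0" using a by auto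
  then have q: "\<bar>x / a - 1\<bar> > 0" using ne by (simp add: field_simps)
  have "log_ratio a b x = 2 * ln (\<bar>x / a - 1\<bar> / (1 + r * x / (- (r * b))))"
    unfolding log_ratio_def abs_divide ab using p q by (subst ln_realpow) auto
  also have "\<dots> = 2 * (ln \<bar>x / a - 1\<bar> - ln (1 + r * x / (- (r * b))))"
    using p q by (subst ln_div) auto
  finally show ?thesis unfolding xa by simp
qed

lemma log_ratio_self: "a \<noteq> 0 \<Longrightarrow> log_ratio a b a = 0"
  by (simp add: log_ratio_def)

text \<open>The summand on the half-line with sign \<open>r\<close>; there \<open>a\<close> is the point of the same sign as \<open>x\<close>,
  where the logarithm is singular, and \<open>b\<close> the point of the opposite sign.\<close>

definition side_log_ratio :: "real \<Rightarrow> real \<Rightarrow> real \<Rightarrow> real \<Rightarrow> real" where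
  "side_log_ratio r a b x = indicator {x. r * x > 0} x * log_ratio a b x"

lemma side_log_ratio_measurable [measurable]: "side_log_ratio r a b \<in> borel_measurable borel"
  unfolding side_log_ratio_def by measurable

text \<open>With \<open>A = |a|\<close>, \<open>B = |b|\<close> and \<open>t = |x|\<close> the summand is at most
  \<open>2 ln ((1 + t/A) / (1 + t/B))\<close>.  This is at most \<open>2 t / A\<close>, and also at most
  \<open>2 ln (1 + B/A)\<close>.  From above there is no singularity: at \<open>a\<close> the logarithm tends to
  minus infinity.\<close>

lemma side_log_ratio_le:
  assumes r: "r \<in> {1, - 1}" and a: "r * a > 0" and b: "r * b < 0"
  shows "side_log_ratio r a b x \<le> 2 * (1 - r * b) / (r * a) * side_weight r x"
proof -
  define A B t where "A = r * a" and "B = - (r * b)" and "t = r * x"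
  have A: "A > 0" and B: "B > 0" using a b by (simp_all add: A_def B_def)
  have Ceq: "2 * (1 - r * b) / (r * a) = 2 * (1 + B) / A" by (simp add: A_def B_def)
  have a0: "a \<noteq> 0" using a by auto
  have w: "side_weight r x \<ge> 0" by (simp add: side_weight_def)
  have C0: "2 * (1 + B) / A \<ge> 0" using A B by simp
  show ?thesis
  proof (cases "t > 0 \<and> x \<noteq> a")
    case False
    then have "side_log_ratio r a b x = 0"
      using log_ratio_self[OF a0, of b] by (auto simp: side_log_ratio_def t_def)
    then show ?thesis unfolding Ceq using mult_nonneg_nonneg[OF C0 w] by simp
  next
    case True
    then have t: "t > 0" and ne: "x \<noteq> a" by auto
    have eq: "side_log_ratio r a b x = 2 * ln \<bar>t / A - 1\<bar> - 2 * ln (1 + t / B)"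
      using log_ratio_side[OF r a b _ ne] t by (simp add: side_log_ratio_def A_def B_def t_def)
    have "a \<noteq> 0" "r \<noteq> 0" using a by auto
    then have "t / A \<noteq> 1" using ne unfolding t_def A_def by (simp add: field_simps)
    then have "ln \<bar>t / A - 1\<bar> \<le> ln (1 + t / A)"
      using t A by (subst ln_le_cancel_iff) (auto simp: abs_if add_pos_pos)
    then have le: "side_log_ratio r a b x \<le> 2 * (ln (1 + t / A) - ln (1 + t / B))" unfolding eq by simp
    have l0: "ln (1 + t / B) \<ge> 0" using t B by simp
    have double: "s \<le> 2 * q" if "s \<le> 2 * (l - m)" "l \<le> q + m" for s l m q :: real
      using that by argo
    show ?thesis
    proof (cases "t \<le> 1")
      case True
      have "ln (1 + t / A) \<le> t / A" using t A by (intro ln_add_one_self_le_self) auto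
      then have "ln (1 + t / A) \<le> t / A + ln (1 + t / B)" using l0 by (rule add_increasing2[rotated])
      with le have "side_log_ratio r a b x \<le> 2 * (t / A)" by (rule double)
      also have "\<dots> \<le> 2 * (1 + B) / A * t" using A B t by (simp add: field_simps)
      also have "t = side_weight r x" using True t by (simp add: side_weight_def t_def)
      finally show ?thesis unfolding Ceq .
    next
      case False
      have "1 + t / A \<le> (1 + B / A) * (1 + t / B)" using A B t by (simp add: field_simps)
      then have "ln (1 + t / A) \<le> ln ((1 + B / A) * (1 + t / B))"
        using A B t by (subst ln_le_cancel_iff) (auto intro!: add_pos_pos mult_pos_pos)
      also have "\<dots> = ln (1 + B / A) + ln (1 + t / B)"
        using A B t by (intro ln_mult_pos) (auto intro: add_pos_pos)
      also have "ln (1 + B / A) \<le> B / A" using A B by (intro ln_add_one_self_le_self) auto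
      finally have "ln (1 + t / A) \<le> B / A + ln (1 + t / B)" by simp
      with le have "side_log_ratio r a b x \<le> 2 * (B / A)" by (rule double)
      also have "\<dots> \<le> 2 * (1 + B) / A * 1" using A by (simp add: field_simps)
      also have "2 * (1 + B) / A * 1 = 2 * (1 + B) / A * side_weight r x" using False by (simp add: side_weight_def t_def)
      finally show ?thesis unfolding Ceq .
    qed
  qed
qed

text \<open>The majorants below are built from integrands of the Gamma function, also for the square-root
  singularities.\<close>

definition gamma_density :: "real \<Rightarrow> real \<Rightarrow> real \<Rightarrow> real" where
  "gamma_density A a t = indicator {0<..} t * (t powr (A - 1) * exp (- (a * t)))"

lemma gamma_density_nonneg: "gamma_density A a t \<ge> 0"
  by (simp add: gamma_density_def)

lemma integrable_gamma_density_affine: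
  assumes "A > 0" "a > 0" "c \<noteq> 0"
  shows "integrable lborel (\<lambda>x. gamma_density A a (s + c * x))"
  using lborel_integrable_real_affine[OF integrable_Gamma_weight[OF assms(1,2)] assms(3), of s]
  unfolding gamma_density_def .

lemma side_weight_decay_bound:
  assumes r: "r \<in> {1, - 1}"
  shows "side_weight r x * (\<bar>x\<bar> powr (- 3/2) * exp (- \<bar>x\<bar> / 2)) \<le> gamma_density (1/2) (1/2) (0 + r * x)"
proof (cases "r * x > 0")
  case True
  then have ax: "\<bar>x\<bar> = r * x" using r by auto
  have p: "r * x * (r * x) powr (- 3/2) = (r * x) powr (1/2 - 1)"
  proof -
    have "(r * x) powr (1/2 - 1) = (r * x) powr (1 + - 3/2)" by simp
    also have "\<dots> = (r * x) powr 1 * (r * x) powr (- 3/2)" by (rule powr_add)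
    finally show ?thesis using True by simp
  qed
  have "side_weight r x * (\<bar>x\<bar> powr (- 3/2) * exp (- \<bar>x\<bar> / 2)) \<le> (r * x) * ((r * x) powr (- 3/2) * exp (- (r * x) / 2))"
    unfolding ax using True by (intro mult_right_mono) (auto simp: side_weight_def)
  also have "\<dots> = gamma_density (1/2) (1/2) (0 + r * x)"
    using True p by (simp add: gamma_density_def mult.assoc[symmetric])
  finally show ?thesis .
next
  case False
  then have "side_weight r x = 0" by (simp add: side_weight_def max.absorb1)
  then show ?thesis by (simp add: gamma_density_nonneg)
qed

text \<open>The positive part, and the negative part on the left half of \<open>(0, A)\<close>, are at most linear
  in \<open>t\<close>; elsewhere the negative part is dominated by an inverse square root.\<close>

lemma abs_ln_le:
  fixes t A :: real
  assumes A: "A > 0" and t: "t > 0" "t \<noteq> A"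
  shows "\<bar>ln \<bar>t / A - 1\<bar>\<bar> \<le> 2 * t / A + indicator {A/2<..} t * (2 * \<bar>t / A - 1\<bar> powr (- 1/2))"
proof -
  define y where "y = \<bar>t / A - 1\<bar>"
  have y: "y > 0" using assms by (auto simp: y_def)
  have "y \<le> 1 + t / A" using assms by (auto simp: y_def abs_if)
  then have "ln y \<le> ln (1 + t / A)" using y by simp
  also have "\<dots> \<le> t / A" using assms by (intro ln_add_one_self_le_self) auto
  finally have up: "ln y \<le> 2 * t / A" using assms by (simp add: field_simps)
  have p0: "0 \<le> 2 * y powr (- 1/2)" by simp
  have t0: "0 \<le> 2 * t / A" using assms by simp
  show ?thesis
  proof (cases "t > A / 2")
    case True
    have "- (1/2) * ln y = ln (y powr (- 1/2))" using y by (simp add: ln_powr)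
    also have "\<dots> \<le> y powr (- 1/2)" using y by (intro less_imp_le ln_less_self) simp
    finally have "- ln y \<le> 2 * y powr (- 1/2)" by simp
    then have "\<bar>ln y\<bar> \<le> 2 * t / A + 2 * y powr (- 1/2)"
      using up p0 t0 by (intro abs_leI add_increasing add_increasing2)
    then show ?thesis using True by (simp add: y_def)
  next
    case False
    define s where "s = t / A"
    have s: "0 \<le> s" "s \<le> 1/2" using False assms by (simp_all add: s_def field_simps)
    have "- ln (1 - s) \<le> 2 * s"
    proof -
      have "- s - 2 * s\<^sup>2 \<le> ln (1 - s)" using s by (intro ln_one_minus_pos_lower_bound) auto
      moreover have "2 * s\<^sup>2 \<le> s" using s mult_right_mono[of "2 * s" 1 s] by (simp add: power2_eq_square)
      ultimately show ?thesis by linarith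
    qed
    moreover have "y = 1 - s" using s unfolding y_def s_def[symmetric] by (simp add: abs_if)
    ultimately have "- ln y \<le> 2 * t / A" by (simp add: s_def)
    then have "\<bar>ln y\<bar> \<le> 2 * t / A" using up by (intro abs_leI)
    then show ?thesis using False by (simp add: y_def)
  qed
qed

lemma abs_powr_exp_le_gamma_density:
  fixes s t :: real
  assumes "t > 0"
  shows "\<bar>s\<bar> powr (- 1/2) * exp (- t / 2) \<le>
    exp 1 * (gamma_density (1/2) 1 s + gamma_density (1/2) 1 (- s)) + gamma_density 1 (1/2) t"
proof -
  have g: "gamma_density 1 (1/2) t = exp (- t / 2)" using assms by (simp add: gamma_density_def)
  have nn: "gamma_density (1/2) 1 s \<ge> 0" "gamma_density (1/2) 1 (- s) \<ge> 0" by (simp_all add: gamma_density_nonneg)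
  show ?thesis
  proof (cases "\<bar>s\<bar> < 1")
    case False
    have "\<bar>s\<bar> powr (- 1/2) \<le> \<bar>s\<bar> powr 0" using False by (intro powr_mono) auto
    also have "\<dots> = 1" using False by auto
    finally have "\<bar>s\<bar> powr (- 1/2) * exp (- t / 2) \<le> 1 * exp (- t / 2)" by (intro mult_right_mono) auto
    moreover have "0 \<le> exp 1 * (gamma_density (1/2) 1 s + gamma_density (1/2) 1 (- s))" using nn by simp
    ultimately show ?thesis unfolding g by linarith
  next
    case True
    have e: "gamma_density (1/2) 1 s + gamma_density (1/2) 1 (- s) = \<bar>s\<bar> powr (- 1/2) * exp (- \<bar>s\<bar>)"
    proof -
      have "(1/2 - 1 :: real) = - 1/2" by simp
      then show ?thesis by (cases "s > 0"; cases "s < 0") (simp_all add: gamma_density_def)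
    qed
    have "1 \<le> exp 1 * exp (- \<bar>s\<bar>)" using True by (simp add: exp_add[symmetric])
    then have "\<bar>s\<bar> powr (- 1/2) * 1 \<le> \<bar>s\<bar> powr (- 1/2) * (exp 1 * exp (- \<bar>s\<bar>))" by (intro mult_left_mono) auto
    moreover have "\<bar>s\<bar> powr (- 1/2) * exp (- t / 2) \<le> \<bar>s\<bar> powr (- 1/2) * 1" using assms by (intro mult_left_mono) auto
    ultimately show ?thesis unfolding e g by (simp add: mult_ac) (smt (verit) exp_ge_zero)
  qed
qed

text \<open>With \<open>t = |x|\<close> the summand is at most a multiple of \<open>t\<close> plus an inverse square root singularity
  at distance at least \<open>A/2\<close> from the origin, where the negative power of \<open>t\<close> is bounded.\<close>

lemma integrable_side_log_ratio_decay:
  assumes r: "r \<in> {1, - 1}" and a: "r * a > 0" and b: "r * b < 0"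
  shows "integrable lborel (\<lambda>x. \<bar>side_log_ratio r a b x\<bar> * (\<bar>x\<bar> powr (- 3/2) * exp (- \<bar>x\<bar> / 2)))"
proof -
  define A B where "A = r * a" and "B = - (r * b)"
  have A: "A > 0" and B: "B > 0" using a b by (simp_all add: A_def B_def)
  have r0: "r \<noteq> 0" and a0: "a \<noteq> 0" using r a by auto
  define c where "c = 4 * (A / 2) powr (- 3/2)"
  define W where "W x = (4 / A + 2 / B) * gamma_density (1/2) (1/2) (0 + r * x) +
     c * (exp 1 * (gamma_density (1/2) 1 (- 1 + r / A * x) + gamma_density (1/2) 1 (1 + (- r / A) * x)) + gamma_density 1 (1/2) (0 + r * x))" for x
  have c0: "c \<ge> 0" by (simp add: c_def)
  have int_W: "integrable lborel W"
    unfolding W_def using r0 A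
    by (intro Bochner_Integration.integrable_add integrable_mult_right integrable_gamma_density_affine) auto
  have le_W: "norm (\<bar>side_log_ratio r a b x\<bar> * (\<bar>x\<bar> powr (- 3/2) * exp (- \<bar>x\<bar> / 2))) \<le> norm (W x)" for x
  proof -
    have W0: "0 \<le> W x" unfolding W_def using A B c0
      by (intro add_nonneg_nonneg mult_nonneg_nonneg) (auto simp: gamma_density_nonneg)
    have "\<bar>side_log_ratio r a b x\<bar> * (\<bar>x\<bar> powr (- 3/2) * exp (- \<bar>x\<bar> / 2)) \<le> W x"
    proof (cases "r * x > 0 \<and> x \<noteq> a")
      case False
      then have "side_log_ratio r a b x = 0"
        using log_ratio_self[OF a0, of b] by (auto simp: side_log_ratio_def)
      then show ?thesis using W0 by simp
    next
      case True
      define t where "t = r * x"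
      have t: "t > 0" using True by (simp add: t_def)
      have ax: "\<bar>x\<bar> = t" using r t by (auto simp: t_def)
      have tA: "t \<noteq> A" using True r0 by (simp add: t_def A_def)
      have eq: "side_log_ratio r a b x = 2 * ln \<bar>t / A - 1\<bar> - 2 * ln (1 + t / B)"
        using log_ratio_side[OF r a b] True by (simp add: side_log_ratio_def A_def B_def t_def)
      have lB: "ln (1 + t / B) \<le> t / B" "0 \<le> ln (1 + t / B)" using t B by (auto intro: ln_add_one_self_le_self)
      have "\<bar>side_log_ratio r a b x\<bar> \<le> 2 * \<bar>ln \<bar>t / A - 1\<bar>\<bar> + 2 * (t / B)"
        unfolding eq using lB by linarith
      also have "\<dots> \<le> 2 * (2 * t / A + indicator {A/2<..} t * (2 * \<bar>t / A - 1\<bar> powr (- 1/2))) + 2 * (t / B)"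
        by (intro add_right_mono mult_left_mono abs_ln_le[OF A t tA]) simp
      also have "\<dots> = (4 / A + 2 / B) * t + indicator {A/2<..} t * (4 * \<bar>t / A - 1\<bar> powr (- 1/2))"
        by (simp add: algebra_simps)
      finally have "\<bar>side_log_ratio r a b x\<bar> * (t powr (- 3/2) * exp (- t / 2)) \<le>
          ((4 / A + 2 / B) * t + indicator {A/2<..} t * (4 * \<bar>t / A - 1\<bar> powr (- 1/2))) * (t powr (- 3/2) * exp (- t / 2))"
        by (intro mult_right_mono) auto
      also have "\<dots> = (4 / A + 2 / B) * (t * t powr (- 3/2) * exp (- t / 2)) +
          4 * (indicator {A/2<..} t * t powr (- 3/2)) * (\<bar>t / A - 1\<bar> powr (- 1/2) * exp (- t / 2))"
        by (simp add: algebra_simps)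
      also have "\<dots> \<le> (4 / A + 2 / B) * gamma_density (1/2) (1/2) t + c *
          (exp 1 * (gamma_density (1/2) 1 (t / A - 1) + gamma_density (1/2) 1 (- (t / A - 1))) + gamma_density 1 (1/2) t)"
      proof (intro add_mono mult_mono)
        have "t powr (1/2 - 1) = t powr (1 + - 3/2)" by simp
        also have "\<dots> = t powr 1 * t powr (- 3/2)" by (rule powr_add)
        finally show "t * t powr (- 3/2) * exp (- t / 2) \<le> gamma_density (1/2) (1/2) t"
          using t by (simp add: gamma_density_def)
        show "4 * (indicator {A/2<..} t * t powr (- 3/2)) \<le> c"
          unfolding c_def using A t by (auto simp: indicator_def intro!: powr_mono2')
        show "\<bar>t / A - 1\<bar> powr (- 1/2) * exp (- t / 2) \<le>
          exp 1 * (gamma_density (1/2) 1 (t / A - 1) + gamma_density (1/2) 1 (- (t / A - 1))) + gamma_density 1 (1/2) t"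
          by (rule abs_powr_exp_le_gamma_density[OF t])
      qed (use A B c0 t in auto)
      also have "\<dots> = W x" unfolding W_def t_def by (simp add: algebra_simps)
      finally show ?thesis unfolding ax .
    qed
    then show ?thesis using W0 by simp
  qed
  show ?thesis
  proof (rule Bochner_Integration.integrable_bound[OF int_W])
    show "AE x in lborel. norm (\<bar>side_log_ratio r a b x\<bar> * (\<bar>x\<bar> powr (- 3/2) * exp (- \<bar>x\<bar> / 2))) \<le> norm (W x)"
      by (intro AE_I2 le_W)
  qed measurable
qed

section \<open>The regularised additive functional\<close>

text \<open>Only finitely many points of the configuration have absolute value between \<open>\<delta>\<close> and
  \<open>\<delta> + 1\<close>; take for \<open>\<eta>\<close> the smallest such absolute value above \<open>\<delta>\<close>.\<close>

lemma Conf_locally_constant_from_right: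
  assumes X: "X \<in> Conf" and \<delta>: "\<delta> > 0"
  obtains \<eta> where "\<eta> > \<delta>"
    "\<And>\<delta>' r. \<delta>' \<in> {\<delta>..<\<eta>} \<Longrightarrow> r \<in> {1, - 1} \<Longrightarrow> X \<inter> {x. r * x > \<delta>'} = X \<inter> {x. r * x > \<delta>}"
proof -
  define S where "S = {- (\<delta> + 1)..- \<delta>} \<union> {\<delta>..\<delta> + 1}"
  have S_eq: "S = {x. \<delta> \<le> \<bar>x\<bar> \<and> \<bar>x\<bar> \<le> \<delta> + 1}" using \<delta> by (auto simp: S_def abs_if)
  have "compact S" "S \<subseteq> - {0}" using \<delta> by (auto simp: S_def intro: compact_Un)
  then have fin: "finite (X \<inter> S)" using X unfolding Conf_def by blast
  \<comment> \<open>The element \<open>\<delta> + 1\<close> keeps the minimum below meaningful when no point lies in the range.\<close>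
  define Z where "Z = insert (\<delta> + 1) {z \<in> abs ` (X \<inter> S). z > \<delta>}"
  have Z: "finite Z" "Z \<noteq> {}" "\<And>z. z \<in> Z \<Longrightarrow> z > \<delta>" using fin by (auto simp: Z_def)
  show thesis
  proof
    show "Min Z > \<delta>" using Z by (simp add: Min_gr_iff)
    fix \<delta>' r :: real assume \<delta>': "\<delta>' \<in> {\<delta>..<Min Z}" and r: "r \<in> {1, - 1}"
    have "r * x > \<delta>'" if x: "x \<in> X" "r * x > \<delta>" for x
    proof (rule ccontr)
      assume n: "\<not> r * x > \<delta>'"
      have rx: "r * x > 0" using \<delta> x(2) by (rule less_trans)
      have "r * x = x \<or> r * x = - x" using r by fastforce
      then have ax: "\<bar>x\<bar> = r * x" using rx by (metis abs_minus_cancel abs_of_pos)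
      have "\<delta> + 1 \<in> Z" by (simp add: Z_def)
      with Z(1) have "Min Z \<le> \<delta> + 1" by (rule Min_le)
      moreover have "r * x < Min Z" using n \<delta>' by simp
      ultimately have "x \<in> S" using x(2) unfolding S_eq by (simp add: ax)
      then have "r * x \<in> abs ` (X \<inter> S)" using x(1) ax by (metis IntI imageI)
      then have "r * x \<in> Z" using x(2) by (simp add: Z_def)
      then have "Min Z \<le> r * x" using Z(1) by (intro Min_le)
      then show False using n \<delta>' by auto
    qed
    then show "X \<inter> {x. r * x > \<delta>'} = X \<inter> {x. r * x > \<delta>}"
      using \<delta>' by (auto intro: le_less_trans)
  qed
qed

text \<open>The value of \<open>Lim\<close> for a function without limit depends on nothing but the type.  Hence the
  functional in the statement is constant on the null set where the limit does not exist, and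
  it is measurable as it stands.\<close>

lemma Lim_not_convergent:
  fixes f :: "'a \<Rightarrow> 'b::t2_space"
  assumes "\<nexists>L. (f \<longlongrightarrow> L) F"
  shows "Lim F f = (THE l. False)"
proof -
  have eq: "(\<lambda>l. (f \<longlongrightarrow> l) F) = (\<lambda>l. False)" using assms by auto
  show ?thesis unfolding t2_space_class.Lim_def eq ..
qed

lemma D_trunc_eq_side_sums:
  assumes "\<delta> \<ge> 0"
  shows "D_trunc n pp pm \<delta> X = (\<Sum>i=1..n. infsum (side_log_ratio 1 (pp i) (pm i)) (X \<inter> {x. 1 * x > \<delta>}) +
     infsum (side_log_ratio (- 1) (pm i) (pp i)) (X \<inter> {x. - 1 * x > \<delta>}))"
proof -
  have sets: "{\<delta><..} = {x. 1 * x > \<delta>}" "{..<- \<delta>} = {x. - 1 * x > \<delta>}" by auto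
  have pos: "infsum (log_ratio a b) (X \<inter> {\<delta><..}) = infsum (side_log_ratio 1 a b) (X \<inter> {x. 1 * x > \<delta>})" for a b
    unfolding sets using assms by (intro infsum_cong) (simp add: side_log_ratio_def)
  have neg: "infsum (log_ratio a b) (X \<inter> {..<- \<delta>}) = infsum (side_log_ratio (- 1) a b) (X \<inter> {x. - 1 * x > \<delta>})" for a b
    unfolding sets using assms by (intro infsum_cong) (simp add: side_log_ratio_def)
  show ?thesis unfolding D_trunc_def log_ratio_def[symmetric] pos neg ..
qed

context dominated_determinantal
begin

text \<open>Almost surely all sums converge absolutely, so the truncated sums and their expectations both
  converge as \<open>\<delta>\<close> tends to 0, and the centred limit is the full sum minus its expectation \<open>e\<close>.  The
  full sum is at most \<open>C (p + q)\<close>, where \<open>p\<close> and \<open>q\<close> are the sums of \<open>min |x| 1\<close> over the two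
  half-lines.  As exponential moments are known for each half-line separately, the exponential
  of \<open>C (p + q)\<close> is split by \<open>x y \<le> x\<^sup>2 + y\<^sup>2\<close>.\<close>

lemma regularised_functional:
  fixes n :: nat and pp pm :: "nat \<Rightarrow> real"
  assumes pp: "\<And>i. i \<in> {1..n} \<Longrightarrow> pp i > 0" and pm: "\<And>i. i \<in> {1..n} \<Longrightarrow> pm i < 0"
    and log_fin: "\<And>r a b. r \<in> {1, - 1} \<Longrightarrow> r * a > 0 \<Longrightarrow> r * b < 0 \<Longrightarrow>
      (\<integral>\<^sup>+x. ennreal \<bar>side_log_ratio r a b x\<bar> \<partial>intensity) < \<infinity>"
    and side_fin: "\<And>r. r \<in> {1, - 1} \<Longrightarrow> (\<integral>\<^sup>+x. ennreal (side_weight r x) \<partial>intensity) < \<infinity>"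
  shows "\<forall>\<delta>>0. integrable M (D_trunc n pp pm \<delta>)"
    and "AE X in M. \<exists>L. (D_centred M n pp pm X \<longlongrightarrow> L) (at_right 0)"
    and "integrable M (\<lambda>X. exp (S_bar M n pp pm X))"
proof -
  define f where "f = (\<lambda>i. side_log_ratio 1 (pp i) (pm i))"
  define g where "g = (\<lambda>i. side_log_ratio (- 1) (pm i) (pp i))"
  define d where "d \<delta> X = (\<Sum>i=1..n. infsum (f i) (X \<inter> {x. 1 * x > \<delta>}) + infsum (g i) (X \<inter> {x. - 1 * x > \<delta>}))" for \<delta> X
  have D_eq: "D_trunc n pp pm \<delta> X = d \<delta> X" if "\<delta> \<ge> 0" for \<delta> X
    unfolding d_def f_def g_def by (rule D_trunc_eq_side_sums[OF that])
  have meas[measurable]: "f i \<in> borel_measurable borel" "g i \<in> borel_measurable borel" for i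
    unfolding f_def g_def by measurable
  have fin: "(\<integral>\<^sup>+x. ennreal \<bar>f i x\<bar> \<partial>intensity) < \<infinity>" "(\<integral>\<^sup>+x. ennreal \<bar>g i x\<bar> \<partial>intensity) < \<infinity>"
    if "i \<in> {1..n}" for i
    unfolding f_def g_def using log_fin[of 1 "pp i" "pm i"] log_fin[of "- 1" "pm i" "pp i"] pp[OF that] pm[OF that]
    by simp_all
  have int_d: "integrable M (d \<delta>)" for \<delta>
    unfolding d_def[abs_def]
    by (intro Bochner_Integration.integrable_sum Bochner_Integration.integrable_add integrable_infsum_inter fin meas side_set_borel)
  show "\<forall>\<delta>>0. integrable M (D_trunc n pp pm \<delta>)"
  proof (intro allI impI)
    fix \<delta> :: real assume "\<delta> > 0"
    then have "D_trunc n pp pm \<delta> = d \<delta>" by (intro ext D_eq) simp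
    then show "integrable M (D_trunc n pp pm \<delta>)" using int_d by simp
  qed
  define e where "e = (\<integral>X. d 0 X \<partial>M)"
  have "((\<lambda>\<delta>. \<integral>X. d \<delta> X \<partial>M) \<longlongrightarrow> e) (at_right 0)"
  proof -
    have eq: "(\<integral>X. d \<delta> X \<partial>M) = (\<Sum>i=1..n. (\<integral>X. infsum (f i) (X \<inter> {x. 1 * x > \<delta>}) \<partial>M) + (\<integral>X. infsum (g i) (X \<inter> {x. - 1 * x > \<delta>}) \<partial>M))" for \<delta>
    proof -
      have "(\<integral>X. d \<delta> X \<partial>M) = (\<Sum>i=1..n. \<integral>X. infsum (f i) (X \<inter> {x. 1 * x > \<delta>}) + infsum (g i) (X \<inter> {x. - 1 * x > \<delta>}) \<partial>M)"
        unfolding d_def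
        by (intro Bochner_Integration.integral_sum Bochner_Integration.integrable_add integrable_infsum_inter fin meas side_set_borel)
      also have "\<dots> = (\<Sum>i=1..n. (\<integral>X. infsum (f i) (X \<inter> {x. 1 * x > \<delta>}) \<partial>M) + (\<integral>X. infsum (g i) (X \<inter> {x. - 1 * x > \<delta>}) \<partial>M))"
        by (intro sum.cong refl Bochner_Integration.integral_add integrable_infsum_inter fin meas side_set_borel)
      finally show ?thesis .
    qed
    show ?thesis
      unfolding e_def eq by (intro tendsto_sum tendsto_add tendsto_expectation_infsum_side fin meas)
  qed
  moreover have pos: "\<forall>\<^sub>F \<delta> in at_right 0. \<delta> > (0::real)" by (rule eventually_at_right_less)
  ultimately have lim_E: "((\<lambda>\<delta>. \<integral>X. D_trunc n pp pm \<delta> X \<partial>M) \<longlongrightarrow> e) (at_right 0)"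
    by (elim tendsto_cong[THEN iffD1, rotated] eventually_mono) (simp add: D_eq)
  have centred_iff: "(D_centred M n pp pm X \<longlongrightarrow> L) (at_right 0) \<longleftrightarrow> ((\<lambda>\<delta>. d \<delta> X) \<longlongrightarrow> L + e) (at_right 0)" for X L
  proof
    assume "(D_centred M n pp pm X \<longlongrightarrow> L) (at_right 0)"
    then have "((\<lambda>\<delta>. D_centred M n pp pm X \<delta> + (\<integral>X. D_trunc n pp pm \<delta> X \<partial>M)) \<longlongrightarrow> L + e) (at_right 0)"
      by (intro tendsto_add lim_E)
    then show "((\<lambda>\<delta>. d \<delta> X) \<longlongrightarrow> L + e) (at_right 0)"
      by (rule tendsto_cong[THEN iffD1, rotated]) (use pos in eventually_elim, simp add: D_centred_def D_eq)
  next
    assume "((\<lambda>\<delta>. d \<delta> X) \<longlongrightarrow> L + e) (at_right 0)"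
    then have "((\<lambda>\<delta>. d \<delta> X - (\<integral>X. D_trunc n pp pm \<delta> X \<partial>M)) \<longlongrightarrow> L + e - e) (at_right 0)"
      by (intro tendsto_diff lim_E)
    then have "((\<lambda>\<delta>. d \<delta> X - (\<integral>X. D_trunc n pp pm \<delta> X \<partial>M)) \<longlongrightarrow> L) (at_right 0)" by simp
    then show "(D_centred M n pp pm X \<longlongrightarrow> L) (at_right 0)"
      by (rule tendsto_cong[THEN iffD1, rotated]) (use pos in eventually_elim, simp add: D_centred_def D_eq)
  qed
  have "AE X in M. \<forall>i\<in>{1..n}. f i summable_on X \<and> g i summable_on X"
    by (intro AE_finite_allI AE_conjI AE_summable fin meas) auto
  then have AE_lim: "AE X in M. ((\<lambda>\<delta>. d \<delta> X) \<longlongrightarrow> d 0 X) (at_right 0)"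
    unfolding d_def by eventually_elim (intro tendsto_sum tendsto_add tendsto_infsum_side; blast)
  show "AE X in M. \<exists>L. (D_centred M n pp pm X \<longlongrightarrow> L) (at_right 0)"
    using AE_lim
  proof eventually_elim
    case (elim X)
    then have "(D_centred M n pp pm X \<longlongrightarrow> d 0 X - e) (at_right 0)" by (simp add: centred_iff)
    then show ?case ..
  qed
  have S_bar_eq: "S_bar M n pp pm X = (if \<exists>L. ((\<lambda>\<delta>. d \<delta> X) \<longlongrightarrow> L) (at_right 0)
      then Lim (at_right 0) (\<lambda>\<delta>. d \<delta> X) else (THE l. False) + e) - e" for X
  proof (cases "\<exists>L. ((\<lambda>\<delta>. d \<delta> X) \<longlongrightarrow> L) (at_right 0)")
    case True
    then obtain L where L: "((\<lambda>\<delta>. d \<delta> X) \<longlongrightarrow> L) (at_right 0)" by blast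
    then have "(D_centred M n pp pm X \<longlongrightarrow> L - e) (at_right 0)" by (simp add: centred_iff)
    then have "S_bar M n pp pm X = L - e" unfolding S_bar_def by (intro tendsto_Lim) auto
    moreover have "Lim (at_right 0) (\<lambda>\<delta>. d \<delta> X) = L" using L by (intro tendsto_Lim) auto
    ultimately show ?thesis using True by simp
  next
    case False
    then have "\<nexists>L. (D_centred M n pp pm X \<longlongrightarrow> L) (at_right 0)" using centred_iff by blast
    then have "S_bar M n pp pm X = (THE l. False)" unfolding S_bar_def by (rule Lim_not_convergent)
    then show ?thesis using False by simp
  qed
  have S_bar_meas: "S_bar M n pp pm \<in> borel_measurable M"
    unfolding S_bar_eq[abs_def]
  proof (intro borel_measurable_diff borel_measurable_const borel_measurable_right_limit)
    show "d \<delta> \<in> borel_measurable M" for \<delta> using int_d by (rule borel_measurable_integrable)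
    fix X and \<delta> :: real assume "X \<in> space M" "\<delta> > 0"
    then obtain \<eta> where \<eta>: "\<eta> > \<delta>"
      "\<And>\<delta>' r. \<delta>' \<in> {\<delta>..<\<eta>} \<Longrightarrow> r \<in> {1, - 1} \<Longrightarrow> X \<inter> {x. r * x > \<delta>'} = X \<inter> {x. r * x > \<delta>}"
      using Conf_locally_constant_from_right[of X \<delta>] by auto
    have "d \<delta>' X = d \<delta> X" if "\<delta>' \<in> {\<delta>..<\<eta>}" for \<delta>'
      unfolding d_def using \<eta>(2)[OF that, of 1] \<eta>(2)[OF that, of "- 1"] by simp
    then show "\<exists>\<eta>>\<delta>. \<forall>\<delta>'\<in>{\<delta>..<\<eta>}. d \<delta>' X = d \<delta> X" using \<eta>(1) by blast
  qed
  define Cf where "Cf i = 2 * (1 - 1 * pm i) / (1 * pp i)" for i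
  define Cg where "Cg i = 2 * (1 - (- 1) * pp i) / ((- 1) * pm i)" for i
  define C where "C = (\<Sum>i=1..n. Cf i + Cg i)"
  have Cnn: "Cf i \<ge> 0" "Cg i \<ge> 0" if "i \<in> {1..n}" for i
    unfolding Cf_def Cg_def using pp[OF that] pm[OF that] by (auto intro!: divide_nonneg_pos divide_nonneg_neg)
  have C: "C \<ge> 0" unfolding C_def by (intro sum_nonneg add_nonneg_nonneg Cnn)
  have AE_side: "AE X in M. side_sum r X < \<infinity>" if "r \<in> {1, - 1}" for r
    using AE_abs_sum_finite[of "side_weight r"] side_fin[OF that]
    by (simp add: side_sum_def side_weight_def)
  have sum_le: "infsum h (X \<inter> {x. r * x > 0}) \<le> c * enn2real (side_sum r X)"
    if h: "h summable_on X" "\<And>x. h x \<le> c * side_weight r x" "c \<ge> 0" and s: "side_sum r X < \<infinity>" for h c r X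
  proof -
    have w0: "side_weight r x \<ge> 0" for x by (simp add: side_weight_def)
    have inth: "integrable (count_space X) h" using h(1) by (simp add: summable_on_iff_integrable_count_space)
    have intw: "integrable (count_space X) (side_weight r)"
      using s w0 by (intro integrableI_bounded) (auto simp: side_sum_def)
    have "infsum h (X \<inter> {x. r * x > 0}) = (\<integral>x. indicator {x. r * x > 0} x * h x \<partial>count_space X)"
      by (rule infsum_inter_eq_integral)
    also have "\<dots> \<le> (\<integral>x. c * side_weight r x \<partial>count_space X)"
    proof (rule integral_mono)
      show "integrable (count_space X) (\<lambda>x. indicator {x. r * x > 0} x * h x)"
        using inth by (rule Bochner_Integration.integrable_bound) (auto simp: indicator_def)
      show "indicator {x. r * x > 0} x * h x \<le> c * side_weight r x" for x
        using h(2)[of x] h(3) w0[of x] by (auto simp: indicator_def)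
    qed (use intw in auto)
    also have "\<dots> = c * (\<integral>x. side_weight r x \<partial>count_space X)" by simp
    also have "(\<integral>x. side_weight r x \<partial>count_space X) = enn2real (side_sum r X)"
      unfolding side_sum_def using intw w0 by (subst nn_integral_eq_integral) auto
    finally show ?thesis .
  qed
  \<comment> \<open>The value 0 where the sum diverges matters only on a null set.\<close>
  define Z where "Z r X = (if side_sum r X < \<infinity> then ennreal (exp (2 * C * enn2real (side_sum r X))) else 0)" for r X
  have Z_fin: "(\<integral>\<^sup>+X. Z r X \<partial>M) < \<infinity>" if "r \<in> {1, - 1}" for r
    unfolding Z_def using C by (intro exponential_moment[OF that _ side_fin[OF that]]) simp
  have Z_meas: "Z r \<in> borel_measurable M" for r
  proof -
    have "side_sum r \<in> borel_measurable M"
      using side_sum_measurable measurable_cong_sets[OF sets_M refl] by blast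
    then show ?thesis unfolding Z_def[abs_def] by measurable
  qed
  have "AE X in M. ennreal (norm (exp (S_bar M n pp pm X))) \<le> ennreal (exp (- e)) * (Z 1 X + Z (- 1) X)"
    using AE_lim \<open>AE X in M. \<forall>i\<in>{1..n}. f i summable_on X \<and> g i summable_on X\<close> AE_side[of 1, simplified] AE_side[of "- 1", simplified]
  proof eventually_elim
    case (elim X)
    define p q where "p = enn2real (side_sum 1 X)" and "q = enn2real (side_sum (- 1) X)"
    have pq: "p \<ge> 0" "q \<ge> 0" by (simp_all add: p_def q_def)
    have "(D_centred M n pp pm X \<longlongrightarrow> d 0 X - e) (at_right 0)" using elim by (simp add: centred_iff)
    then have S: "S_bar M n pp pm X = d 0 X - e" unfolding S_bar_def by (intro tendsto_Lim) auto
    have "d 0 X \<le> (\<Sum>i=1..n. Cf i * p + Cg i * q)"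
      unfolding d_def
    proof (intro sum_mono add_mono)
      fix i assume i: "i \<in> {1..n}"
      show "infsum (f i) (X \<inter> {x. 1 * x > 0}) \<le> Cf i * p"
        unfolding p_def
      proof (rule sum_le)
        show "f i x \<le> Cf i * side_weight 1 x" for x
          unfolding f_def Cf_def using pp[OF i] pm[OF i] by (intro side_log_ratio_le) auto
      qed (use elim i Cnn in auto)
      show "infsum (g i) (X \<inter> {x. - 1 * x > 0}) \<le> Cg i * q"
        unfolding q_def
      proof (rule sum_le)
        show "g i x \<le> Cg i * side_weight (- 1) x" for x
          unfolding g_def Cg_def using pp[OF i] pm[OF i] by (intro side_log_ratio_le) auto
      qed (use elim i Cnn in auto)
    qed
    also have "\<dots> \<le> (\<Sum>i=1..n. (Cf i + Cg i) * (p + q))"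
      using Cnn pq by (intro sum_mono) (simp add: algebra_simps)
    also have "\<dots> = C * (p + q)" unfolding C_def by (rule sum_distrib_right[symmetric])
    finally have "exp (S_bar M n pp pm X) \<le> exp (C * (p + q) - e)" unfolding S by simp
    also have "\<dots> = exp (- e) * (exp (C * p) * exp (C * q))"
      by (simp add: exp_add[symmetric] algebra_simps)
    also have "\<dots> \<le> exp (- e) * (exp (2 * C * p) + exp (2 * C * q))"
    proof (rule mult_left_mono)
      have "exp (C * p) * exp (C * q) \<le> (exp (C * p))\<^sup>2 + (exp (C * q))\<^sup>2"
        using sum_squares_bound[of "exp (C * p)" "exp (C * q)"] mult_nonneg_nonneg[OF exp_ge_zero[of "C * p"] exp_ge_zero[of "C * q"]]
        by linarith
      then show "exp (C * p) * exp (C * q) \<le> exp (2 * C * p) + exp (2 * C * q)"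
        by (simp add: exp_double[symmetric] mult.assoc)
    qed simp
    finally have "ennreal (exp (S_bar M n pp pm X)) \<le> ennreal (exp (- e) * (exp (2 * C * p) + exp (2 * C * q)))"
      by (rule ennreal_leI)
    also have "\<dots> = ennreal (exp (- e)) * (Z 1 X + Z (- 1) X)"
      unfolding Z_def using elim by (simp add: p_def q_def ennreal_mult)
    finally show ?case by simp
  qed
  then have "(\<integral>\<^sup>+X. ennreal (norm (exp (S_bar M n pp pm X))) \<partial>M) \<le> (\<integral>\<^sup>+X. ennreal (exp (- e)) * (Z 1 X + Z (- 1) X) \<partial>M)"
    by (rule nn_integral_mono_AE)
  also have "\<dots> = ennreal (exp (- e)) * ((\<integral>\<^sup>+X. Z 1 X \<partial>M) + (\<integral>\<^sup>+X. Z (- 1) X \<partial>M))"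
    using Z_meas by (simp add: nn_integral_cmult nn_integral_add)
  also have "\<dots> < \<infinity>"
    using Z_fin[of 1] Z_fin[of "- 1"] by (simp add: ennreal_mult_less_top)
  finally show "integrable M (\<lambda>X. exp (S_bar M n pp pm X))"
    by (rule integrableI_bounded[rotated])
      (rule measurable_compose[OF S_bar_meas borel_measurable_continuous_onI[OF continuous_on_exp[OF continuous_on_id]]])
qed

end

theorem proposition1p2:
  fixes z z' :: complex and n :: nat and pp pm :: "nat \<Rightarrow> real"
    and M :: "real set measure"
  assumes "admissible z z'"
    and "cmod (z + z') < 1"
    and "n \<ge> 1"
    and "\<And>i. i \<in> {1..n} \<Longrightarrow> pp i > 0"
    and "\<And>i. i \<in> {1..n} \<Longrightarrow> pm i < 0"
    and "inj_on pp {1..n}"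
    and "inj_on pm {1..n}"
    and "determinantal M (whittaker_kernel z z')"
  shows "(\<forall>\<delta>>0. integrable M (D_trunc n pp pm \<delta>)) \<and>
    (AE X in M. \<exists>L. (D_centred M n pp pm X \<longlongrightarrow> L) (at_right 0)) \<and>
    integrable M (\<lambda>X. exp (S_bar M n pp pm X))"
proof -
  obtain C where C: "C > 0" and bound: "\<And>x y. x * y > 0 \<Longrightarrow> cmod (whittaker_kernel z z' x y) \<le>
       C * (\<bar>x\<bar> powr (- 3/4) * exp (- \<bar>x\<bar> / 4)) * (\<bar>y\<bar> powr (- 3/4) * exp (- \<bar>y\<bar> / 4))"
    using whittaker_kernel_bound[OF assms(1,2)] by blast
  define \<phi> where "\<phi> x = sqrt C * (\<bar>x\<bar> powr (- 3/4) * exp (- \<bar>x\<bar> / 4))" for x :: real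
  have \<phi>2: "(\<phi> x)\<^sup>2 = C * (\<bar>x\<bar> powr (- 3/2) * exp (- \<bar>x\<bar> / 2))" for x
  proof -
    have "(\<bar>x\<bar> powr (- 3/4))\<^sup>2 = \<bar>x\<bar> powr (- 3/2)" by (simp add: power2_eq_square powr_add[symmetric])
    moreover have "(exp (- \<bar>x\<bar> / 4))\<^sup>2 = exp (- \<bar>x\<bar> / 2)" by (simp add: power2_eq_square exp_add[symmetric])
    ultimately show ?thesis using C by (simp only: \<phi>_def power_mult_distrib real_sqrt_pow2 less_imp_le)
  qed
  interpret dominated_determinantal M "whittaker_kernel z z'" \<phi>
  proof
    show "determinantal M (whittaker_kernel z z')" by (rule assms)
    show "\<phi> \<in> borel_measurable borel" unfolding \<phi>_def by measurable
    show "\<phi> x \<ge> 0" for x using C by (simp add: \<phi>_def)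
    show "cmod (whittaker_kernel z z' x y) \<le> \<phi> x * \<phi> y" if "x * y > 0" for x y
    proof -
      have "(sqrt C * p) * (sqrt C * q) = (sqrt C * sqrt C) * p * q" for p q by (simp only: mult_ac)
      then have "\<phi> x * \<phi> y = C * (\<bar>x\<bar> powr (- 3/4) * exp (- \<bar>x\<bar> / 4)) * (\<bar>y\<bar> powr (- 3/4) * exp (- \<bar>y\<bar> / 4))"
        unfolding \<phi>_def using C by simp
      then show ?thesis using bound[OF that] by simp
    qed
  qed
  have intensity_finite: "(\<integral>\<^sup>+x. ennreal (h x) \<partial>intensity) < \<infinity>"
    if h: "h \<in> borel_measurable borel" "\<And>x. h x \<ge> 0"
      and int: "integrable lborel (\<lambda>x. h x * (\<bar>x\<bar> powr (- 3/2) * exp (- \<bar>x\<bar> / 2)))" for h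
  proof -
    have "(\<integral>\<^sup>+x. ennreal (h x) \<partial>intensity) = (\<integral>\<^sup>+x. ennreal ((\<phi> x)\<^sup>2) * ennreal (h x) \<partial>lborel)"
      using h(1) by (intro nn_integral_intensity) measurable
    also have "\<dots> = (\<integral>\<^sup>+x. ennreal (C * (h x * (\<bar>x\<bar> powr (- 3/2) * exp (- \<bar>x\<bar> / 2)))) \<partial>lborel)"
      using C h(2) by (intro nn_integral_cong) (simp add: \<phi>2 ennreal_mult[symmetric] mult_ac)
    also have "\<dots> < \<infinity>"
      using int C h(2) by (subst nn_integral_eq_integral) auto
    finally show ?thesis .
  qed
  have log_fin: "(\<integral>\<^sup>+x. ennreal \<bar>side_log_ratio r a b x\<bar> \<partial>intensity) < \<infinity>"
    if "r \<in> {1, - 1}" "r * a > 0" "r * b < 0" for r a b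
    using integrable_side_log_ratio_decay[OF that] by (intro intensity_finite) auto
  have side_fin: "(\<integral>\<^sup>+x. ennreal (side_weight r x) \<partial>intensity) < \<infinity>" if r: "r \<in> {1, - 1}" for r
  proof (rule intensity_finite)
    have "integrable lborel (\<lambda>x. gamma_density (1/2) (1/2) (0 + r * x))"
      using r by (intro integrable_gamma_density_affine) auto
    then show "integrable lborel (\<lambda>x. side_weight r x * (\<bar>x\<bar> powr (- 3/2) * exp (- \<bar>x\<bar> / 2)))"
    proof (rule Bochner_Integration.integrable_bound)
      show "AE x in lborel. norm (side_weight r x * (\<bar>x\<bar> powr (- 3/2) * exp (- \<bar>x\<bar> / 2))) \<le>
          norm (gamma_density (1/2) (1/2) (0 + r * x))"
        using side_weight_decay_bound[OF r] gamma_density_nonneg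
        by (intro AE_I2) (simp add: side_weight_def)
    qed measurable
  qed (auto simp: side_weight_def)
  show ?thesis
  proof (intro conjI)
    show "\<forall>\<delta>>0. integrable M (D_trunc n pp pm \<delta>)"
      by (rule regularised_functional(1); (rule assms(4) | rule assms(5) | rule log_fin | rule side_fin); assumption)
    show "AE X in M. \<exists>L. (D_centred M n pp pm X \<longlongrightarrow> L) (at_right 0)"
      by (rule regularised_functional(2); (rule assms(4) | rule assms(5) | rule log_fin | rule side_fin); assumption)
    show "integrable M (\<lambda>X. exp (S_bar M n pp pm X))"
      by (rule regularised_functional(3); (rule assms(4) | rule assms(5) | rule log_fin | rule side_fin); assumption)
  qed
qed

end
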